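(* Let $q$ be a power of a prime $p$. For $b\in\mathbb{F}_{q^4}$ let $U(b)=\{(x,bx^q+x^{q^3}) : x\in\mathbb{F}_{q^4}\}$ and let $L_{U(b)}$ be the associated $\mathbb{F}_q$-linear set of $\mathrm{PG}(1,q^4)$. (i) For any $b,c\in\mathbb{F}_{q^4}$, $L_{U(b)}$ and $L_{U(c)}$ are equivalent up to an element of $\mathrm{P\Gamma L}(2,q^4)$ if and only if $c^{q^2+1}=b^{\pm p^s(q^2+1)}$ for some integer $s\geq 0$ (and some choice of the sign). (ii) For any $b,c\in\mathbb{F}_{q^4}$, the linear sets $L_{U(b)}$ and $L_{U(c)}$ are projectively equivalent if and only if $c^{q^2+1}=b^{q^2+1}$ or $c^{q^2+1}=b^{-q(q^2+1)}$. (iii) All linear sets $L_{U(b)}$ with $b\in\mathbb{F}_{q^4}$, $\mathrm{N}_{q^4/q^2}(b)=1$, are projectively equivalent. (iv) There are precisely $q(q-1)/2$ distinct linear sets up to projective equivalence in the family of all $L_{U(b)}$ with $b\in\mathbb{F}_{q^4}$, $\mathrm{N}_{q^4/q}(b)\neq 1$, and, up to projective equivalence, these are the only maximum scattered $\mathbb{F}_q$-linear sets of $\mathrm{PG}(1,q^4)$. (v) There are precisely $q$ distinct linear sets up to projective equivalence in the family of all $L_{U(b)}$ with $b\in\mathbb{F}_{q^4}$, $\mathrm{N}_{q^4/q^2}(b)\neq 1$ and $\mathrm{N}_{q^4/q}(b)=1$.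
   Context: Points of $\mathrm{PG}(1,q^4)$ are the one-dimensional $\mathbb{F}_{q^4}$-subspaces $\langle \mathbf v\rangle_{\mathbb{F}_{q^4}}$, $\mathbf v\neq\mathbf 0$, of $\mathbb{F}_{q^4}^2$. For an $\mathbb{F}_q$-subspace $U$ of $\mathbb{F}_{q^4}^2$, the associated $\mathbb{F}_q$-linear set is $L_U=\{\langle \mathbf v\rangle_{\mathbb{F}_{q^4}} : \mathbf v\in U\setminus\{\mathbf 0\}\}$; its rank is $\dim_{\mathbb{F}_q}U$. $L_U$ is scattered if $\dim_{\mathbb{F}_q}(U\cap P)=1$ for every point $P\in L_U$; it is maximum scattered if it is scattered and has rank $4$. Two point sets of $\mathrm{PG}(1,q^4)$ are projectively equivalent if an element of $\mathrm{PGL}(2,q^4)$ maps one onto the other, and equivalent up to an element of $\mathrm{P\Gamma L}(2,q^4)$ if such an element (collineation induced by an invertible semilinear map of $\mathbb{F}_{q^4}^2$) maps one onto the other. $\mathrm{N}_{q^4/q}(b)=b^{1+q+q^2+q^3}$ and $\mathrm{N}_{q^4/q^2}(b)=b^{q^2+1}$. Convention: when $b=0$, conditions involving a negative power of $b$ are regarded as not satisfied. *)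

theory Defs
  imports "HOL-Analysis.Determinants" "HOL-Computational_Algebra.Primes"
begin

text \<open>
  The field \<open>F_{q^4}\<close> is a finite field type \<open>'a\<close> with \<open>q^4\<close> elements, and \<open>F_q\<close> is a finite field
  type \<open>'k\<close> with \<open>q\<close> elements, regarded as a subfield of \<open>'a\<close> along an embedding \<open>\<iota> :: 'k \<Rightarrow> 'a\<close>.
  With \<open>F_q\<close> as a scalar type, the subspaces and dimensions over it are those of the library.
\<close>

definition field_embedding :: "('k::field \<Rightarrow> 'a::field) \<Rightarrow> bool" where
  "field_embedding \<iota> \<longleftrightarrow> \<iota> 1 = 1 \<and> (\<forall>x y. \<iota> (x + y) = \<iota> x + \<iota> y) \<and> (\<forall>x y. \<iota> (x * y) = \<iota> x * \<iota> y)"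

definition sub_scale :: "('k::field \<Rightarrow> 'a::field) \<Rightarrow> 'k \<Rightarrow> 'a ^ 2 \<Rightarrow> 'a ^ 2" where
  "sub_scale \<iota> c v = \<iota> c *s v"

lemma vector_space_sub_scale:
  assumes "field_embedding \<iota>"
  shows "vector_space (sub_scale \<iota>)"
  using assms unfolding field_embedding_def sub_scale_def
  by unfold_locales (auto simp: vec_eq_iff algebra_simps)

abbreviation sub_subspace :: "('k::field \<Rightarrow> 'a::field) \<Rightarrow> ('a ^ 2) set \<Rightarrow> bool" where
  "sub_subspace \<iota> \<equiv> module.subspace (sub_scale \<iota>)"

abbreviation sub_dim :: "('k::field \<Rightarrow> 'a::field) \<Rightarrow> ('a ^ 2) set \<Rightarrow> nat" where
  "sub_dim \<iota> \<equiv> vector_space.dim (sub_scale \<iota>)"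

text \<open>A point of the projective line is the set of vectors of a one-dimensional subspace of
  \<^typ>\<open>'a::field ^ 2\<close>.\<close>

definition linear_set :: "('a::field ^ 2) set \<Rightarrow> ('a ^ 2) set set" where
  "linear_set U = {vec.span {v} | v. v \<in> U - {0}}"

definition scattered :: "('k::field \<Rightarrow> 'a::field) \<Rightarrow> ('a ^ 2) set \<Rightarrow> bool" where
  "scattered \<iota> U \<longleftrightarrow> (\<forall>P \<in> linear_set U. sub_dim \<iota> (U \<inter> P) = 1)"

definition max_scattered_linear_set :: "('k::field \<Rightarrow> 'a::field) \<Rightarrow> ('a ^ 2) set set \<Rightarrow> bool" where
  "max_scattered_linear_set \<iota> X \<longleftrightarrow>
     (\<exists>U. sub_subspace \<iota> U \<and> X = linear_set U \<and> scattered \<iota> U \<and> sub_dim \<iota> U = 4)"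

definition semilinear :: "('a::field ^ 2 \<Rightarrow> 'a ^ 2) \<Rightarrow> bool" where
  "semilinear f \<longleftrightarrow> (\<exists>\<sigma>. field_embedding \<sigma> \<and> bij \<sigma> \<and>
     (\<forall>v w. f (v + w) = f v + f w) \<and> (\<forall>c v. f (c *s v) = \<sigma> c *s f v))"

text \<open>\<open>proj_equiv\<close> is equivalence under \<open>PGL(2,q^4)\<close> and \<open>semilin_equiv\<close> equivalence under \<open>P\<Gamma>L(2,q^4)\<close>;
  a map of vectors acts on points by taking images.\<close>

definition proj_equiv :: "('a::field ^ 2) set set \<Rightarrow> ('a ^ 2) set set \<Rightarrow> bool" where
  "proj_equiv X Y \<longleftrightarrow> (\<exists>f. Vector_Spaces.linear (*s) (*s) f \<and> bij f \<and> (\<lambda>P. f ` P) ` X = Y)"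

definition semilin_equiv :: "('a::field ^ 2) set set \<Rightarrow> ('a ^ 2) set set \<Rightarrow> bool" where
  "semilin_equiv X Y \<longleftrightarrow> (\<exists>f. semilinear f \<and> bij f \<and> (\<lambda>P. f ` P) ` X = Y)"

definition num_up_to_proj_equiv :: "('a::field ^ 2) set set set \<Rightarrow> nat" where
  "num_up_to_proj_equiv \<F> = card (\<F> // {(X, Y). X \<in> \<F> \<and> Y \<in> \<F> \<and> proj_equiv X Y})"

definition U_set :: "nat \<Rightarrow> 'a::field \<Rightarrow> ('a ^ 2) set" where
  "U_set q b = {vector [x, b * x ^ q + x ^ (q ^ 3)] | x. True}"

abbreviation L_set :: "nat \<Rightarrow> 'a::field \<Rightarrow> ('a ^ 2) set set" where
  "L_set q b \<equiv> linear_set (U_set q b)"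

text \<open>The norms from \<open>F_{q^4}\<close> to \<open>F_q\<close> and to \<open>F_{q^2}\<close>.\<close>

definition norm_q :: "nat \<Rightarrow> 'a::field \<Rightarrow> 'a" where
  "norm_q q b = b ^ (1 + q + q ^ 2 + q ^ 3)"

definition norm_q2 :: "nat \<Rightarrow> 'a::field \<Rightarrow> 'a" where
  "norm_q2 q b = b ^ (q ^ 2 + 1)"

end

theory Submission
  imports Defs "HOL-Computational_Algebra.Polynomial"
begin

text \<open>
  Write \<open>F\<close> for the field of order \<open>q\<^sup>4\<close> and \<open>\<beta> = b\<^bsup>q\<^sup>2+1\<^esup>\<close>. A point \<open>(1, m)\<close> lies on the linear set of
  \<open>U(b)\<close> iff \<open>b x\<^sup>q + x\<^bsup>q\<^sup>3\<^esup> = m x\<close> has a nonzero solution, that is, iff the Dickson determinant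
  \<open>N(m) - Tr(b\<^bsup>q\<^sup>2\<^esup> m\<^bsup>q+1\<^esup>) - (1 - \<beta>) (1 - \<beta>\<^sup>q)\<close> vanishes (\<open>span_in_L_set_iff\<close>).

  \<^emph>\<open>Equivalence.\<close> The Dickson determinant is a polynomial in \<open>m\<close> of degree \<open>1 + q + q\<^sup>2 + q\<^sup>3\<close> with
  values in the field of order \<open>q\<close>. The bound on the degree makes the polynomial, up to a scalar,
  recoverable from the set of its zeros, so a projectivity between two linear sets transforms one
  determinant into a multiple of the other. The exponents are sums of distinct powers of \<open>q\<close>, so
  this is an identity between forms that are linear in four independent vectors, the matrix acting on
  them by its four conjugates (\<open>proj_equiv_imp_forms_proportional\<close>). Invariant theory of
  \<open>2 \<times> 2 \<times> 2 \<times> 2\<close> arrays then decides the question. If \<open>N(b) \<noteq> 1\<close>, Cayley's hyperdeterminant of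
  the partial arrays shows that the matrix is diagonal or antidiagonal, and comparing coefficients
  leaves \<open>\<gamma> = \<beta>\<close> or \<open>\<gamma> = \<beta>\<^bsup>-q\<^esup>\<close> for \<open>\<gamma> = c\<^bsup>q\<^sup>2+1\<^esup>\<close>. If \<open>N(b) = 1\<close>, the form is made of bilinear forms
  of neighbouring slots, which the matrix preserves up to factors whose norms can be computed, and
  the result is \<open>\<gamma> = \<beta>\<close>. Conversely, scaling \<open>x\<close> realizes \<open>\<gamma> = \<beta>\<close> by Hilbert 90, and passing to the
  adjoint polynomial, which has the same determinant, realizes \<open>\<gamma> = \<beta>\<^bsup>-q\<^esup>\<close>. A semilinear map only
  replaces \<open>\<beta>\<close> by its image under an automorphism, which is some \<open>\<beta>\<^bsup>p^s\<^esup>\<close>.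

  \<^emph>\<open>Classification.\<close> Let \<open>U\<close> be scattered of rank four. The functionals \<open>w \<mapsto> u \<cdot> w\<close> form a plane in
  the four-dimensional \<open>F\<close>-space of all \<open>q\<close>-linear maps from \<open>U\<close> to \<open>F\<close>, on which Frobenius acts
  semilinearly. Scatteredness means that a nonzero functional of this plane has a small kernel, hence
  many values, and so satisfies no short linearized relation (\<open>scattered_no_short_relation\<close>).
  Therefore the plane and its image under the square of Frobenius are complementary, and Frobenius is
  described by two semilinear maps \<open>G\<close>, \<open>H\<close> of the plane with \<open>G\<^sup>2 + H\<^sup>2 = 0\<close> and \<open>G H + H G = 1\<close>.
  Such a pair always has a vector \<open>u\<close> with \<open>G u\<close> parallel to \<open>H u\<close> (\<open>ex_parallel_images\<close>), and this
  says exactly that with the coordinate \<open>y = u \<cdot> w\<close> the plane contains a combination of \<open>y\<^sup>q\<close> and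
  \<open>y\<^bsup>q\<^sup>3\<^esup>\<close>: up to a projectivity, \<open>U\<close> is some \<open>U(b)\<close> or \<open>{(y\<^sup>q, y)}\<close>, which is \<open>U(0)\<close>. Finally, \<open>U(b)\<close> is
  scattered iff \<open>N(b) \<noteq> 1\<close>: a comparison of norms gives one direction, an explicit short relation the
  other.

  \<^emph>\<open>Counting.\<close> As \<open>b\<close> varies, \<open>\<beta>\<close> takes every value in the field of order \<open>q\<^sup>2\<close>, and \<open>N(b) = \<beta>\<^bsup>q+1\<^esup>\<close>; the
  classes are the orbits of \<open>\<beta> \<mapsto> \<beta>\<^bsup>-q\<^esup>\<close>, with \<open>0\<close> fixed.
\<close>

section \<open>Powers, roots and the Frobenius map in a finite field\<close>

(* The first power of Frobenius is written with the index 1, which must not turn into Suc 0. *)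
declare One_nat_def [simp del]

lemma power_card_finite_field:
  fixes x :: "'a::{field,finite}"
  shows "x ^ CARD('a) = x"
proof (cases "x = 0")
  case False
  let ?U = "UNIV - {0 :: 'a}"
  have "bij_betw (\<lambda>y. x * y) ?U ?U"
    by (rule bij_betw_byWitness[where f' = "\<lambda>y. y / x"]) (use False in auto)
  hence "(\<Prod>y\<in>?U. x * y) = \<Prod>?U" by (rule prod.reindex_bij_betw)
  hence "x ^ card ?U * \<Prod>?U = 1 * \<Prod>?U" by (simp add: prod.distrib)
  hence x: "x ^ card ?U = 1" by (simp only: mult_cancel_right) simp
  have "CARD('a) = Suc (card ?U)" using finite_UNIV_card_ge_0[where ?'a = 'a]
    by (simp add: card_Diff_singleton)
  thus ?thesis by (simp only: power_Suc x mult_1_right)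
qed simp

lemma card_roots_le:
  fixes P :: "'a::{field,finite} poly"
  assumes "P \<noteq> 0" "degree P \<le> n" "\<And>x. x \<in> A \<Longrightarrow> poly P x = 0"
  shows "card A \<le> n"
proof -
  have "card A \<le> card {x. poly P x = 0}"
    by (intro card_mono poly_roots_finite assms(1)) (use assms(3) in auto)
  also have "\<dots> \<le> degree P" by (rule card_poly_roots_bound[OF assms(1)])
  finally show ?thesis using assms(2) by simp
qed

lemma card_power_eq_le:
  fixes c :: "'a::{field,finite}"
  assumes "n > 0"
  shows "card {x. x ^ n = c} \<le> n"
proof (rule card_roots_le[where P = "monom 1 n - [:c:]"])
  have d: "degree (monom (1::'a) n - [:c:]) = n"
    using assms by (simp add: diff_conv_add_uminus degree_add_eq_left degree_monom_eq
        del: add_uminus_conv_diff)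
  with assms show "monom 1 n - [:c:] \<noteq> 0" by (metis degree_0 less_numeral_extra(3))
  from d show "degree (monom 1 n - [:c:]) \<le> n" by simp
qed (simp add: poly_monom)

text \<open>Both facts express that the multiplicative group is cyclic. They follow by counting:
  raising to the power \<open>m\<close> maps the \<open>n * m\<close> units to roots of unity of order \<open>n\<close>, with fibres
  of size at most \<open>m\<close>, while there are at most \<open>n\<close> such roots; so all bounds are attained.\<close>

lemma
  fixes c :: "'a::{field,finite}"
  assumes nm: "n * m = CARD('a) - 1"
  shows card_roots_of_unity: "card {x::'a. x ^ n = 1} = n"
    and root_of_unity_is_power: "c ^ n = 1 \<Longrightarrow> \<exists>w. w ^ m = c"
proof -
  have card1: "CARD('a) > 1"
    using card_mono[of UNIV "{0,1::'a}"] by simp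
  with nm have pos: "n > 0" "m > 0" by (auto intro: Nat.gr0I)
  let ?R = "{x::'a. x ^ n = 1}" and ?I = "(\<lambda>w::'a. w ^ m) ` (UNIV - {0})"
  have unit: "w ^ (m * n) = 1" if "w \<noteq> 0" for w :: 'a
  proof -
    have "w * w ^ (m * n) = w ^ CARD('a)"
      using nm card1 by (metis Suc_diff_1 less_trans mult.commute power_Suc zero_less_one)
    with that show ?thesis by (simp add: power_card_finite_field)
  qed
  have sub: "?I \<subseteq> ?R" using unit by (auto simp: power_mult)
  have "n * m = card (UNIV - {0::'a})" using nm by (simp add: card_Diff_singleton)
  also have "UNIV - {0} = (\<Union>y\<in>?I. {w. w ^ m = y \<and> w \<noteq> 0})" by auto
  also have "card \<dots> \<le> (\<Sum>y\<in>?I. card {w::'a. w ^ m = y \<and> w \<noteq> 0})"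
    by (rule card_UN_le) simp
  also have "\<dots> \<le> (\<Sum>y\<in>?I. m)"
  proof (rule sum_mono)
    fix y :: 'a
    have "card {w. w ^ m = y \<and> w \<noteq> 0} \<le> card {w. w ^ m = y}" by (rule card_mono) auto
    also have "\<dots> \<le> m" by (rule card_power_eq_le[OF pos(2)])
    finally show "card {w. w ^ m = y \<and> w \<noteq> 0} \<le> m" .
  qed
  finally have ge: "n \<le> card ?I" using pos by simp
  have le: "card ?R \<le> n" by (rule card_power_eq_le[OF pos(1)])
  have "card ?I \<le> card ?R" by (rule card_mono[OF _ sub]) simp
  with ge le show "card ?R = n" by simp
  have eq: "?I = ?R"
    by (rule card_seteq[OF _ sub]) (use ge le in auto)
  show "\<exists>w. w ^ m = c" if "c ^ n = 1"
  proof -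
    from that have "c \<in> ?I" unfolding eq by simp
    thus ?thesis by blast
  qed
qed

lemma CHAR_eq_prime:
  assumes "prime p" "CARD('a::{field,finite}) = p ^ n"
  shows "CHAR('a) = p"
proof -
  have "(\<Sum>x\<in>(UNIV::'a set). x + 1) = (\<Sum>x\<in>UNIV. x)"
    by (rule sum.reindex_bij_witness[of _ "\<lambda>y. y - 1" "\<lambda>y. y + 1"]) auto
  hence "of_nat CARD('a) = (0::'a)" by (simp add: sum.distrib)
  hence "(of_nat p :: 'a) = 0" by (simp add: assms(2))
  hence dvd: "CHAR('a) dvd p" by (simp add: of_nat_eq_0_iff_char_dvd)
  have "of_nat 1 \<noteq> (0::'a)" by simp
  hence "CHAR('a) \<noteq> 1" by (metis of_nat_CHAR)
  with dvd assms(1) show ?thesis by (metis prime_nat_iff)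
qed

locale quartic_extension =
  fixes \<iota> :: "'k::{field,finite} \<Rightarrow> 'a::{field,finite}" and p h q :: nat
  assumes prime_p: "prime p" and h1: "h \<ge> 1" and q_def: "q = p ^ h"
    and card_k: "CARD('k) = q" and card_a: "CARD('a) = q ^ 4" and emb: "field_embedding \<iota>"
begin

lemma q_ge_2: "q \<ge> 2"
proof -
  have "p \<ge> 2" by (rule prime_ge_2_nat[OF prime_p])
  also have "p ^ 1 \<le> p ^ h" by (rule power_increasing) (use h1 \<open>p \<ge> 2\<close> in auto)
  finally show ?thesis by (simp add: q_def)
qed

lemma q_pos [simp]: "q > 0" "0 < q ^ n"
  using q_ge_2 by auto

lemma q_power_less: "i < j \<Longrightarrow> q ^ i < q ^ j"
  using q_ge_2 by (intro power_strict_increasing) auto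

lemma CHAR_a: "CHAR('a) = p"
  by (rule CHAR_eq_prime[OF prime_p, where n = "h * 4"]) (simp add: card_a q_def power_mult)

lemma add_power_p: "(x + y :: 'a) ^ (p ^ n) = x ^ (p ^ n) + y ^ (p ^ n)"
  by (rule freshmans_dream'[where n = n]) (simp_all add: CHAR_a prime_p)

definition frob :: "nat \<Rightarrow> 'a \<Rightarrow> 'a" where
  "frob i x = x ^ (q ^ i)"

lemma frob_add [simp]: "frob i (x + y) = frob i x + frob i y"
proof -
  have "q ^ i = p ^ (h * i)" by (simp add: q_def power_mult)
  thus ?thesis by (simp add: frob_def add_power_p)
qed

lemma frob_0 [simp]: "frob i 0 = 0" and frob_1 [simp]: "frob i 1 = 1"
  by (simp_all add: frob_def)

lemma frob_minus [simp]: "frob i (- x) = - frob i x"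
  by (metis add.right_inverse add_eq_0_iff frob_0 frob_add)

lemma frob_diff [simp]: "frob i (x - y) = frob i x - frob i y"
  using frob_add[of i x "- y"] by simp

lemma frob_mult [simp]: "frob i (x * y) = frob i x * frob i y"
  by (simp add: frob_def power_mult_distrib)

lemma frob_inverse [simp]: "frob i (inverse x) = inverse (frob i x)"
  by (simp add: frob_def power_inverse)

lemma frob_divide [simp]: "frob i (x / y) = frob i x / frob i y"
  by (simp add: divide_inverse)

lemma frob_power [simp]: "frob i (x ^ n) = frob i x ^ n"
  by (simp add: frob_def mult.commute flip: power_mult)

lemma frob_frob [simp]: "frob i (frob j x) = frob (i + j) x"
  by (simp add: frob_def power_add mult.commute flip: power_mult)

lemma frob_zero_index [simp]: "frob 0 x = x"
  by (simp add: frob_def)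

lemma frob_eq_0_iff [simp]: "frob i x = 0 \<longleftrightarrow> x = 0"
  by (simp add: frob_def)

lemma frob_inj [simp]: "frob i x = frob i y \<longleftrightarrow> x = y"
  by (metis frob_diff frob_eq_0_iff right_minus_eq)

lemma frob_4 [simp]: "frob 4 x = x"
  using power_card_finite_field[of x] by (simp add: frob_def card_a)

lemma frob_ge_4 [simp]: "frob 5 x = frob 1 x" "frob 6 x = frob 2 x" "frob 7 x = frob 3 x"
  "frob (4 + n) x = frob n x" "frob (n + 4) x = frob n x"
  using frob_frob[of 1 4 x] frob_frob[of 2 4 x] frob_frob[of 3 4 x] frob_frob[of n 4 x]
  by (simp_all add: add.commute)

lemma power_q_eqs: "x ^ q = frob 1 x" "x ^ (q ^ 2) = frob 2 x" "x ^ (q ^ 3) = frob 3 x"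
  by (simp_all add: frob_def)

lemma norm_q2_eq: "norm_q2 q b = b * frob 2 b"
  by (simp add: norm_q2_def frob_def power_add mult.commute)

lemma norm_q_eq: "norm_q q b = b * frob 1 b * frob 2 b * frob 3 b"
  by (simp add: norm_q_def frob_def power_add)

text \<open>A nonzero linearized polynomial of degree at most \<open>q\<^sup>2\<close> has at most \<open>q\<^sup>2\<close> roots; one of degree
  at most \<open>q\<^sup>3\<close> cannot vanish on a field with \<open>q\<^sup>4\<close> elements.\<close>

lemma card_linearized_kernel_le:
  assumes "(a0, a1, a2) \<noteq> (0, 0, 0)"
    and "\<And>x. x \<in> A \<Longrightarrow> a0 * x + a1 * frob 1 x + a2 * frob 2 x = 0"
  shows "card A \<le> q ^ 2"
proof (rule card_roots_le[where P = "monom a0 1 + monom a1 q + monom a2 (q ^ 2)"])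
  have ne: "1 < q" "q < q ^ 2" "1 < q ^ 2"
    using q_power_less[of 0 1] q_power_less[of 1 2] q_power_less[of 0 2] by auto
  show "monom a0 1 + monom a1 q + monom a2 (q ^ 2) \<noteq> 0" (is "?P \<noteq> 0")
  proof
    assume "?P = 0"
    hence "coeff ?P 1 = 0" "coeff ?P q = 0" "coeff ?P (q ^ 2) = 0" by simp_all
    with ne assms(1) show False by (auto simp: if_splits)
  qed
  show "degree ?P \<le> q ^ 2"
    by (intro degree_add_le order.trans[OF degree_monom_le]) (use ne in auto)
qed (use assms(2) in \<open>simp_all add: poly_monom frob_def\<close>)

lemma ex_linearized_nonzero:
  assumes "(a0, a1, a2, a3) \<noteq> (0, 0, 0, 0)"
  shows "\<exists>x. a0 * x + a1 * frob 1 x + a2 * frob 2 x + a3 * frob 3 x \<noteq> 0"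
proof (rule ccontr)
  assume *: "\<not> ?thesis"
  let ?P = "monom a0 1 + monom a1 q + monom a2 (q ^ 2) + monom a3 (q ^ 3)"
  have ne: "1 < q" "q < q ^ 2" "q ^ 2 < q ^ 3" "q ^ 3 < q ^ 4" "1 < q ^ 2" "1 < q ^ 3" "q < q ^ 3"
    using q_power_less[of 0 1] q_power_less[of 1 2] q_power_less[of 2 3] q_power_less[of 3 4]
      q_power_less[of 0 2] q_power_less[of 0 3] q_power_less[of 1 3] by auto
  have "CARD('a) \<le> q ^ 3"
  proof (rule card_roots_le[where P = ?P])
    show "?P \<noteq> 0"
    proof
      assume "?P = 0"
      hence "coeff ?P 1 = 0" "coeff ?P q = 0" "coeff ?P (q ^ 2) = 0" "coeff ?P (q ^ 3) = 0"
        by simp_all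
      with ne assms(1) show False by (auto simp: if_splits)
    qed
    show "degree ?P \<le> q ^ 3"
      by (intro degree_add_le order.trans[OF degree_monom_le]) (use ne in auto)
  qed (use * in \<open>simp_all add: poly_monom frob_def\<close>)
  with ne card_a show False by simp
qed

lemma card_a_minus_1: "(q ^ 2 + 1) * (q ^ 2 - 1) = CARD('a) - 1"
proof -
  have "(q ^ 2 + 1) * (q ^ 2 - 1) = (q ^ 2) ^ 2 - 1" 
    by (simp add: diff_mult_distrib2 add_mult_distrib power2_eq_square)
  thus ?thesis by (simp add: card_a flip: power_mult)
qed

lemma frob_2_fixed_iff: "frob 2 x = x \<longleftrightarrow> x = 0 \<or> x ^ (q ^ 2 - 1) = 1"
proof -
  have "frob 2 x = x * x ^ (q ^ 2 - 1)"
    by (simp add: frob_def flip: power_Suc)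
  thus ?thesis by auto
qed

lemma frob_1_fixed_iff: "frob 1 x = x \<longleftrightarrow> x = 0 \<or> x ^ (q - 1) = 1"
proof -
  have "frob 1 x = x * x ^ (q - 1)"
    by (simp add: frob_def flip: power_Suc)
  thus ?thesis by auto
qed

lemma norm_q2_surj:
  assumes "frob 2 x = x"
  shows "\<exists>b. b * frob 2 b = x"
proof (cases "x = 0")
  case False
  with assms have "x ^ (q ^ 2 - 1) = 1" by (simp add: frob_2_fixed_iff)
  then obtain b where "b ^ (q ^ 2 + 1) = x"
    using root_of_unity_is_power[of "q ^ 2 - 1" "q ^ 2 + 1" x] card_a_minus_1 
    by (auto simp: mult.commute)
  thus ?thesis by (auto simp: frob_def power_add mult.commute)
qed (auto intro: exI[of _ 0])

text \<open>Hilbert's Theorem 90 for the extension of degree two: the twisted trace of a suitable element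
  is the required one.\<close>

lemma hilbert_90_q2:
  assumes "u * frob 2 u = 1"
  shows "\<exists>w. w \<noteq> 0 \<and> w = u * frob 2 w"
proof -
  from ex_linearized_nonzero[of 1 0 u 0] obtain z where z: "z + u * frob 2 z \<noteq> 0" by auto
  have "u * frob 2 (z + u * frob 2 z) = u * frob 2 z + (u * frob 2 u) * z"
    by (simp add: algebra_simps)
  with z assms show ?thesis by (intro exI[of _ "z + u * frob 2 z"]) auto
qed

lemma norm_q_minus_1: "(q ^ 2 + 1) * (q + 1) * (q - 1) = CARD('a) - 1"
proof -
  have "(q + 1) * (q - 1) = q ^ 2 - 1"
    by (simp add: diff_mult_distrib2 add_mult_distrib power2_eq_square)
  thus ?thesis using card_a_minus_1 by (simp add: mult.assoc)
qed

lemma power_q_plus_1_surj: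
  assumes "y \<noteq> 0" and "frob 1 (y * frob 2 y) = y * frob 2 y"
  shows "\<exists>x. x * frob 1 x = y"
proof -
  have "y * frob 2 y = y ^ (q ^ 2 + 1)" by (simp add: frob_def power_add mult.commute)
  with assms frob_1_fixed_iff[of "y ^ (q ^ 2 + 1)"] have "(y ^ (q ^ 2 + 1)) ^ (q - 1) = 1"
    by (simp del: frob_power frob_mult)
  hence "y ^ ((q ^ 2 + 1) * (q - 1)) = 1" by (simp only: power_mult)
  then obtain w where "w ^ (q + 1) = y"
    using root_of_unity_is_power[of "(q ^ 2 + 1) * (q - 1)" "q + 1" y] norm_q_minus_1
    by (auto simp: mult_ac)
  thus ?thesis by (auto simp: frob_def power_add mult.commute)
qed

lemma iota_simps [simp]:
  "\<iota> (x + y) = \<iota> x + \<iota> y" "\<iota> (x * y) = \<iota> x * \<iota> y" "\<iota> 1 = 1" "\<iota> 0 = 0"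
proof -
  have add: "\<iota> (x + y) = \<iota> x + \<iota> y" for x y
    using emb by (auto simp: field_embedding_def)
  thus "\<iota> (x + y) = \<iota> x + \<iota> y" .
  show "\<iota> (x * y) = \<iota> x * \<iota> y" "\<iota> 1 = 1"
    using emb by (auto simp: field_embedding_def)
  from add[of 0 0] show "\<iota> 0 = 0" by (metis add.right_neutral add_left_imp_eq)
qed

lemma iota_diff [simp]: "\<iota> (x - y) = \<iota> x - \<iota> y"
  by (metis add_diff_cancel_right' diff_add_cancel iota_simps(1))

lemma iota_eq_0_iff [simp]: "\<iota> x = 0 \<longleftrightarrow> x = 0"
proof
  assume "\<iota> x = 0"
  show "x = 0"
  proof (rule ccontr)
    assume "x \<noteq> 0"
    hence "\<iota> (x * inverse x) = 1" by (simp del: iota_simps(2))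
    with \<open>\<iota> x = 0\<close> show False by simp
  qed
qed simp

lemma inj_iota: "inj \<iota>"
  by (rule injI) (metis iota_diff iota_eq_0_iff right_minus_eq)

lemma iota_power [simp]: "\<iota> (x ^ n) = \<iota> x ^ n"
  by (induction n) auto

lemma frob_iota [simp]: "frob i (\<iota> x) = \<iota> x"
proof (induction i)
  case (Suc i)
  have "frob (Suc i) (\<iota> x) = frob 1 (frob i (\<iota> x))"
    by (simp add: Suc_eq_plus1 add.commute)
  also have "\<dots> = \<iota> (x ^ q)" by (simp only: Suc) (simp add: frob_def)
  also have "x ^ q = x" using power_card_finite_field[of x] by (simp add: card_k)
  finally show ?case .
qed simp

lemma range_iota: "range \<iota> = {x. frob 1 x = x}"
proof (rule card_seteq)
  have "card (range \<iota>) = q" using card_image[OF inj_iota] card_k by simp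
  moreover have "card {x. frob 1 x = x} \<le> q"
  proof (rule card_roots_le[where P = "monom 1 q - monom 1 1"])
    have "coeff (monom (1::'a) q - monom 1 1) q = 1" using q_ge_2 by simp
    thus "monom (1::'a) q - monom 1 1 \<noteq> 0" by (metis coeff_0 zero_neq_one)
    show "degree (monom (1::'a) q - monom 1 1) \<le> q"
      by (intro degree_diff_le order.trans[OF degree_monom_le]) (use q_ge_2 in auto)
  qed (simp add: poly_monom frob_def)
  ultimately show "card {x. frob 1 x = x} \<le> card (range \<iota>)" by simp
qed auto

end

section \<open>The Dickson form of a linear set\<close>

text \<open>For \<open>X\<^sub>i = 1\<close> and \<open>Y\<^sub>i\<close>, \<open>b\<^sub>i\<close> the conjugates of \<open>m\<close>, \<open>b\<close>, this is the determinant of the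
  Dickson matrix of \<open>b x\<^sup>q + x\<^bsup>q\<^sup>3\<^esup> - m x\<close>. Making the four conjugates independent turns it into a form
  that is linear in each of the four vectors \<open>(X\<^sub>i, Y\<^sub>i)\<close>.\<close>

definition dickson_form ::
  "'a::comm_ring_1 \<Rightarrow> 'a \<Rightarrow> 'a \<Rightarrow> 'a \<Rightarrow> 'a \<Rightarrow> 'a \<Rightarrow> 'a \<Rightarrow> 'a \<Rightarrow> 'a \<Rightarrow> 'a \<Rightarrow> 'a \<Rightarrow> 'a \<Rightarrow> 'a"
where
  "dickson_form b0 b1 b2 b3 X0 Y0 X1 Y1 X2 Y2 X3 Y3 =
     Y0 * Y1 * Y2 * Y3
     - b0 * X0 * X1 * Y2 * Y3 - b1 * X1 * X2 * Y3 * Y0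
     - b2 * X2 * X3 * Y0 * Y1 - b3 * X3 * X0 * Y1 * Y2
     - (1 - b0 * b2) * (1 - b1 * b3) * X0 * X1 * X2 * X3"

lemma dickson_form_linear:
  "dickson_form b0 b1 b2 b3 (X * a + X' * c) (Y * a + Y' * c) X1 Y1 X2 Y2 X3 Y3 =
     a * dickson_form b0 b1 b2 b3 X Y X1 Y1 X2 Y2 X3 Y3 + c * dickson_form b0 b1 b2 b3 X' Y' X1 Y1 X2 Y2 X3 Y3"
  "dickson_form b0 b1 b2 b3 X0 Y0 (X * a + X' * c) (Y * a + Y' * c) X2 Y2 X3 Y3 =
     a * dickson_form b0 b1 b2 b3 X0 Y0 X Y X2 Y2 X3 Y3 + c * dickson_form b0 b1 b2 b3 X0 Y0 X' Y' X2 Y2 X3 Y3"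
  "dickson_form b0 b1 b2 b3 X0 Y0 X1 Y1 (X * a + X' * c) (Y * a + Y' * c) X3 Y3 =
     a * dickson_form b0 b1 b2 b3 X0 Y0 X1 Y1 X Y X3 Y3 + c * dickson_form b0 b1 b2 b3 X0 Y0 X1 Y1 X' Y' X3 Y3"
  "dickson_form b0 b1 b2 b3 X0 Y0 X1 Y1 X2 Y2 (X * a + X' * c) (Y * a + Y' * c) =
     a * dickson_form b0 b1 b2 b3 X0 Y0 X1 Y1 X2 Y2 X Y + c * dickson_form b0 b1 b2 b3 X0 Y0 X1 Y1 X2 Y2 X' Y'"
  by (simp_all add: dickson_form_def algebra_simps)

lemma dickson_form_std:
  "dickson_form b0 b1 b2 b3 X0 Y0 X1 Y1 X2 Y2 X3 Y3 = X0 * dickson_form b0 b1 b2 b3 1 0 X1 Y1 X2 Y2 X3 Y3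
     + Y0 * dickson_form b0 b1 b2 b3 0 1 X1 Y1 X2 Y2 X3 Y3"
  "dickson_form b0 b1 b2 b3 X0 Y0 X1 Y1 X2 Y2 X3 Y3 = X1 * dickson_form b0 b1 b2 b3 X0 Y0 1 0 X2 Y2 X3 Y3
     + Y1 * dickson_form b0 b1 b2 b3 X0 Y0 0 1 X2 Y2 X3 Y3"
  "dickson_form b0 b1 b2 b3 X0 Y0 X1 Y1 X2 Y2 X3 Y3 = X2 * dickson_form b0 b1 b2 b3 X0 Y0 X1 Y1 1 0 X3 Y3
     + Y2 * dickson_form b0 b1 b2 b3 X0 Y0 X1 Y1 0 1 X3 Y3"
  "dickson_form b0 b1 b2 b3 X0 Y0 X1 Y1 X2 Y2 X3 Y3 = X3 * dickson_form b0 b1 b2 b3 X0 Y0 X1 Y1 X2 Y2 1 0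
     + Y3 * dickson_form b0 b1 b2 b3 X0 Y0 X1 Y1 X2 Y2 0 1"
  by (simp_all add: dickson_form_def algebra_simps)

context quartic_extension
begin

definition dickson :: "'a \<Rightarrow> 'a \<Rightarrow> 'a \<Rightarrow> 'a" where
  "dickson b X Y = dickson_form b (frob 1 b) (frob 2 b) (frob 3 b)
     X Y (frob 1 X) (frob 1 Y) (frob 2 X) (frob 2 Y) (frob 3 X) (frob 3 Y)"

lemma frob_dickson: "frob 1 (dickson b X Y) = dickson b X Y"
  by (simp add: dickson_def dickson_form_def algebra_simps)

lemma dickson_scale:
  "dickson b (l * X) (l * Y) = (l * frob 1 l * frob 2 l * frob 3 l) * dickson b X Y"
  by (simp add: dickson_def dickson_form_def algebra_simps)

lemma dickson_0_left: "dickson b 0 Y = Y * frob 1 Y * frob 2 Y * frob 3 Y"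
  by (simp add: dickson_def dickson_form_def)

lemma dickson_1_left: 
  "dickson b 1 m = m * frob 1 m * frob 2 m * frob 3 m
     - b * frob 2 m * frob 3 m - frob 1 b * frob 3 m * m - frob 2 b * m * frob 1 m
     - frob 3 b * frob 1 m * frob 2 m - (1 - b * frob 2 b) * (1 - frob 1 b * frob 3 b)"
  by (simp add: dickson_def dickson_form_def)

text \<open>The kernel of \<open>b x\<^sup>q + x\<^bsup>q\<^sup>3\<^esup> - m x\<close> is governed by a cyclic system of four linear
  equations in \<open>x\<close> and its conjugates. Eliminating two unknowns leaves a \<open>2 \<times> 2\<close> system whose
  determinant is, up to sign, the Dickson form. Conversely, the solution space of the system is stable under
  the semilinear shift, so summing the shifts of a multiple of a solution produces a solution of
  the form \<open>(x, x\<^sup>q, x\<^bsup>q\<^sup>2\<^esup>, x\<^bsup>q\<^sup>3\<^esup>)\<close>.\<close>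

lemma kernel_iff_dickson:
  "(\<exists>x. x \<noteq> 0 \<and> b * frob 1 x + frob 3 x = m * x) \<longleftrightarrow> dickson b 1 m = 0"
proof
  assume "\<exists>x. x \<noteq> 0 \<and> b * frob 1 x + frob 3 x = m * x"
  then obtain x where x: "x \<noteq> 0" and e0: "b * frob 1 x + frob 3 x = m * x" by blast
  from e0 have "frob 1 (b * frob 1 x + frob 3 x) = frob 1 (m * x)"
    "frob 2 (b * frob 1 x + frob 3 x) = frob 2 (m * x)"
    "frob 3 (b * frob 1 x + frob 3 x) = frob 3 (m * x)" by (simp_all only:)
  hence e: "frob 1 b * frob 2 x + x = frob 1 m * frob 1 x"
    "frob 2 b * frob 3 x + frob 1 x = frob 2 m * frob 2 x"
    "frob 3 b * x + frob 2 x = frob 3 m * frob 3 x" by simp_all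
  have "dickson b 1 m * frob 1 x = 0"
    using e0 e unfolding dickson_1_left by algebra
  with x show "dickson b 1 m = 0" by simp
next
  assume D: "dickson b 1 m = 0"
  let ?b1 = "frob 1 b" and ?b2 = "frob 2 b" and ?b3 = "frob 3 b"
  let ?m1 = "frob 1 m" and ?m2 = "frob 2 m" and ?m3 = "frob 3 m"
  define k11 where "k11 = 1 + ?b2 * (m * ?m1 - b)"
  define k12 where "k12 = - ?m2 - ?b2 * ?b1 * m"
  define k21 where "k21 = ?b3 * ?m1 - ?m3 * (m * ?m1 - b)"
  define k22 where "k22 = 1 - ?b3 * ?b1 + ?m3 * m * ?b1"
  have det: "k11 * k22 - k12 * k21 = 0"
    using D unfolding dickson_1_left k11_def k12_def k21_def k22_def by algebra
  obtain y1 y2 where y: "(y1, y2) \<noteq> (0, 0)" "k11 * y1 + k12 * y2 = 0" "k21 * y1 + k22 * y2 = 0"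
  proof (cases "k11 = 0 \<and> k12 = 0")
    case True
    show ?thesis
    proof (cases "k21 = 0 \<and> k22 = 0")
      case True
      with \<open>k11 = 0 \<and> k12 = 0\<close> show ?thesis by (intro that[of 1 0]) auto
    next
      case False
      with \<open>k11 = 0 \<and> k12 = 0\<close> show ?thesis by (intro that[of k22 "- k21"]) auto
    qed
  next
    case False
    thus ?thesis by (intro that[of k12 "- k11"]) (use det in \<open>auto simp: algebra_simps\<close>)
  qed
  define y0 where "y0 = ?m1 * y1 - ?b1 * y2"
  define y3 where "y3 = m * y0 - b * y1"
  have r0: "b * y1 + y3 = m * y0" by (simp add: y3_def)
  have r1: "?b1 * y2 + y0 = ?m1 * y1" by (simp add: y0_def)
  have r2: "?b2 * y3 + y1 = ?m2 * y2"
    using y(2) unfolding k11_def k12_def y3_def y0_def by algebra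
  have r3: "?b3 * y0 + y2 = ?m3 * y3"
    using y(3) unfolding k21_def k22_def y3_def y0_def by algebra
  have "(y0, frob 1 y3, frob 2 y2, frob 3 y1) \<noteq> (0, 0, 0, 0)" using y(1) by auto
  from ex_linearized_nonzero[OF this] obtain l where
    l: "y0 * l + frob 1 y3 * frob 1 l + frob 2 y2 * frob 2 l + frob 3 y1 * frob 3 l \<noteq> 0" by blast
  define x where
    "x = y0 * l + frob 1 y3 * frob 1 l + frob 2 y2 * frob 2 l + frob 3 y1 * frob 3 l"
  have "b * frob 1 x + frob 3 x = l * (b * y1 + y3) + frob 1 l * (b * frob 1 y0 + frob 1 y2)
     + frob 2 l * (b * frob 2 y3 + frob 2 y1) + frob 3 l * (b * frob 3 y2 + frob 3 y0)"
    by (simp add: x_def algebra_simps)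
  moreover have "b * frob 1 y0 + frob 1 y2 = m * frob 1 y3"
    using arg_cong[OF r3, of "frob 1"] by simp
  moreover have "b * frob 2 y3 + frob 2 y1 = m * frob 2 y2"
    using arg_cong[OF r2, of "frob 2"] by simp
  moreover have "b * frob 3 y2 + frob 3 y0 = m * frob 3 y1"
    using arg_cong[OF r1, of "frob 3"] by simp
  ultimately have "b * frob 1 x + frob 3 x = l * (m * y0) + frob 1 l * (m * frob 1 y3)
     + frob 2 l * (m * frob 2 y2) + frob 3 l * (m * frob 3 y1)"
    by (simp only: r0)
  also have "\<dots> = m * x" by (simp add: x_def algebra_simps)
  finally have "b * frob 1 x + frob 3 x = m * x" .
  with l x_def show "\<exists>x. x \<noteq> 0 \<and> b * frob 1 x + frob 3 x = m * x" by blast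
qed

end

section \<open>Linear maps of the plane and the points of a linear set\<close>

lemma vec2_eq_iff: "(v :: 'a ^ 2) = w \<longleftrightarrow> v $ 1 = w $ 1 \<and> v $ 2 = w $ 2"
  by (simp add: vec_eq_iff forall_2)

definition plane_map :: "'a::field \<Rightarrow> 'a \<Rightarrow> 'a \<Rightarrow> 'a \<Rightarrow> 'a ^ 2 \<Rightarrow> 'a ^ 2" where
  "plane_map A B C D v = vector [A * v $ 1 + B * v $ 2, C * v $ 1 + D * v $ 2]"

lemma linear_plane_map: "Vector_Spaces.linear (*s) (*s) (plane_map A B C D)"
  by unfold_locales (simp_all add: plane_map_def vec2_eq_iff algebra_simps)

lemma bij_plane_map:
  assumes "A * D - B * C \<noteq> 0"
  shows "bij (plane_map A B C D)"
proof (rule o_bij)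
  let ?d = "A * D - B * C"
  let ?g = "plane_map (D / ?d) (- B / ?d) (- C / ?d) (A / ?d)"
  show "?g \<circ> plane_map A B C D = id" "plane_map A B C D \<circ> ?g = id"
    using assms by (auto simp: fun_eq_iff plane_map_def vec2_eq_iff divide_simps) 
      (simp_all add: algebra_simps)
qed

lemma bij_linear_is_plane_map:
  assumes "Vector_Spaces.linear (*s) (*s) f" "bij (f :: 'a::field ^ 2 \<Rightarrow> 'a ^ 2)"
  obtains A B C D where "f = plane_map A B C D" "A * D - B * C \<noteq> 0"
proof -
  interpret f: Vector_Spaces.linear "(*s)" "(*s)" f by fact
  have inj0: "v = 0" if "f v = 0" for v using assms(2) that f.zero by (metis bij_pointE)
  define e1 where "e1 = (vector [1, 0] :: 'a ^ 2)"
  define e2 where "e2 = (vector [0, 1] :: 'a ^ 2)"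
  define A B C D where "A = f e1 $ 1" and "B = f e2 $ 1" and "C = f e1 $ 2" and "D = f e2 $ 2"
  have f: "f v = plane_map A B C D v" for v
  proof -
    have "v = v $ 1 *s e1 + v $ 2 *s e2" by (simp add: e1_def e2_def vec2_eq_iff)
    hence "f v = v $ 1 *s f e1 + v $ 2 *s f e2" by (metis f.add f.scale)
    thus ?thesis
      by (simp add: plane_map_def vec2_eq_iff A_def B_def C_def D_def mult.commute)
  qed
  have "A * D - B * C \<noteq> 0"
  proof
    assume d: "A * D - B * C = 0"
    have "f (vector [D, - C]) = 0" "f (vector [B, - A]) = 0"
      unfolding f using d by (simp_all add: plane_map_def vec2_eq_iff algebra_simps)
    hence "(vector [D, - C] :: 'a ^ 2) = 0" "(vector [B, - A] :: 'a ^ 2) = 0"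
      by (auto intro: inj0)
    hence "A = 0" "B = 0" "C = 0" "D = 0" by (simp_all add: vec2_eq_iff)
    hence "f e1 = 0" unfolding f by (simp add: plane_map_def vec2_eq_iff)
    hence "e1 = 0" by (rule inj0)
    thus False by (simp add: e1_def vec2_eq_iff)
  qed
  with f show ?thesis by (intro that[of A B C D]) auto
qed

lemma image_linear_set:
  assumes "\<And>v. f ` vec.span {v} = vec.span {f v}" "\<And>v. f v = 0 \<longleftrightarrow> v = 0"
  shows "(\<lambda>P. f ` P) ` linear_set U = linear_set (f ` U)"
proof -
  have "(\<lambda>P. f ` P) ` linear_set U = {vec.span {f v} | v. v \<in> U - {0}}"
    using assms(1) by (auto simp: linear_set_def image_iff)
  also have "\<dots> = linear_set (f ` U)"
    using assms(2) by (force simp: linear_set_def)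
  finally show ?thesis .
qed

lemma span_singleton_iff: "w \<in> vec.span {v} \<longleftrightarrow> (\<exists>c. w = c *s (v :: 'a::field ^ 2))"
  by (auto simp: vec.span_singleton)

lemma span_singleton_image:
  assumes "\<And>c v. f (c *s v) = s c *s f v" "surj s"
  shows "f ` vec.span {v} = vec.span {f v :: 'a::field ^ 2}"
proof -
  have "f ` vec.span {v} = {f (c *s v) |c. True}" by (auto simp: vec.span_singleton)
  also have "\<dots> = {s c *s f v |c. True}" by (simp add: assms(1))
  also have "\<dots> = {c *s f v |c. True}" using assms(2) by (metis surjD)
  finally show ?thesis by (auto simp: vec.span_singleton)
qed

lemma image_linear_set_linear:
  assumes "Vector_Spaces.linear (*s) (*s) f" "bij f"
  shows "(\<lambda>P. f ` P) ` linear_set U = linear_set (f ` U :: ('a::field ^ 2) set)"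
proof (rule image_linear_set)
  interpret f: Vector_Spaces.linear "(*s)" "(*s)" f by fact
  show "f ` vec.span {v} = vec.span {f v}" for v
    by (rule span_singleton_image[where s = id]) (auto simp: f.scale)
  show "f v = 0 \<longleftrightarrow> v = 0" for v
    using assms(2) f.zero by (metis bij_pointE)
qed

lemma proj_equiv_refl: "proj_equiv X X"
  unfolding proj_equiv_def
  by (intro exI[of _ id]) (auto simp: vec.linear_id[unfolded id_def] intro!: vec.linear_id)

lemma proj_equiv_sym:
  assumes "proj_equiv X (Y :: ('a::field ^ 2) set set)"
  shows "proj_equiv Y X"
proof -
  from assms obtain f where f: "Vector_Spaces.linear (*s) (*s) f" "bij f" "(\<lambda>P. f ` P) ` X = Y"
    unfolding proj_equiv_def by blast
  interpret f: Vector_Spaces.linear "(*s)" "(*s)" f by fact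
  have i: "f (inv f v) = v" "inv f (f v) = v" for v
    using f(2) by (simp_all add: bij_def surj_f_inv_f)
  have "Vector_Spaces.linear (*s) (*s) (inv f)"
    by unfold_locales (metis i f.add, metis i f.scale)
  moreover have "(\<lambda>P. inv f ` P) ` Y = X"
    unfolding f(3)[symmetric] image_image by (simp add: i)
  ultimately show ?thesis
    unfolding proj_equiv_def using bij_imp_bij_inv[OF f(2)] by blast
qed

lemma proj_equiv_trans:
  assumes "proj_equiv X Y" "proj_equiv Y (Z :: ('a::field ^ 2) set set)"
  shows "proj_equiv X Z"
proof -
  from assms obtain f g where f: "Vector_Spaces.linear (*s) (*s) f" "bij f" "(\<lambda>P. f ` P) ` X = Y"
    and g: "Vector_Spaces.linear (*s) (*s) g" "bij g" "(\<lambda>P. g ` P) ` Y = Z"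
    unfolding proj_equiv_def by blast
  have "(\<lambda>P. (g \<circ> f) ` P) ` X = Z"
    unfolding g(3)[symmetric] f(3)[symmetric] image_image by (simp add: image_comp)
  with Vector_Spaces.linear_compose[OF f(1) g(1)] bij_comp[OF f(2) g(2)]
  show ?thesis unfolding proj_equiv_def by blast
qed

lemma proj_equiv_linear_set_image:
  assumes "A * D - B * C \<noteq> 0"
  shows "proj_equiv (linear_set U) (linear_set (plane_map A B C D ` U))"
  unfolding proj_equiv_def
  using linear_plane_map bij_plane_map[OF assms] image_linear_set_linear by blast

context quartic_extension
begin

lemma in_U_set_iff: "v \<in> U_set q b \<longleftrightarrow> v $ 2 = b * frob 1 (v $ 1) + frob 3 (v $ 1)"
  unfolding U_set_def by (auto simp: vec2_eq_iff power_q_eqs)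

lemma span_in_L_set_iff:
  assumes "(X, Y) \<noteq> (0, 0)"
  shows "vec.span {vector [X, Y]} \<in> L_set q b \<longleftrightarrow> dickson b X Y = 0"
proof -
  have "vec.span {vector [X, Y]} \<in> L_set q b \<longleftrightarrow> (\<exists>c. c \<noteq> 0 \<and> c *s vector [X, Y] \<in> U_set q b)"
  proof
    assume "vec.span {vector [X, Y]} \<in> L_set q b"
    then obtain v where v: "v \<in> U_set q b" "v \<noteq> 0" "vec.span {vector [X, Y]} = vec.span {v}"
      by (auto simp: linear_set_def)
    have "v \<in> vec.span {vector [X, Y]}" unfolding v(3) by (simp add: vec.span_base)
    then obtain c where "v = c *s vector [X, Y]" by (auto simp: span_singleton_iff)
    with v(1,2) show "\<exists>c. c \<noteq> 0 \<and> c *s vector [X, Y] \<in> U_set q b" by (intro exI[of _ c]) auto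
  next
    assume "\<exists>c. c \<noteq> 0 \<and> c *s vector [X, Y] \<in> U_set q b"
    then obtain c where c: "c \<noteq> 0" "c *s vector [X, Y] \<in> U_set q b" by blast
    have "vec.span {vector [X, Y] :: 'a ^ 2} = vec.span {c *s vector [X, Y]}"
    proof (intro set_eqI)
      fix w :: "'a ^ 2"
      have "(\<exists>k. w = k *s (vector [X, Y] :: 'a ^ 2)) \<longleftrightarrow> (\<exists>k. w = k *s (c *s vector [X, Y]))"
      proof
        assume "\<exists>k. w = k *s vector [X, Y]"
        then obtain k where "w = k *s vector [X, Y]" by blast
        with c(1) show "\<exists>k. w = k *s (c *s vector [X, Y])"
          by (intro exI[of _ "k / c"]) simp
      qed (metis vector_smult_assoc)
      thus "w \<in> vec.span {vector [X, Y]} \<longleftrightarrow> w \<in> vec.span {c *s vector [X, Y]}"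
        by (simp add: span_singleton_iff)
    qed
    moreover have "c *s (vector [X, Y] :: 'a ^ 2) \<noteq> 0" using c(1) assms by (auto simp: vec2_eq_iff)
    ultimately show "vec.span {vector [X, Y]} \<in> L_set q b"
      using c(2) by (auto simp: linear_set_def)
  qed
  also have "\<dots> \<longleftrightarrow> (\<exists>c. c \<noteq> 0 \<and> b * frob 1 (c * X) + frob 3 (c * X) = c * Y)"
    by (auto simp: in_U_set_iff)
  also have "\<dots> \<longleftrightarrow> dickson b X Y = 0"
  proof (cases "X = 0")
    case True
    with assms show ?thesis by (auto simp: dickson_0_left)
  next
    case False
    have "(\<exists>c. c \<noteq> 0 \<and> b * frob 1 (c * X) + frob 3 (c * X) = c * Y) \<longleftrightarrow>
      (\<exists>x. x \<noteq> 0 \<and> b * frob 1 x + frob 3 x = Y / X * x)"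
    proof
      assume "\<exists>c. c \<noteq> 0 \<and> b * frob 1 (c * X) + frob 3 (c * X) = c * Y"
      then obtain c where "c \<noteq> 0" "b * frob 1 (c * X) + frob 3 (c * X) = c * Y" by blast
      with False show "\<exists>x. x \<noteq> 0 \<and> b * frob 1 x + frob 3 x = Y / X * x"
        by (intro exI[of _ "c * X"]) simp
    next
      assume "\<exists>x. x \<noteq> 0 \<and> b * frob 1 x + frob 3 x = Y / X * x"
      then obtain x where "x \<noteq> 0" "b * frob 1 x + frob 3 x = Y / X * x" by blast
      with False show "\<exists>c. c \<noteq> 0 \<and> b * frob 1 (c * X) + frob 3 (c * X) = c * Y"
        by (intro exI[of _ "x / X"]) (simp del: frob_divide frob_mult)
    qed
    also have "\<dots> \<longleftrightarrow> dickson b 1 (Y / X) = 0" by (rule kernel_iff_dickson)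
    also have "\<dots> \<longleftrightarrow> dickson b X Y = 0"
      using dickson_scale[of b X 1 "Y / X"] False by simp
    finally show ?thesis .
  qed
  finally show ?thesis .
qed

lemma proj_equiv_dicksonD:
  assumes "proj_equiv (L_set q b) (L_set q c)"
  obtains A B C D where "A * D - B * C \<noteq> 0"
    and "\<And>m. dickson b 1 m = 0 \<longleftrightarrow> dickson c (A + B * m) (C + D * m) = 0"
proof -
  from assms obtain f where f: "Vector_Spaces.linear (*s) (*s) f" "bij f"
    "(\<lambda>P. f ` P) ` L_set q b = L_set q c" unfolding proj_equiv_def by blast
  from bij_linear_is_plane_map[OF f(1,2)] obtain A B C D
    where fp: "f = plane_map A B C D" and det: "A * D - B * C \<noteq> 0" .
  interpret f: Vector_Spaces.linear "(*s)" "(*s)" f by fact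
  have "dickson b 1 m = 0 \<longleftrightarrow> dickson c (A + B * m) (C + D * m) = 0" for m
  proof -
    have fm: "f (vector [1, m]) = vector [A + B * m, C + D * m]"
      by (simp add: fp plane_map_def)
    have "f (vector [1, m]) \<noteq> 0"
    proof
      assume "f (vector [1, m]) = 0"
      hence "(vector [1, m] :: 'a ^ 2) = 0" using f(2) f.zero by (metis bij_pointE)
      thus False by (simp add: vec2_eq_iff)
    qed
    hence ne: "(A + B * m, C + D * m) \<noteq> (0, 0)" unfolding fm by (auto simp: vec2_eq_iff)
    have im: "f ` vec.span {vector [1, m]} = vec.span {vector [A + B * m, C + D * m]}"
      unfolding fm[symmetric] by (rule span_singleton_image[where s = id]) (auto simp: f.scale)
    have "dickson b 1 m = 0 \<longleftrightarrow> vec.span {vector [1, m]} \<in> L_set q b"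
      by (simp add: span_in_L_set_iff)
    also have "\<dots> \<longleftrightarrow> f ` vec.span {vector [1, m]} \<in> (\<lambda>P. f ` P) ` L_set q b"
      using f(2) by (auto simp: bij_def inj_image_eq_iff)
    also have "\<dots> \<longleftrightarrow> dickson c (A + B * m) (C + D * m) = 0"
      unfolding f(3) im by (rule span_in_L_set_iff[OF ne])
    finally show ?thesis .
  qed
  with det show ?thesis by (rule that)
qed

end

section \<open>Equivalent linear sets have proportional Dickson forms\<close>

text \<open>A polynomial all of whose exponents have \<open>k\<close> digits \<open>0\<close> or \<open>1\<close> in base \<open>q\<close>; the list that
  selects a coefficient starts with the leading digit.\<close>

primrec digit_poly :: "nat \<Rightarrow> nat \<Rightarrow> (bool list \<Rightarrow> 'a::comm_ring_1) \<Rightarrow> 'a poly" where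
  "digit_poly q 0 r = [:r []:]"
| "digit_poly q (Suc k) r =
     digit_poly q k (\<lambda>s. r (False # s)) + monom 1 (q ^ k) * digit_poly q k (\<lambda>s. r (True # s))"

text \<open>Expressed with the factor \<open>q - 1\<close>, the size of the multiplicative group of the small field,
  because products of that many such polynomials are needed below degree \<open>q\<^sup>k\<close>.\<close>

lemma degree_digit_poly:
  assumes "q \<ge> 2"
  shows "(q - 1) * degree (digit_poly q k r) < q ^ k"
proof (induction k arbitrary: r)
  case (Suc k)
  let ?P = "digit_poly q k (\<lambda>s. r (False # s))" and ?Q = "digit_poly q k (\<lambda>s. r (True # s))"
  have "degree (monom 1 (q ^ k) * ?Q) \<le> q ^ k + degree ?Q"
    by (rule order.trans[OF degree_mult_le]) (simp add: degree_monom_le)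
  hence "degree (digit_poly q (Suc k) r) \<le> max (degree ?P) (q ^ k + degree ?Q)"
    by (simp add: degree_add_le max.coboundedI1 max.coboundedI2)
  hence "(q - 1) * degree (digit_poly q (Suc k) r) \<le> (q - 1) * max (degree ?P) (q ^ k + degree ?Q)"
    by (rule mult_le_mono2)
  also have "\<dots> < q * q ^ k"
  proof -
    have "(q - 1) * degree ?P < q ^ k" "(q - 1) * degree ?Q < q ^ k" by (rule Suc.IH)+
    moreover have "q ^ k \<le> q * q ^ k" using assms by simp
    moreover have "(q - 1) * q ^ k + q ^ k = q * q ^ k" using assms
      by (simp add: diff_mult_distrib)
    ultimately show ?thesis by (auto simp: max_def distrib_left)
  qed
  finally show ?case by simp
qed simp

lemma poly_split_unique:
  fixes P P' R R' :: "'a::comm_ring_1 poly"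
  assumes "degree P < n" "degree P' < n" "P + monom 1 n * R = P' + monom 1 n * R'"
  shows "P = P' \<and> R = R'"
proof -
  have c: "coeff (P + monom 1 n * R) i = (if i < n then coeff P i else coeff R (i - n))"
    if "degree P < n" for P R :: "'a poly" and i
    using that coeff_eq_0[of P i] by (auto simp: coeff_monom_mult)
  have "coeff P i = coeff P' i" for i
  proof (cases "i < n")
    case True
    thus ?thesis using c[OF assms(1), of R i] c[OF assms(2), of R' i] assms(3) by simp
  next
    case False
    thus ?thesis using assms(1,2) by (simp add: coeff_eq_0)
  qed
  moreover have "coeff R i = coeff R' i" for i
    using c[OF assms(1), of R "i + n"] c[OF assms(2), of R' "i + n"] assms(3) by simp
  ultimately show ?thesis by (auto intro: poly_eqI)
qed

lemma digit_poly_eqD: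
  assumes "q \<ge> 2" "digit_poly q k r = digit_poly q k r'" "length s = k"
  shows "r s = r' s"
  using assms(2,3)
proof (induction k arbitrary: r r' s)
  case (Suc k)
  obtain x t where s: "s = x # t" "length t = k" using Suc.prems(2) by (cases s) auto
  have d: "degree (digit_poly q k f) < q ^ k" for f :: "bool list \<Rightarrow> 'a"
  proof -
    have "degree (digit_poly q k f) \<le> (q - 1) * degree (digit_poly q k f)"
      using assms(1) mult_le_mono1[of 1 "q - 1" "degree (digit_poly q k f)"] by linarith
    also have "\<dots> < q ^ k" by (rule degree_digit_poly[OF assms(1)])
    finally show ?thesis .
  qed
  have "digit_poly q k (\<lambda>s. r (False # s)) = digit_poly q k (\<lambda>s. r' (False # s))"
    "digit_poly q k (\<lambda>s. r (True # s)) = digit_poly q k (\<lambda>s. r' (True # s))"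
    using poly_split_unique[OF d d] Suc.prems(1) by auto
  from Suc.IH[OF this(1) s(2)] Suc.IH[OF this(2) s(2)] show ?case by (cases x) (auto simp: s(1))
qed simp

lemma smult_digit_poly: "smult c (digit_poly q k r) = digit_poly q k (\<lambda>s. c * r s)"
proof (induction k arbitrary: r)
  case (Suc k)
  have "smult c (digit_poly q (Suc k) r) = smult c (digit_poly q k (\<lambda>s. r (False # s)))
      + monom 1 (q ^ k) * smult c (digit_poly q k (\<lambda>s. r (True # s)))"
    by (simp add: smult_add_right)
  thus ?case by (simp only: Suc.IH digit_poly.simps)
qed simp

lemma dickson_form_affine:
  "dickson_form b0 b1 b2 b3 (X + X' * c) (Y + Y' * c) X1 Y1 X2 Y2 X3 Y3 =
     dickson_form b0 b1 b2 b3 X Y X1 Y1 X2 Y2 X3 Y3 + c * dickson_form b0 b1 b2 b3 X' Y' X1 Y1 X2 Y2 X3 Y3"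
  "dickson_form b0 b1 b2 b3 X0 Y0 (X + X' * c) (Y + Y' * c) X2 Y2 X3 Y3 =
     dickson_form b0 b1 b2 b3 X0 Y0 X Y X2 Y2 X3 Y3 + c * dickson_form b0 b1 b2 b3 X0 Y0 X' Y' X2 Y2 X3 Y3"
  "dickson_form b0 b1 b2 b3 X0 Y0 X1 Y1 (X + X' * c) (Y + Y' * c) X3 Y3 =
     dickson_form b0 b1 b2 b3 X0 Y0 X1 Y1 X Y X3 Y3 + c * dickson_form b0 b1 b2 b3 X0 Y0 X1 Y1 X' Y' X3 Y3"
  "dickson_form b0 b1 b2 b3 X0 Y0 X1 Y1 X2 Y2 (X + X' * c) (Y + Y' * c) =
     dickson_form b0 b1 b2 b3 X0 Y0 X1 Y1 X2 Y2 X Y + c * dickson_form b0 b1 b2 b3 X0 Y0 X1 Y1 X2 Y2 X' Y'"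
  by (simp_all add: dickson_form_def algebra_simps)

context quartic_extension
begin

text \<open>The values of the Dickson form on the columns of a matrix and its conjugates; they are the
  coefficients of the polynomial \<open>m \<mapsto> dickson b (A + B m) (C + D m)\<close>.\<close>

definition form_at :: "'a \<Rightarrow> 'a \<Rightarrow> 'a \<Rightarrow> 'a \<Rightarrow> 'a \<Rightarrow> bool list \<Rightarrow> 'a" where
  "form_at b A B C D s = dickson_form b (frob 1 b) (frob 2 b) (frob 3 b)
     (if s ! 3 then B else A) (if s ! 3 then D else C)
     (if s ! 2 then frob 1 B else frob 1 A) (if s ! 2 then frob 1 D else frob 1 C)
     (if s ! 1 then frob 2 B else frob 2 A) (if s ! 1 then frob 2 D else frob 2 C)
     (if s ! 0 then frob 3 B else frob 3 A) (if s ! 0 then frob 3 D else frob 3 C)"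

lemma poly_digit_poly_Suc:
  "poly (digit_poly q (Suc k) r) m =
     poly (digit_poly q k (\<lambda>s. r (False # s))) m + frob k m * poly (digit_poly q k (\<lambda>s. r (True # s))) m"
  by (simp add: poly_monom frob_def)

lemma poly_form_at:
  "poly (digit_poly q 4 (form_at b A B C D)) m = dickson b (A + B * m) (C + D * m)"
proof -
  have 0: "poly (digit_poly q 0 r) m = r []" for r by simp
  have 1: "poly (digit_poly q 1 r) m = r [False] + m * r [True]" for r
    using poly_digit_poly_Suc[of 0 r m] unfolding 0 by (simp add: One_nat_def del: digit_poly.simps)
  have 2: "poly (digit_poly q 2 r) m = (r [False, False] + m * r [False, True])
     + frob 1 m * (r [True, False] + m * r [True, True])" for r
    using poly_digit_poly_Suc[of 1 r m] unfolding 1 by (simp del: digit_poly.simps)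
  have 3: "poly (digit_poly q 3 r) m = ((r [False, False, False] + m * r [False, False, True])
     + frob 1 m * (r [False, True, False] + m * r [False, True, True]))
     + frob 2 m * ((r [True, False, False] + m * r [True, False, True])
     + frob 1 m * (r [True, True, False] + m * r [True, True, True]))" for r
    using poly_digit_poly_Suc[of 2 r m] unfolding 2 by (simp del: digit_poly.simps)
  have "poly (digit_poly q 4 r) m =
    (((r [False, False, False, False] + m * r [False, False, False, True])
      + frob 1 m * (r [False, False, True, False] + m * r [False, False, True, True]))
      + frob 2 m * ((r [False, True, False, False] + m * r [False, True, False, True])
      + frob 1 m * (r [False, True, True, False] + m * r [False, True, True, True])))
    + frob 3 m * (((r [True, False, False, False] + m * r [True, False, False, True])
      + frob 1 m * (r [True, False, True, False] + m * r [True, False, True, True]))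
      + frob 2 m * ((r [True, True, False, False] + m * r [True, True, False, True])
      + frob 1 m * (r [True, True, True, False] + m * r [True, True, True, True])))" for r
    using poly_digit_poly_Suc[of 3 r m] unfolding 3 by (simp del: digit_poly.simps)
  note this [where r = "form_at b A B C D"]
  moreover have "dickson b (A + B * m) (C + D * m) =
    (((form_at b A B C D [False, False, False, False] + m * form_at b A B C D [False, False, False, True])
      + frob 1 m * (form_at b A B C D [False, False, True, False] + m * form_at b A B C D [False, False, True, True]))
      + frob 2 m * ((form_at b A B C D [False, True, False, False] + m * form_at b A B C D [False, True, False, True])
      + frob 1 m * (form_at b A B C D [False, True, True, False] + m * form_at b A B C D [False, True, True, True])))
    + frob 3 m * (((form_at b A B C D [True, False, False, False] + m * form_at b A B C D [True, False, False, True])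
      + frob 1 m * (form_at b A B C D [True, False, True, False] + m * form_at b A B C D [True, False, True, True]))
      + frob 2 m * ((form_at b A B C D [True, True, False, False] + m * form_at b A B C D [True, True, False, True])
      + frob 1 m * (form_at b A B C D [True, True, True, False] + m * form_at b A B C D [True, True, True, True])))"
    unfolding dickson_def frob_add frob_mult dickson_form_affine(4)
    unfolding dickson_form_affine(3)
    unfolding dickson_form_affine(2)
    unfolding dickson_form_affine(1) form_at_def by simp
  ultimately show ?thesis by (simp only:)
qed

definition forms_proportional :: "'a \<Rightarrow> 'a \<Rightarrow> 'a \<Rightarrow> 'a \<Rightarrow> 'a \<Rightarrow> 'a \<Rightarrow> 'a \<Rightarrow> bool" where
  "forms_proportional b c A B C D s \<longleftrightarrow> A * D - B * C \<noteq> 0 \<and> s \<noteq> 0 \<and> frob 1 s = s \<and>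
     (\<forall>X0 Y0 X1 Y1 X2 Y2 X3 Y3.
       dickson_form c (frob 1 c) (frob 2 c) (frob 3 c)
         (A * X0 + B * Y0) (C * X0 + D * Y0)
         (frob 1 A * X1 + frob 1 B * Y1) (frob 1 C * X1 + frob 1 D * Y1)
         (frob 2 A * X2 + frob 2 B * Y2) (frob 2 C * X2 + frob 2 D * Y2)
         (frob 3 A * X3 + frob 3 B * Y3) (frob 3 C * X3 + frob 3 D * Y3) =
       s * dickson_form b (frob 1 b) (frob 2 b) (frob 3 b) X0 Y0 X1 Y1 X2 Y2 X3 Y3)"

lemma forms_proportionalD:
  assumes "forms_proportional b c A B C D s"
  shows "A * D - B * C \<noteq> 0" "s \<noteq> 0" "frob 1 s = s"
    "dickson_form c (frob 1 c) (frob 2 c) (frob 3 c)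
         (A * X0 + B * Y0) (C * X0 + D * Y0)
         (frob 1 A * X1 + frob 1 B * Y1) (frob 1 C * X1 + frob 1 D * Y1)
         (frob 2 A * X2 + frob 2 B * Y2) (frob 2 C * X2 + frob 2 D * Y2)
         (frob 3 A * X3 + frob 3 B * Y3) (frob 3 C * X3 + frob 3 D * Y3) =
       s * dickson_form b (frob 1 b) (frob 2 b) (frob 3 b) X0 Y0 X1 Y1 X2 Y2 X3 Y3"
  using assms unfolding forms_proportional_def by blast+

text \<open>A projectivity between the linear sets gives two polynomial functions with the same zeros, the
  Dickson forms along \<open>(1, m)\<close> and along its image. Both take values in the small field, so at each
  \<open>m\<close> they agree up to one of the \<open>q - 1\<close> factors \<open>s\<close> from that field. The product of the
  differences over all \<open>s\<close> vanishes everywhere, although its degree is below \<open>q\<^sup>4\<close>; hence one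
  difference is the zero polynomial. Exponents with digits \<open>0\<close> and \<open>1\<close> are all distinct, so
  comparing coefficients gives the identity of the multilinear forms.\<close>

lemma proj_equiv_imp_forms_proportional:
  assumes "proj_equiv (L_set q b) (L_set q c)"
  shows "\<exists>A B C D s. forms_proportional b c A B C D s"
proof -
  obtain A B C D where det: "A * D - B * C \<noteq> 0"
    and zeros: "\<And>m. dickson b 1 m = 0 \<longleftrightarrow> dickson c (A + B * m) (C + D * m) = 0"
    by (rule proj_equiv_dicksonD[OF assms], rule that)
  define Pb where "Pb = digit_poly q 4 (form_at b 1 0 0 1)"
  define Pc where "Pc = digit_poly q 4 (form_at c A B C D)"
  define S where "S = {s. s \<noteq> 0 \<and> frob 1 s = s}"
  define Q where "Q = (\<Prod>s\<in>S. Pc - smult s Pb)"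
  have cardS: "card S \<le> q - 1"
  proof -
    have "card S \<le> card {s::'a. s ^ (q - 1) = 1}"
      by (rule card_mono) (auto simp: S_def frob_1_fixed_iff)
    also have "\<dots> \<le> q - 1" by (rule card_power_eq_le) (use q_ge_2 in simp)
    finally show ?thesis .
  qed
  have "Q = 0"
  proof (rule ccontr)
    assume "Q \<noteq> 0"
    obtain d where d: "degree Pb \<le> d" "degree Pc \<le> d" "(q - 1) * d < q ^ 4"
      using degree_digit_poly[OF q_ge_2, of 4 "form_at b 1 0 0 1"]
        degree_digit_poly[OF q_ge_2, of 4 "form_at c A B C D"]
      by (metis Pb_def Pc_def linear order_refl)
    have "degree Q \<le> (\<Sum>s\<in>S. degree (Pc - smult s Pb))"
      unfolding Q_def using degree_prod_sum_le[of S "\<lambda>s. Pc - smult s Pb"] by (simp add: o_def)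
    also have "\<dots> \<le> (\<Sum>s\<in>S. d)"
      by (intro sum_mono degree_diff_le order.trans[OF degree_smult_le] d)
    also have "\<dots> \<le> (q - 1) * d" using cardS by simp
    finally have "CARD('a) \<le> (q - 1) * d"
    proof (intro card_roots_le[OF \<open>Q \<noteq> 0\<close>])
      fix m
      let ?u = "dickson c (A + B * m) (C + D * m)" and ?v = "dickson b 1 m"
      have "\<exists>s\<in>S. ?u = s * ?v"
      proof (cases "?v = 0")
        case True
        with zeros[of m] show ?thesis by (intro bexI[of _ 1]) (auto simp: S_def)
      next
        case False
        with zeros[of m] show ?thesis
          by (intro bexI[of _ "?u / ?v"]) (auto simp: S_def frob_dickson)
      qed
      hence "\<exists>s\<in>S. poly (Pc - smult s Pb) m = 0" by (simp add: Pc_def Pb_def poly_form_at)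
      thus "poly Q m = 0" by (auto simp: Q_def poly_prod)
    qed
    with d(3) card_a show False by simp
  qed
  hence "\<exists>s\<in>S. Pc = smult s Pb" by (simp add: Q_def)
  then obtain s where s: "s \<noteq> 0" "frob 1 s = s" and eq: "Pc = smult s Pb"
    by (auto simp: S_def)
  have at: "form_at c A B C D l = s * form_at b 1 0 0 1 l" if "length l = 4" for l
    using digit_poly_eqD[OF q_ge_2 eq[unfolded Pc_def Pb_def smult_digit_poly] that] by simp
  let ?a = "\<lambda>n i. if i then frob n B else frob n A" and ?c = "\<lambda>n i. if i then frob n D else frob n C"
  let ?x = "\<lambda>i. if i then 0 else 1" and ?y = "\<lambda>i. if i then 1 else 0"
  let ?Tb = "dickson_form b (frob 1 b) (frob 2 b) (frob 3 b)"
    and ?Tc = "dickson_form c (frob 1 c) (frob 2 c) (frob 3 c)"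
  have base: "?Tc (?a 0 i) (?c 0 i) (?a 1 j) (?c 1 j) (?a 2 k) (?c 2 k) (?a 3 l) (?c 3 l)
      = s * ?Tb (?x i) (?y i) (?x j) (?y j) (?x k) (?y k) (?x l) (?y l)" for i j k l
    using at[of "[l, k, j, i]"] by (simp add: form_at_def cong: if_cong)
  \<comment> \<open>The sixteen identities of coefficients extend to all arguments, one slot at a time.\<close>
  note std = dickson_form_std[of b "frob 1 b" "frob 2 b" "frob 3 b"]
  have s3: "?Tc (?a 0 i) (?c 0 i) (?a 1 j) (?c 1 j) (?a 2 k) (?c 2 k)
        (frob 3 A * X3 + frob 3 B * Y3) (frob 3 C * X3 + frob 3 D * Y3)
      = s * ?Tb (?x i) (?y i) (?x j) (?y j) (?x k) (?y k) X3 Y3" for i j k X3 Y3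
    unfolding dickson_form_linear(4) std(4)[of "?x i" "?y i" "?x j" "?y j" "?x k" "?y k" X3 Y3]
    using base[of i j k False] base[of i j k True] by (simp only: if_True if_False) (simp only: distrib_left mult_ac)
  have s2: "?Tc (?a 0 i) (?c 0 i) (?a 1 j) (?c 1 j)
        (frob 2 A * X2 + frob 2 B * Y2) (frob 2 C * X2 + frob 2 D * Y2)
        (frob 3 A * X3 + frob 3 B * Y3) (frob 3 C * X3 + frob 3 D * Y3)
      = s * ?Tb (?x i) (?y i) (?x j) (?y j) X2 Y2 X3 Y3" for i j X2 Y2 X3 Y3
    unfolding dickson_form_linear(3) std(3)[of "?x i" "?y i" "?x j" "?y j" X2 Y2]
    using s3[of i j False] s3[of i j True] by (simp only: if_True if_False) (simp only: distrib_left mult_ac)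
  have s1: "?Tc (?a 0 i) (?c 0 i)
        (frob 1 A * X1 + frob 1 B * Y1) (frob 1 C * X1 + frob 1 D * Y1)
        (frob 2 A * X2 + frob 2 B * Y2) (frob 2 C * X2 + frob 2 D * Y2)
        (frob 3 A * X3 + frob 3 B * Y3) (frob 3 C * X3 + frob 3 D * Y3)
      = s * ?Tb (?x i) (?y i) X1 Y1 X2 Y2 X3 Y3" for i X1 Y1 X2 Y2 X3 Y3
    unfolding dickson_form_linear(2) std(2)[of "?x i" "?y i" X1 Y1]
    using s2[of i False] s2[of i True] by (simp only: if_True if_False) (simp only: distrib_left mult_ac)
  have s0: "?Tc (A * X0 + B * Y0) (C * X0 + D * Y0)
        (frob 1 A * X1 + frob 1 B * Y1) (frob 1 C * X1 + frob 1 D * Y1)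
        (frob 2 A * X2 + frob 2 B * Y2) (frob 2 C * X2 + frob 2 D * Y2)
        (frob 3 A * X3 + frob 3 B * Y3) (frob 3 C * X3 + frob 3 D * Y3)
      = s * ?Tb X0 Y0 X1 Y1 X2 Y2 X3 Y3" for X0 Y0 X1 Y1 X2 Y2 X3 Y3
    unfolding dickson_form_linear(1) std(1)[of X0 Y0]
    using s1[of False] s1[of True] by (simp only: if_True if_False frob_zero_index) (simp only: distrib_left mult_ac)
  from det s s0 have "forms_proportional b c A B C D s"
    unfolding forms_proportional_def by blast
  thus ?thesis by blast
qed

end

section \<open>Invariants of the Dickson form\<close>

text \<open>Cayley's hyperdeterminant of a \<open>2 \<times> 2 \<times> 2\<close> array.\<close>

definition hyperdet8 :: "'a::comm_ring_1 \<Rightarrow> 'a \<Rightarrow> 'a \<Rightarrow> 'a \<Rightarrow> 'a \<Rightarrow> 'a \<Rightarrow> 'a \<Rightarrow> 'a \<Rightarrow> 'a" where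
  "hyperdet8 a000 a001 a010 a011 a100 a101 a110 a111 =
     (a000 * a111)^2 + (a001 * a110)^2 + (a010 * a101)^2 + (a100 * a011)^2
     - 2 * (a000 * a111 * a001 * a110 + a000 * a111 * a010 * a101 + a000 * a111 * a100 * a011
            + a001 * a110 * a010 * a101 + a001 * a110 * a100 * a011 + a010 * a101 * a100 * a011)
     + 4 * (a000 * a011 * a101 * a110 + a001 * a010 * a100 * a111)"

definition hyperdet :: "(bool \<Rightarrow> bool \<Rightarrow> bool \<Rightarrow> 'a::comm_ring_1) \<Rightarrow> 'a" where
  "hyperdet f = hyperdet8 (f False False False) (f False False True) (f False True False)
     (f False True True) (f True False False) (f True False True) (f True True False) (f True True True)"

lemma hyperdet8_slot:
  fixes A B C D :: "'a::field"
  shows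
  "hyperdet8 (A * a000 + C * a100) (A * a001 + C * a101) (A * a010 + C * a110) (A * a011 + C * a111)
     (B * a000 + D * a100) (B * a001 + D * a101) (B * a010 + D * a110) (B * a011 + D * a111)
   = (A * D - B * C)^2 * hyperdet8 a000 a001 a010 a011 a100 a101 a110 a111"
  "hyperdet8 (A * a000 + C * a010) (A * a001 + C * a011) (B * a000 + D * a010) (B * a001 + D * a011)
     (A * a100 + C * a110) (A * a101 + C * a111) (B * a100 + D * a110) (B * a101 + D * a111)
   = (A * D - B * C)^2 * hyperdet8 a000 a001 a010 a011 a100 a101 a110 a111"
  "hyperdet8 (A * a000 + C * a001) (B * a000 + D * a001) (A * a010 + C * a011) (B * a010 + D * a011)
     (A * a100 + C * a101) (B * a100 + D * a101) (A * a110 + C * a111) (B * a110 + D * a111)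
   = (A * D - B * C)^2 * hyperdet8 a000 a001 a010 a011 a100 a101 a110 a111"
  unfolding hyperdet8_def by algebra+

lemma hyperdet_slot:
  fixes A B C D :: "'a::field"
  shows
  "hyperdet (\<lambda>i j k. (if i then B else A) * f False j k + (if i then D else C) * f True j k)
     = (A * D - B * C)^2 * hyperdet f"
  "hyperdet (\<lambda>i j k. (if j then B else A) * f i False k + (if j then D else C) * f i True k)
     = (A * D - B * C)^2 * hyperdet f"
  "hyperdet (\<lambda>i j k. (if k then B else A) * f i j False + (if k then D else C) * f i j True)
     = (A * D - B * C)^2 * hyperdet f"
  unfolding hyperdet_def if_True if_False by (rule hyperdet8_slot)+

lemma hyperdet_scale:
  fixes s :: "'a::field"
  shows "hyperdet (\<lambda>i j k. s * f i j k) = s ^ 4 * hyperdet f"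
proof -
  have "hyperdet8 (s * a000) (s * a001) (s * a010) (s * a011) (s * a100) (s * a101) (s * a110) (s * a111)
   = s ^ 4 * hyperdet8 a000 a001 a010 a011 a100 a101 a110 a111" 
    for a000 a001 a010 a011 a100 a101 a110 a111 :: 'a
    unfolding hyperdet8_def by algebra
  thus ?thesis unfolding hyperdet_def .
qed

(* The coordinates of the two standard basis vectors, selected by a truth value. *)
abbreviation ex :: "bool \<Rightarrow> 'a::zero_neq_one" where "ex i \<equiv> (if i then 0 else 1)"
abbreviation ey :: "bool \<Rightarrow> 'a::zero_neq_one" where "ey i \<equiv> (if i then 1 else 0)"

text \<open>Fixing one of the four vectors of the Dickson form leaves a \<open>2 \<times> 2 \<times> 2\<close> array. Its
  hyperdeterminant, as a function of the fixed vector \<open>(X, Y)\<close>, is the square of a multiple of \<open>X Y\<close>: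
  unless the norm of \<open>b\<close> is one, the form remembers the two coordinate axes.\<close>

lemma hyperdet_dickson_form:
  fixes b0 :: "'a::field"
  shows
  "hyperdet (\<lambda>i j k. dickson_form b0 b1 b2 b3 (ex i) (ey i) (ex j) (ey j) X Y (ex k) (ey k))
    = ((1 - b0 * b1 * b2 * b3) * X * Y) ^ 2"
  unfolding hyperdet_def hyperdet8_def dickson_form_def if_True if_False
    mult_zero_left mult_zero_right mult_1_left mult_1_right minus_zero diff_zero diff_0 add_0_left add_0_right
  by (simp add: algebra_simps power2_eq_square)

lemma hyperdet_dickson_form_transformed:
  fixes A0 :: "'a::field"
  shows
  "hyperdet (\<lambda>i j k. dickson_form b0 b1 b2 b3
      (if i then B0 else A0) (if i then D0 else C0) (if j then B1 else A1) (if j then D1 else C1) X Y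
      (if k then B3 else A3) (if k then D3 else C3))
    = ((A0 * D0 - B0 * C0) * (A1 * D1 - B1 * C1) * (A3 * D3 - B3 * C3)
        * (1 - b0 * b1 * b2 * b3) * X * Y) ^ 2"
proof -
  let ?T = "dickson_form b0 b1 b2 b3"
  let ?g = "\<lambda>i j k. ?T (ex i) (ey i) (ex j) (ey j) X Y (ex k) (ey k)"
  let ?f3 = "\<lambda>i j k. (if k then B3 else A3) * ?g i j False + (if k then D3 else C3) * ?g i j True"
  let ?f1 = "\<lambda>i j k. (if j then B1 else A1) * ?f3 i False k + (if j then D1 else C1) * ?f3 i True k"
  let ?f0 = "\<lambda>i j k. (if i then B0 else A0) * ?f1 False j k + (if i then D0 else C0) * ?f1 True j k"
  have f3: "?f3 i j k = ?T (ex i) (ey i) (ex j) (ey j) X Y (if k then B3 else A3) (if k then D3 else C3)"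
    for i j k
    unfolding dickson_form_std(4)[of _ _ _ _ "ex i" "ey i" "ex j" "ey j" X Y "if k then B3 else A3"]
    by (simp only: if_True if_False)
  have f1: "?f1 i j k = ?T (ex i) (ey i) (if j then B1 else A1) (if j then D1 else C1) X Y
      (if k then B3 else A3) (if k then D3 else C3)" for i j k
    unfolding f3 dickson_form_std(2)[of _ _ _ _ "ex i" "ey i" "if j then B1 else A1"]
    by (simp only: if_True if_False)
  have f0: "?f0 i j k = ?T (if i then B0 else A0) (if i then D0 else C0)
      (if j then B1 else A1) (if j then D1 else C1) X Y
      (if k then B3 else A3) (if k then D3 else C3)" for i j k
    unfolding f1 dickson_form_std(1)[of _ _ _ _ "if i then B0 else A0"]
    by (simp only: if_True if_False)
  have "hyperdet ?f0 = (A0 * D0 - B0 * C0)^2 * hyperdet ?f1" by (rule hyperdet_slot(1))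
  also have "hyperdet ?f1 = (A1 * D1 - B1 * C1)^2 * hyperdet ?f3" by (rule hyperdet_slot(2))
  also have "hyperdet ?f3 = (A3 * D3 - B3 * C3)^2 * hyperdet ?g" by (rule hyperdet_slot(3))
  also have "hyperdet ?g = ((1 - b0 * b1 * b2 * b3) * X * Y) ^ 2" by (rule hyperdet_dickson_form)
  finally have "hyperdet ?f0 = (A0 * D0 - B0 * C0)^2 * ((A1 * D1 - B1 * C1)^2 *
      ((A3 * D3 - B3 * C3)^2 * ((1 - b0 * b1 * b2 * b3) * X * Y) ^ 2))" .
  thus ?thesis unfolding f0 by (simp add: power_mult_distrib mult_ac)
qed

text \<open>The determinant of the Dickson form in its first two slots is another covariant, this time of the
  remaining two vectors.\<close>

lemma pair_det_dickson_form_transformed: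
  fixes A0 :: "'a::field"
  shows
  "dickson_form b0 b1 b2 b3 A0 C0 A1 C1 X Y Z W * dickson_form b0 b1 b2 b3 B0 D0 B1 D1 X Y Z W
   - dickson_form b0 b1 b2 b3 A0 C0 B1 D1 X Y Z W * dickson_form b0 b1 b2 b3 B0 D0 A1 C1 X Y Z W
   = (A0 * D0 - B0 * C0) * (A1 * D1 - B1 * C1) *
     ((1 - b0*b2) * (1 - b1*b3) * b2 * X^2 * Z^2 - b0 * Y^2 * W^2
      + (b0*b2 - (1 - b0*b2) * (1 - b1*b3) - b1*b3) * X * Y * Z * W)"
  unfolding dickson_form_def by algebra

text \<open>If the norm \<open>b\<^sub>0 b\<^sub>1 b\<^sub>2 b\<^sub>3\<close> is one, the hyperdeterminant vanishes identically and the group of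
  the form is larger. What is preserved instead are the bilinear forms
  \<open>b\<^sub>2 Y\<^sub>0 Y\<^sub>1 + (1 - b\<^sub>0 b\<^sub>2) X\<^sub>0 X\<^sub>1\<close> of cyclically neighbouring slots, from which the whole form is
  built.\<close>

lemma dickson_form_norm_1_decomposition:
  fixes b0 :: "'a::field"
  assumes "b0 * b1 * b2 * b3 = 1"
  shows "(1 - b0 * b2) * dickson_form b0 b1 b2 b3 X0 Y0 X1 Y1 X2 Y2 X3 Y3 =
     b0 * b2 * (b3 * Y1 * Y2 + (1 - b1 * b3) * X1 * X2) * (b1 * Y3 * Y0 + (1 - b1 * b3) * X3 * X0)
     - (b2 * Y0 * Y1 + (1 - b0 * b2) * X0 * X1) * (b0 * Y2 * Y3 + (1 - b0 * b2) * X2 * X3)"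
  using assms unfolding dickson_form_def by algebra

text \<open>For norm one, the determinant in two slots is the square of the bilinear form of the other two
  slots, up to a factor.\<close>

lemma norm_1_square:
  fixes b0 :: "'a::field"
  assumes "b0 * b1 * b2 * b3 = 1"
  shows "b0 * ((1 - b0*b2) * (1 - b1*b3) * b2 * X^2 * Z^2 - b0 * Y^2 * W^2
      + (b0*b2 - (1 - b0*b2) * (1 - b1*b3) - b1*b3) * X * Y * Z * W)
    = - ((b0 * Y * W + (1 - b0 * b2) * X * Z) ^ 2)"
  using assms by algebra

context quartic_extension
begin

text \<open>By covariance of the hyperdeterminant, the change of coordinates preserves the pair of coordinate
  axes, so its matrix is diagonal or antidiagonal.\<close>

lemma forms_proportional_norm_ne_1:
  assumes norms: "norm_q q b \<noteq> 1" and fp: "forms_proportional b c A B C D s"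
  shows "norm_q q c \<noteq> 1 \<and> ((B = 0 \<and> C = 0) \<or> (A = 0 \<and> D = 0))"
proof -
  note det = forms_proportionalD(1)[OF fp] and s = forms_proportionalD(2,3)[OF fp]
    and T = forms_proportionalD(4)[OF fp]
  have H: "((A * D - B * C) * (frob 1 A * frob 1 D - frob 1 B * frob 1 C)
        * (frob 3 A * frob 3 D - frob 3 B * frob 3 C) * (1 - c * frob 1 c * frob 2 c * frob 3 c)
        * (frob 2 A * X + frob 2 B * Y) * (frob 2 C * X + frob 2 D * Y)) ^ 2
      = s ^ 4 * ((1 - b * frob 1 b * frob 2 b * frob 3 b) * X * Y) ^ 2" for X Y
  proof -
    let ?Tb = "dickson_form b (frob 1 b) (frob 2 b) (frob 3 b)"
      and ?Tc = "dickson_form c (frob 1 c) (frob 2 c) (frob 3 c)"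
    have "?Tc (if i then B else A) (if i then D else C) (if j then frob 1 B else frob 1 A)
        (if j then frob 1 D else frob 1 C) (frob 2 A * X + frob 2 B * Y) (frob 2 C * X + frob 2 D * Y)
        (if k then frob 3 B else frob 3 A) (if k then frob 3 D else frob 3 C)
      = s * ?Tb (ex i) (ey i) (ex j) (ey j) X Y (ex k) (ey k)" for i j k
      using T[of "ex i" "ey i" "ex j" "ey j" X Y "ex k" "ey k"] by (cases i; cases j; cases k) simp_all
    hence "hyperdet (\<lambda>i j k. ?Tc (if i then B else A) (if i then D else C) (if j then frob 1 B else frob 1 A)
        (if j then frob 1 D else frob 1 C) (frob 2 A * X + frob 2 B * Y) (frob 2 C * X + frob 2 D * Y)
        (if k then frob 3 B else frob 3 A) (if k then frob 3 D else frob 3 C))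
      = s ^ 4 * hyperdet (\<lambda>i j k. ?Tb (ex i) (ey i) (ex j) (ey j) X Y (ex k) (ey k))"
      unfolding hyperdet_scale[symmetric] by (simp only:)
    thus ?thesis
      unfolding hyperdet_dickson_form_transformed[where ?A0.0 = A] hyperdet_dickson_form .
  qed
  have det': "frob n A * frob n D - frob n B * frob n C \<noteq> 0" for n
    using det by (metis frob_diff frob_eq_0_iff frob_mult)
  have nb: "1 - b * frob 1 b * frob 2 b * frob 3 b \<noteq> 0"
    and nc: "norm_q q c = c * frob 1 c * frob 2 c * frob 3 c"
    using norms by (simp_all add: norm_q_eq)
  have "s ^ 4 * ((1 - b * frob 1 b * frob 2 b * frob 3 b) * 1 * 1) ^ 2 \<noteq> 0"
    using nb s by simp
  hence "1 - c * frob 1 c * frob 2 c * frob 3 c \<noteq> 0" unfolding H[of 1 1, symmetric] by auto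
  moreover have "A * C = 0" "B * D = 0"
    using H[of 1 0] H[of 0 1] det det'[of 1] det'[of 3] calculation by auto
  ultimately show ?thesis using det nc by auto
qed

text \<open>For a diagonal or antidiagonal matrix, comparing the few nonzero coefficients shows that
  \<open>b\<^bsup>q\<^sup>2+1\<^esup>\<close>, its conjugate and the last coefficient of the form are all multiplied by the same scalar
  \<open>r\<close>. Since the last coefficient is determined by the other two, only two values of \<open>r\<close> survive.\<close>

lemma forms_proportional_imp_beta_norm_ne_1:
  assumes norms: "norm_q q b \<noteq> 1" and fp: "forms_proportional b c A B C D s"
  shows "c * frob 2 c = b * frob 2 b \<or> (c * frob 2 c) * frob 1 (b * frob 2 b) = 1"
proof -
  note det = forms_proportionalD(1)[OF fp] and s = forms_proportionalD(2,3)[OF fp]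
    and T = forms_proportionalD(4)[OF fp]
  let ?K = "\<lambda>b. (1 - b * frob 2 b) * (1 - frob 1 b * frob 3 b)"
  from forms_proportional_norm_ne_1[OF assms]
  have nc: "norm_q q c \<noteq> 1" and cases: "(B = 0 \<and> C = 0) \<or> (A = 0 \<and> D = 0)" by auto
  have "\<exists>r. r \<noteq> 0 \<and> b * frob 2 b = r * (c * frob 2 c) \<and> frob 1 b * frob 3 b = r * (frob 1 c * frob 3 c)
      \<and> ?K b = r * ?K c"
    using cases
  proof
    assume BC: "B = 0 \<and> C = 0"
    hence AD: "A \<noteq> 0" "D \<noteq> 0" using det by auto
    define a where "a = A / D"
    have A: "A = a * D" using AD by (simp add: a_def)
    have a: "a \<noteq> 0" using AD by (simp add: a_def)
    have s_eq: "s = D * frob 1 D * frob 2 D * frob 3 D"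
      using T[of 0 1 0 1 0 1 0 1] BC by (simp add: dickson_form_def)
    have D': "frob n D \<noteq> 0" for n using AD by simp
    have "c * a * frob 1 a * s = s * b"
      using T[of 1 0 1 0 0 1 0 1] BC unfolding s_eq by (simp add: dickson_form_def A algebra_simps)
    hence e0: "b = c * a * frob 1 a" using s by (simp add: mult_ac)
    have "?K c * a * frob 1 a * frob 2 a * frob 3 a * s = s * ?K b"
      using T[of 1 0 1 0 1 0 1 0] BC unfolding s_eq by (simp add: dickson_form_def A algebra_simps)
    hence e4: "?K b = ?K c * a * frob 1 a * frob 2 a * frob 3 a" using s(1)
      by (metis mult.commute mult_left_cancel)
    show ?thesis
      by (rule exI[of _ "a * frob 1 a * frob 2 a * frob 3 a"]) (use a e4 in \<open>simp add: e0 mult_ac\<close>)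
  next
    assume AD: "A = 0 \<and> D = 0"
    hence BC: "B \<noteq> 0" "C \<noteq> 0" using det by auto
    define a where "a = C / B"
    have C: "C = a * B" using BC by (simp add: a_def)
    have a: "a \<noteq> 0" using BC by (simp add: a_def)
    define NB where "NB = B * frob 1 B * frob 2 B * frob 3 B"
    have NB: "NB \<noteq> 0" using BC by (simp add: NB_def)
    define Na where "Na = a * frob 1 a * frob 2 a * frob 3 a"
    have Na: "Na \<noteq> 0" using a by (simp add: Na_def)
    have s_eq: "s = - ?K c * NB"
      using T[of 0 1 0 1 0 1 0 1] AD unfolding NB_def by (simp add: dickson_form_def mult_ac)
    have "Na * NB = - s * ?K b"
      using T[of 1 0 1 0 1 0 1 0] AD unfolding NB_def Na_def by (simp add: dickson_form_def C algebra_simps)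
    hence e4: "Na = ?K c * ?K b" using NB unfolding s_eq by simp
    have Kc: "?K c \<noteq> 0" using s s_eq by auto
    have Kb: "?K b \<noteq> 0" using e4 Na by auto
    have "- frob 2 c * a * frob 1 a * NB = - s * b"
      using T[of 1 0 1 0 0 1 0 1] AD unfolding NB_def by (simp add: dickson_form_def C algebra_simps)
    hence "NB * (frob 2 c * a * frob 1 a) = NB * (- ?K c * b)" unfolding s_eq by algebra
    hence e0: "frob 2 c * a * frob 1 a = - ?K c * b" using NB by (simp only: mult_cancel_left) simp
    have K2: "frob 2 (?K c) = ?K c" by (simp add: mult_ac)
    have "c * frob 2 a * frob 3 a = - ?K c * frob 2 b"
      using arg_cong[OF e0, of "frob 2"] by (simp add: mult.commute)
    with e0 have "c * frob 2 c * Na = ?K c * ?K c * (b * frob 2 b)"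
      unfolding Na_def by algebra
    hence "(c * frob 2 c) * ?K b = ?K c * (b * frob 2 b)" unfolding e4 using Kc
      by (simp add: mult_ac del: mult_eq_0_iff)
    hence e5: "b * frob 2 b = ?K b / ?K c * (c * frob 2 c)" using Kc by (simp add: field_simps)
    have Kr: "frob 1 (?K b) = ?K b" "frob 1 (?K c) = ?K c" by (simp_all add: mult_ac)
    have "frob 1 b * frob 3 b = ?K b / ?K c * (frob 1 c * frob 3 c)"
      using arg_cong[OF e5, of "frob 1"] unfolding frob_mult frob_divide Kr[unfolded frob_mult] by simp
    with e5 Kb Kc show ?thesis
      by (intro exI[of _ "?K b / ?K c"]) simp
  qed
  then obtain r where r: "r \<noteq> 0" and e: "b * frob 2 b = r * (c * frob 2 c)"
    "frob 1 b * frob 3 b = r * (frob 1 c * frob 3 c)" and K: "?K b = r * ?K c" by blast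
  \<comment> \<open>With \<open>\<gamma> = c\<^bsup>q\<^sup>2+1\<^esup>\<close> and its conjugate \<open>\<gamma>'\<close>, the relation between the last coefficients is
     \<open>(1 - r \<gamma>) (1 - r \<gamma>') = r (1 - \<gamma>) (1 - \<gamma>')\<close>, which factors.\<close>
  have "(r - 1) * (r * (c * frob 2 c) * (frob 1 c * frob 3 c) - 1) = 0"
    using K unfolding e by (simp add: algebra_simps)
  hence "r = 1 \<or> r * (c * frob 2 c) * (frob 1 c * frob 3 c) = 1" by auto
  thus ?thesis
  proof
    assume "r = 1"
    thus ?thesis using e by simp
  next
    assume "r * (c * frob 2 c) * (frob 1 c * frob 3 c) = 1"
    hence "c * frob 2 c * (frob 1 b * frob 3 b) = 1" unfolding e(2) by (simp add: mult_ac)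
    thus ?thesis by simp
  qed
qed


lemma forms_proportional_norm_1_square:
  assumes "norm_q q b = 1" "norm_q q c = 1" and fp: "forms_proportional b c A B C D s"
  shows "b * ((A * D - B * C) * (frob 1 A * frob 1 D - frob 1 B * frob 1 C)) *
      (c * (frob 2 C * X + frob 2 D * Y) * (frob 3 C * Z + frob 3 D * W)
        + (1 - c * frob 2 c) * (frob 2 A * X + frob 2 B * Y) * (frob 3 A * Z + frob 3 B * W)) ^ 2
    = c * s^2 * (b * Y * W + (1 - b * frob 2 b) * X * Z) ^ 2" (is "b * ?d * ?Qc ^ 2 = c * s^2 * ?Qb ^ 2")
proof -
  note T = forms_proportionalD(4)[OF fp]
  let ?h = "\<lambda>b X Y Z W. ((1 - b * frob 2 b) * (1 - frob 1 b * frob 3 b) * frob 2 b * X^2 * Z^2 - b * Y^2 * W^2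
      + (b * frob 2 b - (1 - b * frob 2 b) * (1 - frob 1 b * frob 3 b) - frob 1 b * frob 3 b) * X * Y * Z * W)"
  have n: "b * frob 1 b * frob 2 b * frob 3 b = 1" "c * frob 1 c * frob 2 c * frob 3 c = 1"
    using assms(1,2) by (simp_all add: norm_q_eq)
  let ?Tb = "dickson_form b (frob 1 b) (frob 2 b) (frob 3 b)"
    and ?Tc = "dickson_form c (frob 1 c) (frob 2 c) (frob 3 c)"
  let ?X = "frob 2 A * X + frob 2 B * Y" and ?Y = "frob 2 C * X + frob 2 D * Y"
  let ?Z = "frob 3 A * Z + frob 3 B * W" and ?W = "frob 3 C * Z + frob 3 D * W"
  have "?Tc A C (frob 1 A) (frob 1 C) ?X ?Y ?Z ?W = s * ?Tb 1 0 1 0 X Y Z W"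
    "?Tc B D (frob 1 B) (frob 1 D) ?X ?Y ?Z ?W = s * ?Tb 0 1 0 1 X Y Z W"
    "?Tc A C (frob 1 B) (frob 1 D) ?X ?Y ?Z ?W = s * ?Tb 1 0 0 1 X Y Z W"
    "?Tc B D (frob 1 A) (frob 1 C) ?X ?Y ?Z ?W = s * ?Tb 0 1 1 0 X Y Z W"
    using T[of 1 0 1 0 X Y Z W] T[of 0 1 0 1 X Y Z W] T[of 1 0 0 1 X Y Z W] T[of 0 1 1 0 X Y Z W]
    by simp_all
  hence "?d * ?h c ?X ?Y ?Z ?W = (s * ?Tb 1 0 1 0 X Y Z W) * (s * ?Tb 0 1 0 1 X Y Z W)
      - (s * ?Tb 1 0 0 1 X Y Z W) * (s * ?Tb 0 1 1 0 X Y Z W)"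
    unfolding pair_det_dickson_form_transformed[symmetric] by (simp only:)
  also have "\<dots> = s^2 * (?Tb 1 0 1 0 X Y Z W * ?Tb 0 1 0 1 X Y Z W - ?Tb 1 0 0 1 X Y Z W * ?Tb 0 1 1 0 X Y Z W)"
    by (simp add: algebra_simps power2_eq_square)
  also have "\<dots> = s^2 * ?h b X Y Z W"
    unfolding pair_det_dickson_form_transformed by simp
  finally have *: "?d * ?h c ?X ?Y ?Z ?W = s^2 * ?h b X Y Z W" .
  have "b * ?d * (- (?Qc ^ 2)) = b * ?d * (c * ?h c ?X ?Y ?Z ?W)"
    by (subst norm_1_square[OF n(2)]) simp
  also have "\<dots> = b * c * (?d * ?h c ?X ?Y ?Z ?W)" by (simp only: mult_ac)
  also have "\<dots> = c * s^2 * (b * ?h b X Y Z W)" unfolding * by (simp only: mult_ac)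
  also have "\<dots> = c * s^2 * (- (?Qb ^ 2))"
    by (subst norm_1_square[OF n(1)]) simp
  finally show ?thesis by simp
qed

lemma norm_1_ne_0: "norm_q q b = 1 \<Longrightarrow> b \<noteq> (0::'a)"
  by (auto simp: norm_q_eq)

text \<open>The bilinear form of two neighbouring slots is degenerate exactly when \<open>b\<^bsup>q\<^sup>2+1\<^esup> = 1\<close>, and
  degeneracy is preserved.\<close>

lemma forms_proportional_beta_ne_1:
  assumes norms: "norm_q q b = 1" "norm_q q c = 1" and fp: "forms_proportional b c A B C D s"
    and "c * frob 2 c \<noteq> 1"
  shows "b * frob 2 b \<noteq> 1"
proof
  assume "b * frob 2 b = 1"
  have det: "A * D - B * C \<noteq> 0" using fp by (simp add: forms_proportional_def)
  have det': "frob n A * frob n D - frob n B * frob n C \<noteq> 0" for n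
    using det by (metis frob_diff frob_eq_0_iff frob_mult)
  note sq = forms_proportional_norm_1_square[OF norms fp]
  have "c * frob 2 C * frob 3 C + (1 - c * frob 2 c) * frob 2 A * frob 3 A = 0"
    "c * frob 2 C * frob 3 D + (1 - c * frob 2 c) * frob 2 A * frob 3 B = 0"
    using sq[of 1 0 1 0] sq[of 1 0 0 1] \<open>b * frob 2 b = 1\<close> det det'[of 1] norms norm_1_ne_0[of b] by auto
  hence "c * frob 2 C * (frob 3 A * frob 3 D - frob 3 B * frob 3 C) = 0"
    "(1 - c * frob 2 c) * frob 2 A * (frob 3 A * frob 3 D - frob 3 B * frob 3 C) = 0" by algebra+
  with det'[of 3] assms(4) norm_1_ne_0[OF norms(2)] have "A = 0" "C = 0" by auto
  with det show False by simp
qed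

text \<open>The invariance of the bilinear forms up to a factor \<open>\<mu>\<close> expresses the Frobenius image of the
  matrix through the matrix itself. Going once around the cycle of four conjugates, and comparing
  with the determinants of the bilinear forms, shows that the relative norm of \<open>\<mu>\<close>, suitably
  normalized, lies in the small field. Then the decomposition of the form leaves only
  \<open>b\<^bsup>q\<^sup>2+1\<^esup> = c\<^bsup>q\<^sup>2+1\<^esup>\<close>.\<close>

lemma forms_proportional_imp_beta_norm_1:
  assumes norms: "norm_q q b = 1" "norm_q q c = 1" and fp: "forms_proportional b c A B C D s"
    and ne: "c * frob 2 c \<noteq> 1" "b * frob 2 b \<noteq> 1"
  shows "c * frob 2 c = b * frob 2 b"
proof -
  note det = forms_proportionalD(1)[OF fp] and s = forms_proportionalD(2,3)[OF fp]
    and T = forms_proportionalD(4)[OF fp]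
  have det': "frob n A * frob n D - frob n B * frob n C \<noteq> 0" for n
    using det by (metis frob_diff frob_eq_0_iff frob_mult)
  have bc: "b \<noteq> 0" "c \<noteq> 0" using norms norm_1_ne_0 by auto
  define \<beta> \<gamma> where "\<beta> = b * frob 2 b" and "\<gamma> = c * frob 2 c"
  have ne': "\<beta> \<noteq> 1" "\<gamma> \<noteq> 1" "\<beta> \<noteq> 0" "\<gamma> \<noteq> 0" using ne bc by (simp_all add: \<beta>_def \<gamma>_def)
  have n: "b * frob 1 b * frob 2 b * frob 3 b = 1" "c * frob 1 c * frob 2 c * frob 3 c = 1"
    using norms by (simp_all add: norm_q_eq)
  have fr: "frob 1 \<beta> = 1 / \<beta>" "frob 1 \<gamma> = 1 / \<gamma>" "frob 2 \<beta> = \<beta>" "frob 2 \<gamma> = \<gamma>"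
    "frob 1 b * frob 3 b = 1 / \<beta>" "frob 1 c * frob 3 c = 1 / \<gamma>"
    using n bc by (simp_all add: \<beta>_def \<gamma>_def field_simps)
  let ?Qc = "\<lambda>X Y Z W. c * Y * W + (1 - \<gamma>) * X * Z"
  note sq = forms_proportional_norm_1_square[OF norms fp, folded \<beta>_def \<gamma>_def]
  define d where "d = (A * D - B * C) * (frob 1 A * frob 1 D - frob 1 B * frob 1 C)"
  have d: "d \<noteq> 0" using det det'[of 1] by (simp add: d_def)
  define f00 where "f00 = ?Qc (frob 2 A) (frob 2 C) (frob 3 A) (frob 3 C)"
  define f01 where "f01 = ?Qc (frob 2 A) (frob 2 C) (frob 3 B) (frob 3 D)"
  define f10 where "f10 = ?Qc (frob 2 B) (frob 2 D) (frob 3 A) (frob 3 C)"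
  define f11 where "f11 = ?Qc (frob 2 B) (frob 2 D) (frob 3 B) (frob 3 D)"
  have sq': "b * d * (f00 * X * Z + f01 * X * W + f10 * Y * Z + f11 * Y * W) ^ 2
      = c * s^2 * (b * Y * W + (1 - \<beta>) * X * Z) ^ 2" for X Y Z W
  proof -
    have "f00 * X * Z + f01 * X * W + f10 * Y * Z + f11 * Y * W =
      ?Qc (frob 2 A * X + frob 2 B * Y) (frob 2 C * X + frob 2 D * Y)
        (frob 3 A * Z + frob 3 B * W) (frob 3 C * Z + frob 3 D * W)"
      by (simp add: f00_def f01_def f10_def f11_def algebra_simps)
    thus ?thesis using sq[of X Y Z W] unfolding d_def by (simp only:)
  qed
  have "b * d * f01 ^ 2 = 0" "b * d * f10 ^ 2 = 0" using sq'[of 1 0 1 0] sq'[of 0 1 0 1] by simp_all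
  hence f01: "f01 = 0" and f10: "f10 = 0" using d bc by simp_all
  define \<mu> where "\<mu> = f11 / b"
  have f11: "f11 = \<mu> * b" using bc by (simp add: \<mu>_def)
  have e11: "b * d * (\<mu> * b) ^ 2 = c * s^2 * b ^ 2" using sq'[of 0 0 1 1] by (simp add: f11)
  have e00: "b * d * f00 ^ 2 = c * s^2 * (1 - \<beta>) ^ 2" using sq'[of 1 1 0 0] by simp
  have e1: "b * d * (f00 + \<mu> * b) ^ 2 = c * s^2 * (b + (1 - \<beta>)) ^ 2"
    using sq'[of 1 1 1 1] by (simp add: f11 f01 f10)
  have \<mu>: "\<mu> \<noteq> 0" using e11 bc s d by auto
  have cs: "c * s^2 = b * d * \<mu> ^ 2" using e11 bc by (simp add: power_mult_distrib mult_ac)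
  have sq00: "f00 ^ 2 = (\<mu> * (1 - \<beta>)) ^ 2" using e00 bc d unfolding cs by (simp add: power_mult_distrib)
  have "(f00 + \<mu> * b) ^ 2 = (\<mu> * (b + (1 - \<beta>))) ^ 2"
    using e1 bc d unfolding cs by (simp add: power_mult_distrib)
  \<comment> \<open>The squares determine the bilinear form up to sign in each coefficient; the mixed term fixes the
     relative sign, except in characteristic two, where there is no sign to fix.\<close>
  hence "2 * \<mu> * b * (f00 - \<mu> * (1 - \<beta>)) = 0" using sq00 by algebra
  hence "2 = (0::'a) \<or> f00 = \<mu> * (1 - \<beta>)" using bc \<mu> by auto
  hence f00: "f00 = \<mu> * (1 - \<beta>)"
  proof
    assume "2 = (0::'a)"
    moreover have "(f00 - u) ^ 2 = f00 ^ 2 - u ^ 2 + 2 * (u ^ 2 - f00 * u)" for u by algebra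
    ultimately have "(f00 - \<mu> * (1 - \<beta>)) ^ 2 = 0" using sq00 by simp
    thus ?thesis by simp
  qed
  define \<delta> where "\<delta> = frob 2 A * frob 2 D - frob 2 B * frob 2 C"
  have \<delta>: "\<delta> \<noteq> 0" using det'[of 2] by (simp add: \<delta>_def)
  \<comment> \<open>The bilinear relation turns the Frobenius image of the matrix into its cofactor matrix.\<close>
  have E: "(1 - \<gamma>) * frob 2 A * frob 3 A + c * frob 2 C * frob 3 C = \<mu> * (1 - \<beta>)"
    "(1 - \<gamma>) * frob 2 A * frob 3 B + c * frob 2 C * frob 3 D = 0"
    "(1 - \<gamma>) * frob 2 B * frob 3 A + c * frob 2 D * frob 3 C = 0"
    "(1 - \<gamma>) * frob 2 B * frob 3 B + c * frob 2 D * frob 3 D = \<mu> * b"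
    using f00 f01 f10 f11 by (simp_all add: f00_def f01_def f10_def f11_def add_ac)
  have A3: "frob 3 A * (1 - \<gamma>) * \<delta> = \<mu> * (1 - \<beta>) * frob 2 D"
    and D3: "frob 3 D * c * \<delta> = \<mu> * b * frob 2 A"
    and B3: "frob 3 B * (1 - \<gamma>) * \<delta> = - \<mu> * b * frob 2 C"
    and C3: "frob 3 C * c * \<delta> = - \<mu> * (1 - \<beta>) * frob 2 B"
    using E unfolding \<delta>_def by algebra+
  have Edet: "(1 - \<gamma>) * c * \<delta> * frob 1 \<delta> = \<mu>^2 * (1 - \<beta>) * b"
  proof -
    have "frob 1 \<delta> = frob 3 A * frob 3 D - frob 3 B * frob 3 C" by (simp add: \<delta>_def)
    thus ?thesis using E unfolding \<delta>_def by algebra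
  qed
  define M where "M = \<mu> * frob 2 \<mu>"
  define P where "P = \<delta> * frob 1 \<delta> * frob 2 \<delta> * frob 3 \<delta>"
  have P: "P \<noteq> 0" using \<delta> by (simp add: P_def)
  have M0: "M \<noteq> 0" using \<mu> by (simp add: M_def)
  have M2: "(1 - \<gamma>)^2 * \<gamma> * P = M^2 * (1 - \<beta>)^2 * \<beta>"
  proof -
    have "(1 - \<gamma>) * frob 2 c * frob 2 \<delta> * frob 3 \<delta> = (frob 2 \<mu>)^2 * (1 - \<beta>) * frob 2 b"
      using arg_cong[OF Edet, of "frob 2"] by (simp add: fr)
    with Edet show ?thesis unfolding \<gamma>_def[symmetric] unfolding P_def M_def \<gamma>_def \<beta>_def by algebra
  qed
  have g1: "frob 1 (1 - \<beta>) = - (1 - \<beta>) / \<beta>" "frob 1 (1 - \<gamma>) = - (1 - \<gamma>) / \<gamma>"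
    using ne' by (simp_all add: fr field_simps)
  have g2: "(frob 1 (1 - \<beta>))^2 * \<beta> = (1 - \<beta>)^2 / \<beta>" "(frob 1 (1 - \<gamma>))^2 * \<gamma> = (1 - \<gamma>)^2 / \<gamma>"
    unfolding g1 using ne' by (simp_all add: power2_eq_square) (simp_all add: algebra_simps)
  have M1: "M * frob 1 M * (1 - \<beta>)^2 * \<gamma> = P * (1 - \<gamma>)^2 * \<beta>"
  proof -
    have fr2: "frob 2 (frob 1 (1 - \<beta>)) = frob 1 (1 - \<beta>)" "frob 2 (frob 1 (1 - \<gamma>)) = frob 1 (1 - \<gamma>)"
      using fr(3,4) by (metis frob_1 frob_diff frob_frob add.commute)+
    have "\<exists>k. k * (frob 1 (1 - \<gamma>))^2 * \<gamma> * P = k * (frob 1 (1 - \<beta>))^2 * \<beta> * (M * frob 1 M) \<and> k \<noteq> 0"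
    proof (cases "A = 0")
      case False
      have "A * frob 1 (1 - \<gamma>) * frob 1 \<delta> = frob 1 \<mu> * frob 1 (1 - \<beta>) * frob 3 D"
        using arg_cong[OF A3, of "frob 1"] by (simp del: frob_diff)
      with D3 have 1: "A * frob 1 (1 - \<gamma>) * frob 1 \<delta> * c * \<delta> = frob 1 \<mu> * frob 1 (1 - \<beta>) * \<mu> * b * frob 2 A"
        by algebra
      have 2: "frob 2 A * frob 1 (1 - \<gamma>) * frob 3 \<delta> * frob 2 c * frob 2 \<delta>
          = frob 3 \<mu> * frob 1 (1 - \<beta>) * frob 2 \<mu> * frob 2 b * A"
        using arg_cong[OF 1, of "frob 2"] fr2 by (simp del: frob_diff)
      have "frob 1 M = frob 1 \<mu> * frob 3 \<mu>" by (simp add: M_def)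
      with 1 2 have "A * frob 2 A * (frob 1 (1 - \<gamma>))^2 * \<gamma> * P = A * frob 2 A * (frob 1 (1 - \<beta>))^2 * \<beta> * (M * frob 1 M)"
        unfolding P_def M_def \<beta>_def[symmetric] \<gamma>_def[symmetric] unfolding \<beta>_def \<gamma>_def by algebra
      with False show ?thesis by (intro exI[of _ "A * frob 2 A"]) simp
    next
      case True
      hence C0: "C \<noteq> 0" using det by auto
      have "C * frob 1 c * frob 1 \<delta> = - frob 1 \<mu> * frob 1 (1 - \<beta>) * frob 3 B"
        using arg_cong[OF C3, of "frob 1"] by (simp del: frob_diff)
      with B3 have 1: "C * frob 1 c * frob 1 \<delta> * (1 - \<gamma>) * \<delta> = frob 1 \<mu> * frob 1 (1 - \<beta>) * \<mu> * b * frob 2 C"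
        by algebra
      have 2: "frob 2 C * frob 3 c * frob 3 \<delta> * (1 - \<gamma>) * frob 2 \<delta>
          = frob 3 \<mu> * frob 1 (1 - \<beta>) * frob 2 \<mu> * frob 2 b * C"
        using arg_cong[OF 1, of "frob 2"] fr2(1) fr(4) frob_diff[of 2 1 \<gamma>] by (simp del: frob_diff)
      have "frob 1 M = frob 1 \<mu> * frob 3 \<mu>" by (simp add: M_def)
      with 1 2 have *: "C * frob 2 C * (1 - \<gamma>)^2 * (frob 1 c * frob 3 c) * P
          = C * frob 2 C * (frob 1 (1 - \<beta>))^2 * (b * frob 2 b) * (M * frob 1 M)"
        unfolding P_def M_def by algebra
      have "C * frob 2 C * (frob 1 (1 - \<gamma>))^2 * \<gamma> * P = C * frob 2 C * (frob 1 (1 - \<beta>))^2 * \<beta> * (M * frob 1 M)"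
      proof -
        have "(frob 1 (1 - \<gamma>))^2 * \<gamma> = (1 - \<gamma>)^2 * (1 / \<gamma>)" unfolding g2 by simp
        with * show ?thesis unfolding fr(6) \<beta>_def[symmetric] by (simp only: mult.assoc)
      qed
      with C0 show ?thesis by (intro exI[of _ "C * frob 2 C"]) simp
    qed
    then obtain k where k: "k \<noteq> 0"
      and eq: "k * (frob 1 (1 - \<gamma>))^2 * \<gamma> * P = k * (frob 1 (1 - \<beta>))^2 * \<beta> * (M * frob 1 M)" by blast
    have "(frob 1 (1 - \<gamma>))^2 * \<gamma> * P = (frob 1 (1 - \<beta>))^2 * \<beta> * (M * frob 1 M)"
      using eq k by (simp add: mult.assoc del: frob_diff)
    hence "(1 - \<gamma>)^2 / \<gamma> * P = (1 - \<beta>)^2 / \<beta> * (M * frob 1 M)"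
      unfolding g2 .
    thus ?thesis using ne' by (simp add: field_simps)
  qed
  have MM: "frob 1 M * \<gamma>^2 = M * \<beta>^2"
  proof -
    have "M * (1 - \<beta>)^2 * (frob 1 M * \<gamma>^2) = \<gamma> * (P * (1 - \<gamma>)^2 * \<beta>)"
      unfolding M1[symmetric] by (simp add: power2_eq_square mult_ac)
    also have "\<dots> = \<beta> * ((1 - \<gamma>)^2 * \<gamma> * P)" by (simp only: mult_ac)
    also have "\<dots> = M * (1 - \<beta>)^2 * (M * \<beta>^2)" unfolding M2 by (simp add: power2_eq_square mult_ac)
    finally show ?thesis using M0 ne' by simp
  qed
  have E1: "frob 2 c * D * frob 1 D + (1 - c * frob 2 c) * B * frob 1 B = frob 2 \<mu> * frob 2 b"
    "frob 1 c * frob 3 D * D + (1 - frob 1 c * frob 3 c) * frob 3 B * B = frob 1 \<mu> * frob 1 b"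
    "frob 3 c * frob 1 D * frob 2 D + (1 - frob 1 c * frob 3 c) * frob 1 B * frob 2 B = frob 3 \<mu> * frob 3 b"
    using arg_cong[OF E(4), of "frob 2"] arg_cong[OF E(4), of "frob 1"] arg_cong[OF E(4), of "frob 3"]
    by (simp_all add: \<gamma>_def add_ac mult_ac)
  have E2: "frob 3 c * frob 1 C * frob 2 D + (1 - frob 1 c * frob 3 c) * frob 1 A * frob 2 B = 0"
    using arg_cong[OF E(2), of "frob 3"] by (simp add: \<gamma>_def add_ac mult_ac)
  have E3: "frob 2 c * C * frob 1 C + (1 - c * frob 2 c) * A * frob 1 A = frob 2 \<mu> * (1 - \<beta>)"
    using arg_cong[OF E(1), of "frob 2"] fr(3) by (simp add: \<gamma>_def add_ac mult_ac)
  have E4: "c * frob 2 D * frob 3 D + (1 - c * frob 2 c) * frob 2 B * frob 3 B = \<mu> * b"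
    using E(4) by (simp add: \<gamma>_def add_ac)
  note dec = dickson_form_norm_1_decomposition[OF n(2)]
  have "(1 - \<gamma>) * s = \<gamma> * (frob 3 \<mu> * frob 3 b) * (frob 1 \<mu> * frob 1 b) - (frob 2 \<mu> * frob 2 b) * (\<mu> * b)"
    using dec[of B D "frob 1 B" "frob 1 D" "frob 2 B" "frob 2 D" "frob 3 B" "frob 3 D"]
      T[of 0 1 0 1 0 1 0 1] unfolding E1 E4 by (simp add: dickson_form_def \<gamma>_def)
  also have "\<dots> = \<gamma> * frob 1 M * (frob 1 b * frob 3 b) - M * \<beta>"
    by (simp add: M_def \<beta>_def)
  finally have s1: "(1 - \<gamma>) * s = \<gamma> * frob 1 M / \<beta> - M * \<beta>" unfolding fr(5) by simp
  have "(1 - \<gamma>) * (s * - b) = - (frob 2 \<mu> * (1 - \<beta>)) * (\<mu> * b)"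
    using dec[of A C "frob 1 A" "frob 1 C" "frob 2 B" "frob 2 D" "frob 3 B" "frob 3 D"]
      T[of 1 0 1 0 0 1 0 1] unfolding E4 E2 E3 by (simp add: dickson_form_def \<gamma>_def)
  hence "(1 - \<gamma>) * s * b = M * (1 - \<beta>) * b" unfolding M_def by algebra
  hence "(1 - \<gamma>) * s = M * (1 - \<beta>)" using bc by simp
  with s1 have "\<gamma> * frob 1 M / \<beta> = M" by algebra
  hence "\<gamma> * frob 1 M = M * \<beta>" using ne' by (simp add: field_simps)
  with MM have "M * \<beta> * \<gamma> = M * \<beta> * \<beta>" by algebra
  hence "\<gamma> = \<beta>" using M0 ne' by simp
  thus ?thesis by (simp add: \<beta>_def \<gamma>_def)
qed

end

section \<open>The equivalence criteria\<close>

lemma field_embedding_simps: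
  assumes "field_embedding \<sigma>"
  shows "\<sigma> 0 = 0" "\<sigma> 1 = 1" "\<sigma> (x + y) = \<sigma> x + \<sigma> y" "\<sigma> (x * y) = \<sigma> x * \<sigma> y"
    "\<sigma> (x ^ n) = \<sigma> x ^ n" "\<sigma> (of_nat k) = of_nat k" "\<sigma> (sum f A) = (\<Sum>a\<in>A. \<sigma> (f a))"
proof -
  have add: "\<sigma> (x + y) = \<sigma> x + \<sigma> y" and mult: "\<sigma> (x * y) = \<sigma> x * \<sigma> y" and one: "\<sigma> 1 = 1" for x y
    using assms by (auto simp: field_embedding_def)
  show zero: "\<sigma> 0 = 0" using add[of 0 0] by (metis add.right_neutral add_left_imp_eq)
  show "\<sigma> 1 = 1" "\<sigma> (x + y) = \<sigma> x + \<sigma> y" "\<sigma> (x * y) = \<sigma> x * \<sigma> y" by (fact one add mult)+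
  show "\<sigma> (x ^ n) = \<sigma> x ^ n" by (induction n) (simp_all add: one mult)
  show "\<sigma> (of_nat k) = of_nat k" by (induction k) (simp_all add: zero one add)
  show "\<sigma> (sum f A) = (\<Sum>a\<in>A. \<sigma> (f a))"
    by (induction A rule: infinite_finite_induct) (simp_all add: zero add)
qed

context quartic_extension
begin

lemma L_set_eq: "L_set q b = {vec.span {vector [1, m]} | m. dickson b 1 m = 0}"
proof (intro set_eqI iffI)
  fix P assume P: "P \<in> L_set q b"
  then obtain v where v: "P = vec.span {v}" "v \<in> U_set q b" "v \<noteq> 0" by (auto simp: linear_set_def)
  have v2: "v $ 2 = b * frob 1 (v $ 1) + frob 3 (v $ 1)" using v(2) by (simp add: in_U_set_iff)
  have v1: "v $ 1 \<noteq> 0"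
  proof
    assume "v $ 1 = 0"
    with v2 have "v = 0" by (simp add: vec2_eq_iff)
    with v(3) show False by simp
  qed
  define m where "m = v $ 2 / v $ 1"
  have "v = v $ 1 *s vector [1, m]" using v1 by (simp add: vec2_eq_iff m_def)
  moreover have "(\<lambda>w. v $ 1 *s w) ` vec.span {vector [1, m]} = vec.span {v $ 1 *s vector [1, m] :: 'a ^ 2}"
    by (rule span_singleton_image[where s = id]) (simp_all add: mult.commute)
  moreover have "(\<lambda>w. v $ 1 *s w) ` vec.span {vector [1, m] :: 'a ^ 2} = vec.span {vector [1, m]}"
  proof (intro set_eqI iffI)
    fix w :: "'a ^ 2" assume "w \<in> vec.span {vector [1, m]}"
    hence "(1 / v $ 1) *s w \<in> vec.span {vector [1, m]}" by (rule vec.span_scale)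
    thus "w \<in> (\<lambda>w. v $ 1 *s w) ` vec.span {vector [1, m]}"
      using v1 by (intro image_eqI[of _ _ "(1 / v $ 1) *s w"]) auto
  qed (auto intro: vec.span_scale)
  ultimately have "P = vec.span {vector [1, m]}" using v(1) by metis
  with P show "P \<in> {vec.span {vector [1, m]} | m. dickson b 1 m = 0}"
    by (auto simp: span_in_L_set_iff)
qed (auto simp: span_in_L_set_iff)

lemma proj_equiv_scaleI:
  assumes "k \<noteq> 0" "\<And>m. dickson b 1 m = 0 \<longleftrightarrow> dickson c 1 (k * m) = 0"
  shows "proj_equiv (L_set q b) (L_set q c)"
proof -
  let ?f = "plane_map 1 0 0 k"
  have f: "Vector_Spaces.linear (*s) (*s) ?f" "bij ?f"
    using assms(1) by (auto intro: linear_plane_map bij_plane_map)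
  have im: "?f ` vec.span {vector [1, m]} = vec.span {vector [1, k * m]}" for m
  proof -
    have "?f ` vec.span {vector [1, m]} = vec.span {?f (vector [1, m])}"
      by (rule span_singleton_image[where s = id]) (simp_all add: plane_map_def vec2_eq_iff)
    thus ?thesis by (simp add: plane_map_def)
  qed
  have "(\<lambda>P. ?f ` P) ` L_set q b = L_set q c"
  proof (intro set_eqI iffI)
    fix P assume "P \<in> L_set q c"
    then obtain m where m: "P = vec.span {vector [1, m]}" "dickson c 1 m = 0" unfolding L_set_eq by blast
    have "P = ?f ` vec.span {vector [1, m / k]}" "dickson b 1 (m / k) = 0"
      using m assms by (simp_all add: im)
    thus "P \<in> (\<lambda>P. ?f ` P) ` L_set q b" unfolding L_set_eq by blast
  qed (use assms(2) in \<open>auto simp: L_set_eq im\<close>)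
  with f show ?thesis unfolding proj_equiv_def by blast
qed

text \<open>If \<open>b\<close> and \<open>c\<close> have the same relative norm, their quotient is \<open>\<lambda>\<^bsup>q-q\<^sup>3\<^esup>\<close> by Hilbert 90, and
  substituting \<open>\<lambda> x\<close> for \<open>x\<close> carries one subspace to the other.\<close>

lemma proj_equiv_same_norm:
  assumes "c * frob 2 c = b * frob 2 b"
  shows "proj_equiv (L_set q b) (L_set q c)"
proof (cases "b = 0")
  case True
  with assms show ?thesis by (simp add: proj_equiv_refl)
next
  case False
  define u where "u = c / b"
  have "u * frob 2 u = 1" using assms False by (simp add: u_def)
  from hilbert_90_q2[OF this] obtain w where w: "w \<noteq> 0" "w = u * frob 2 w" by blast
  define l where "l = frob 3 w"
  have l: "l \<noteq> 0" using w by (simp add: l_def)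
  have c: "c * frob 3 l = b * frob 1 l"
    using w False by (simp add: l_def u_def field_simps)
  have "plane_map (1 / l) 0 0 (1 / frob 3 l) ` U_set q b = U_set q c"
  proof (intro set_eqI iffI)
    fix v assume "v \<in> plane_map (1 / l) 0 0 (1 / frob 3 l) ` U_set q b"
    then obtain w where "w \<in> U_set q b" "v = plane_map (1 / l) 0 0 (1 / frob 3 l) w" by blast
    with c l show "v \<in> U_set q c"
      by (simp add: in_U_set_iff plane_map_def divide_simps) (simp add: algebra_simps)
  next
    fix v assume "v \<in> U_set q c"
    with c l have "vector [l * v $ 1, frob 3 l * v $ 2] \<in> U_set q b"
      by (simp add: in_U_set_iff algebra_simps)
    moreover have "v = plane_map (1 / l) 0 0 (1 / frob 3 l) (vector [l * v $ 1, frob 3 l * v $ 2])"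
      using l by (simp add: plane_map_def vec2_eq_iff)
    ultimately show "v \<in> plane_map (1 / l) 0 0 (1 / frob 3 l) ` U_set q b" by blast
  qed
  moreover have "1 / l * (1 / frob 3 l) - 0 * 0 \<noteq> 0" using l by simp
  ultimately show ?thesis using proj_equiv_linear_set_image by metis
qed

text \<open>The polynomial \<open>b x\<^sup>q + x\<^bsup>q\<^sup>3\<^esup>\<close> and its adjoint have the same Dickson form, so they define
  the same linear set; scaling makes the adjoint monic.\<close>

lemma proj_equiv_adjoint:
  assumes "b \<noteq> 0"
  shows "proj_equiv (L_set q b) (L_set q (1 / frob 3 b))"
proof (rule proj_equiv_scaleI[where k = "1 / frob 3 b"])
  fix m
  have "(b * frob 1 b * frob 2 b * frob 3 b) * dickson (1 / frob 3 b) 1 (1 / frob 3 b * m) = dickson b 1 m"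
    using assms unfolding dickson_1_left
    by (simp add: divide_simps) (simp add: algebra_simps)
  thus "dickson b 1 m = 0 \<longleftrightarrow> dickson (1 / frob 3 b) 1 (1 / frob 3 b * m) = 0" using assms by auto
qed (use assms in simp)

text \<open>With \<open>\<beta> = b\<^bsup>q\<^sup>2+1\<^esup>\<close> and \<open>\<gamma> = c\<^bsup>q\<^sup>2+1\<^esup>\<close> the criterion reads \<open>\<gamma> = \<beta>\<close> or \<open>\<gamma> \<beta>\<^sup>q = 1\<close>; the second
  alternative is symmetric because \<open>\<beta>\<close> and \<open>\<gamma>\<close> are fixed by the square of Frobenius.\<close>

theorem proj_equiv_L_set_iff:
  "proj_equiv (L_set q b) (L_set q c) \<longleftrightarrow>
     c * frob 2 c = b * frob 2 b \<or> (c * frob 2 c) * frob 1 (b * frob 2 b) = 1"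
proof
  assume equiv: "proj_equiv (L_set q b) (L_set q c)"
  then obtain A B C D s where fp: "forms_proportional b c A B C D s"
    using proj_equiv_imp_forms_proportional by blast
  from equiv have "proj_equiv (L_set q c) (L_set q b)" by (rule proj_equiv_sym)
  then obtain A' B' C' D' s' where fp': "forms_proportional c b A' B' C' D' s'"
    using proj_equiv_imp_forms_proportional by blast
  show "c * frob 2 c = b * frob 2 b \<or> (c * frob 2 c) * frob 1 (b * frob 2 b) = 1"
  proof (cases "norm_q q b = 1")
    case False
    thus ?thesis using forms_proportional_imp_beta_norm_ne_1[OF _ fp] by blast
  next
    case nb: True
    have nc: "norm_q q c = 1" using forms_proportional_norm_ne_1[OF _ fp'] nb by blast
    show ?thesis
    proof (cases "b * frob 2 b = 1")
      case True
      thus ?thesis using forms_proportional_beta_ne_1[OF nb nc fp] by auto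
    next
      case False
      hence "c * frob 2 c \<noteq> 1" using forms_proportional_beta_ne_1[OF nc nb fp'] by auto
      from forms_proportional_imp_beta_norm_1[OF nb nc fp this False] show ?thesis by simp
    qed
  qed
next
  assume "c * frob 2 c = b * frob 2 b \<or> (c * frob 2 c) * frob 1 (b * frob 2 b) = 1"
  thus "proj_equiv (L_set q b) (L_set q c)"
  proof
    assume *: "(c * frob 2 c) * frob 1 (b * frob 2 b) = 1"
    hence b: "b \<noteq> 0" by auto
    from * b have "c * frob 2 c = (1 / frob 3 b) * frob 2 (1 / frob 3 b)"
      by (simp add: field_simps)
    from proj_equiv_same_norm[OF this] proj_equiv_adjoint[OF b] show ?thesis
      using proj_equiv_trans by blast
  qed (rule proj_equiv_same_norm)
qed

text \<open>The polynomial whose roots are the conjugates \<open>x\<^bsup>p^j\<^esup>\<close> has coefficients in the prime field, hence is fixed by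
  the automorphism, which therefore permutes its roots.\<close>

lemma field_embedding_eq_power:
  fixes x :: 'a and \<sigma> :: "'a \<Rightarrow> 'a"
  assumes \<sigma>: "field_embedding \<sigma>"
  shows "\<exists>s. \<sigma> x = x ^ (p ^ s)"
proof -
  define N where "N = h * 4"
  have N: "CARD('a) = p ^ N" "N > 0" using h1 by (simp_all add: N_def card_a q_def power_mult)
  define P where "P = (\<Prod>j<N. [:- (x ^ (p ^ j)), 1:])"
  have degP: "degree P \<le> N"
  proof -
    have "degree P \<le> (\<Sum>j<N. degree [:- (x ^ (p ^ j)), 1:])"
      unfolding P_def using degree_prod_sum_le[of "{..<N}" "\<lambda>j. [:- (x ^ (p ^ j)), 1:]"] by (simp add: o_def)
    thus ?thesis by simp
  qed
  have pow: "(y ^ p) ^ (p ^ n) = y ^ (p ^ Suc n)" for y :: 'a and n by (simp flip: power_mult)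
  have powp_diff: "(y - z) ^ p = y ^ p - z ^ p" for y z :: 'a
  proof -
    have "((y - z) + z) ^ p = (y - z) ^ p + z ^ p" using add_power_p[of "y - z" z 1] by simp
    thus ?thesis by simp
  qed
  have powN: "y ^ (p ^ N) = y" for y :: 'a using power_card_finite_field[of y] by (simp add: N)
  have poly_power: "poly P y ^ p = poly P (y ^ p)" for y
  proof -
    have "poly P y ^ p = (\<Prod>j<N. y ^ p - x ^ (p ^ Suc j))"
      by (simp add: P_def poly_prod prod_power_distrib powp_diff mult.commute flip: power_mult)
    also have "\<dots> = (\<Prod>j<N. y ^ p - x ^ (p ^ j))"
    proof -
      obtain n where n: "N = Suc n" using N(2) by (cases N) auto
      have "x ^ (p ^ Suc n) = x ^ (p ^ 0)" using powN[of x] by (simp add: n)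
      thus ?thesis unfolding n prod.lessThan_Suc_shift[of "\<lambda>j. y ^ p - x ^ (p ^ j)"]
        by (simp only: prod.lessThan_Suc o_def mult.commute)
    qed
    also have "\<dots> = poly P (y ^ p)" by (simp add: P_def poly_prod)
    finally show ?thesis .
  qed
  have P_eval: "poly P y = (\<Sum>i\<le>N. coeff P i * y ^ i)" for y
    unfolding poly_altdef by (rule sum.mono_neutral_left) (use degP in \<open>auto simp: coeff_eq_0\<close>)
  have coeff_fixed: "coeff P i ^ p = coeff P i" for i
  proof -
    define R where "R = (\<Sum>i\<le>N. monom (coeff P i ^ p - coeff P i) i)"
    have "poly R z = 0" for z
    proof -
      obtain y where z: "z = y ^ p"
        using powN[of z] N(2) by (metis Suc_pred pow power_mult mult.commute power_Suc)
      have "poly P y ^ p = (\<Sum>i\<le>N. (coeff P i * y ^ i) ^ p)"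
        unfolding P_eval by (rule freshmans_dream_sum) (simp_all add: CHAR_a prime_p)
      also have "\<dots> = (\<Sum>i\<le>N. coeff P i ^ p * z ^ i)"
        by (simp add: z power_mult_distrib mult.commute flip: power_mult)
      finally have "poly P z = (\<Sum>i\<le>N. coeff P i ^ p * z ^ i)" unfolding poly_power z .
      hence "(\<Sum>i\<le>N. (coeff P i ^ p - coeff P i) * z ^ i) = 0"
        unfolding P_eval by (simp only: left_diff_distrib sum_subtractf diff_self)
      thus ?thesis by (simp only: R_def poly_sum poly_monom)
    qed
    moreover have "degree R \<le> N" unfolding R_def
      by (intro degree_sum_le) (auto intro: order.trans[OF degree_monom_le])
    moreover have "N < CARD('a)"
      using N(1) prime_ge_2_nat[OF prime_p] by (metis less_exp power_mono order.strict_trans2 le0)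
    ultimately have "R = 0" using card_roots_le[of R N UNIV] by auto
    hence "coeff R i = 0" by simp
    show ?thesis
    proof (cases "i \<le> N")
      case True
      have "coeff R i = coeff P i ^ p - coeff P i" using True
        by (simp add: R_def coeff_sum)
      with \<open>coeff R i = 0\<close> show ?thesis by simp
    next
      case False
      hence "coeff P i = 0" using degP by (intro coeff_eq_0) auto
      thus ?thesis using prime_gt_0_nat[OF prime_p] by simp
    qed
  qed
  have "y \<in> range (of_nat :: nat \<Rightarrow> 'a)" if "y ^ p = y" for y :: 'a
  proof -
    have p1: "p > 1" by (rule prime_gt_1_nat[OF prime_p])
    let ?Z = "{y::'a. y ^ p = y}" and ?N = "(of_nat :: nat \<Rightarrow> 'a) ` {..<p}"
    have "inj_on (of_nat :: nat \<Rightarrow> 'a) {..<p}"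
    proof (rule linorder_inj_onI)
      fix k l :: nat assume kl: "k < l" "l \<in> {..<p}"
      show "of_nat k \<noteq> (of_nat l :: 'a)"
      proof
        assume "of_nat k = (of_nat l :: 'a)"
        hence "(of_nat (l - k) :: 'a) = 0" using kl(1) by (simp add: of_nat_diff)
        hence "p dvd l - k" by (simp add: of_nat_eq_0_iff_char_dvd CHAR_a)
        with kl show False by (auto dest: dvd_imp_le)
      qed
    qed auto
    hence "card ?N = p" by (simp add: card_image)
    moreover have "card ?Z \<le> p"
    proof (rule card_roots_le[where P = "monom 1 p - monom 1 1"])
      have "coeff (monom (1::'a) p - monom 1 1) p = 1" using p1 by simp
      thus "monom (1::'a) p - monom 1 1 \<noteq> 0" by (metis coeff_0 zero_neq_one)
      show "degree (monom (1::'a) p - monom 1 1) \<le> p"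
        by (intro degree_diff_le order.trans[OF degree_monom_le]) (use p1 in auto)
    qed (simp add: poly_monom)
    moreover have "?N \<subseteq> ?Z"
    proof
      fix y :: 'a assume "y \<in> ?N"
      then obtain k where "y = of_nat k" by blast
      moreover have "(of_nat k :: 'a) ^ p = of_nat k"
      proof (induction k)
        case (Suc k)
        thus ?case using add_power_p[of 1 "of_nat k" 1] by simp
      qed (use p1 in simp)
      ultimately show "y \<in> ?Z" by simp
    qed
    ultimately have "?N = ?Z" by (intro card_seteq) auto
    with that have "y \<in> ?N" by simp
    thus ?thesis by auto
  qed
  hence \<sigma>_coeff: "\<sigma> (coeff P i) = coeff P i" for i
    using coeff_fixed[of i] field_embedding_simps(6)[OF \<sigma>] by (metis imageE)
  have "poly P x = 0" unfolding P_def poly_prod using N(2) by (auto intro!: bexI[of _ 0])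
  hence "0 = \<sigma> (poly P x)" using field_embedding_simps(1)[OF \<sigma>] by simp
  also have "\<dots> = (\<Sum>i\<le>N. coeff P i * \<sigma> x ^ i)"
    unfolding P_eval by (simp add: field_embedding_simps[OF \<sigma>] \<sigma>_coeff)
  also have "\<dots> = poly P (\<sigma> x)" unfolding P_eval ..
  finally show ?thesis by (auto simp: P_def poly_prod)
qed

lemma bij_power_p: "bij (\<lambda>x::'a. x ^ (p ^ s))"
proof -
  have "inj (\<lambda>x::'a. x ^ (p ^ s))"
  proof (rule injI)
    fix x y :: 'a assume "x ^ (p ^ s) = y ^ (p ^ s)"
    moreover have "(x - y) ^ (p ^ s) + y ^ (p ^ s) = x ^ (p ^ s)" using add_power_p[of "x - y" y s] by simp
    ultimately have "(x - y) ^ (p ^ s) = 0" by simp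
    thus "x = y" by simp
  qed
  thus ?thesis by (simp add: bij_def finite_UNIV_inj_surj)
qed

lemma field_embedding_power_p: "field_embedding (\<lambda>x::'a. x ^ (p ^ s))"
  by (simp add: field_embedding_def add_power_p power_mult_distrib)

definition coordinatewise :: "('a \<Rightarrow> 'a) \<Rightarrow> 'a ^ 2 \<Rightarrow> 'a ^ 2" where
  "coordinatewise \<sigma> v = vector [\<sigma> (v $ 1), \<sigma> (v $ 2)]"

lemma coordinatewise_image_L_set:
  assumes "field_embedding \<sigma>" "bij \<sigma>"
  shows "(\<lambda>P. coordinatewise \<sigma> ` P) ` L_set q b = L_set q (\<sigma> b)"
    and bij_coordinatewise: "bij (coordinatewise \<sigma>)"
    and coordinatewise_add: "coordinatewise \<sigma> (v + w) = coordinatewise \<sigma> v + coordinatewise \<sigma> w"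
    and coordinatewise_scale: "coordinatewise \<sigma> (c *s v) = \<sigma> c *s coordinatewise \<sigma> v"
proof -
  let ?k = "coordinatewise \<sigma>"
  note \<sigma> = field_embedding_simps[OF assms(1)]
  show add: "?k (v + w) = ?k v + ?k w" and scale: "?k (c *s v) = \<sigma> c *s ?k v" for v w c
    by (simp_all add: coordinatewise_def vec2_eq_iff \<sigma>)
  have inv: "\<sigma> (inv \<sigma> x) = x" "inv \<sigma> (\<sigma> x) = x" for x
    using assms(2) by (simp_all add: bij_def surj_f_inv_f)
  show bij: "bij ?k"
    by (rule o_bij[of "\<lambda>v. vector [inv \<sigma> (v $ 1), inv \<sigma> (v $ 2)]"])
      (auto simp: fun_eq_iff coordinatewise_def vec2_eq_iff inv)
  have "(\<lambda>P. ?k ` P) ` L_set q b = linear_set (?k ` U_set q b)"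
  proof (rule image_linear_set)
    show "?k ` vec.span {v} = vec.span {?k v}" for v
      by (rule span_singleton_image[where s = \<sigma>]) (use scale assms(2) in \<open>auto simp: bij_def\<close>)
    have "?k 0 = 0" by (simp add: coordinatewise_def vec2_eq_iff \<sigma>)
    thus "?k v = 0 \<longleftrightarrow> v = 0" for v using bij by (metis bij_pointE)
  qed
  also have "?k ` U_set q b = U_set q (\<sigma> b)"
  proof (intro set_eqI iffI)
    fix v assume "v \<in> ?k ` U_set q b"
    thus "v \<in> U_set q (\<sigma> b)" by (auto simp: coordinatewise_def U_set_def \<sigma>)
  next
    fix v assume "v \<in> U_set q (\<sigma> b)"
    then obtain x where v: "v = vector [x, \<sigma> b * x ^ q + x ^ (q ^ 3)]" by (auto simp: U_set_def)
    define y where "y = inv \<sigma> x"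
    have "x = \<sigma> y" by (simp add: y_def inv)
    hence "v = ?k (vector [y, b * y ^ q + y ^ (q ^ 3)])" by (simp add: v coordinatewise_def \<sigma>)
    thus "v \<in> ?k ` U_set q b" by (auto simp: U_set_def)
  qed
  finally show "(\<lambda>P. ?k ` P) ` L_set q b = L_set q (\<sigma> b)" .
qed

text \<open>A semilinear map is a linear map after the coordinatewise action of its automorphism, which takes
  the linear set of \<open>b\<close> to that of \<open>\<sigma> b\<close>.\<close>

lemma semilin_equiv_iff_ex_automorphism:
  fixes b c :: 'a
  shows
  "semilin_equiv (L_set q b) (L_set q c) \<longleftrightarrow>
     (\<exists>\<sigma>. field_embedding \<sigma> \<and> bij \<sigma> \<and> proj_equiv (L_set q (\<sigma> b)) (L_set q c))"
proof
  assume "semilin_equiv (L_set q b) (L_set q c)"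
  then obtain f where semilin: "semilinear f" and f: "bij f" "(\<lambda>P. f ` P) ` L_set q b = L_set q c"
    unfolding semilin_equiv_def by (elim exE conjE) (rule that)
  from semilin obtain \<sigma> where \<sigma>: "field_embedding \<sigma>" "bij \<sigma>"
    and add: "\<forall>v w. f (v + w) = f v + f w" and scale: "\<forall>c v. f (c *s v) = \<sigma> c *s f v"
    unfolding semilinear_def by (elim exE conjE) (rule that)
  define k where "k = coordinatewise \<sigma>"
  note k = coordinatewise_image_L_set[OF \<sigma>, folded k_def] bij_coordinatewise[OF \<sigma>, folded k_def]
    coordinatewise_add[OF \<sigma>, folded k_def] coordinatewise_scale[OF \<sigma>, folded k_def]
  have ik: "inv k (k v) = v" "k (inv k v) = v" for v using k(2) by (simp_all add: bij_def surj_f_inv_f)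
  have iadd: "inv k (v + w) = inv k v + inv k w" for v w
  proof -
    have "v + w = k (inv k v + inv k w)" by (simp add: k(3) ik)
    thus ?thesis by (simp only: ik)
  qed
  define g where "g = f \<circ> inv k"
  have "Vector_Spaces.linear (*s) (*s) g"
  proof unfold_locales
    show "g (v + w) = g v + g w" for v w by (simp add: g_def iadd add)
    show "g (c *s v) = c *s g v" for c v
    proof -
      have s: "\<sigma> (inv \<sigma> c) = c" using \<sigma>(2) by (simp add: bij_def surj_f_inv_f)
      have "c *s v = k (inv \<sigma> c *s inv k v)" by (simp add: k(4) ik s)
      hence "inv k (c *s v) = inv \<sigma> c *s inv k v" by (simp add: ik)
      thus ?thesis by (simp add: g_def scale s)
    qed
  qed
  moreover have "bij g" unfolding g_def by (intro bij_comp bij_imp_bij_inv k(2) f(1))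
  moreover have "(\<lambda>P. g ` P) ` L_set q (\<sigma> b) = L_set q c"
    unfolding k(1)[symmetric] f(2)[symmetric] image_image by (simp add: g_def ik)
  ultimately show "\<exists>\<sigma>. field_embedding \<sigma> \<and> bij \<sigma> \<and> proj_equiv (L_set q (\<sigma> b)) (L_set q c)"
    using \<sigma> unfolding proj_equiv_def by blast
next
  assume "\<exists>\<sigma>. field_embedding \<sigma> \<and> bij \<sigma> \<and> proj_equiv (L_set q (\<sigma> b)) (L_set q c)"
  then obtain \<sigma> where \<sigma>: "field_embedding \<sigma>" "bij \<sigma>" and equiv: "proj_equiv (L_set q (\<sigma> b)) (L_set q c)"
    by blast
  from equiv obtain g where
    g: "Vector_Spaces.linear (*s) (*s) g" "bij g" "(\<lambda>P. g ` P) ` L_set q (\<sigma> b) = L_set q c"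
    unfolding proj_equiv_def by blast
  interpret g: Vector_Spaces.linear "(*s)" "(*s)" g by fact
  define k where "k = coordinatewise \<sigma>"
  note k = coordinatewise_image_L_set[OF \<sigma>, folded k_def] bij_coordinatewise[OF \<sigma>, folded k_def]
    coordinatewise_add[OF \<sigma>, folded k_def] coordinatewise_scale[OF \<sigma>, folded k_def]
  have "semilinear (g \<circ> k)" unfolding semilinear_def
    using \<sigma> by (intro exI[of _ \<sigma>]) (simp add: k(3,4) g.add g.scale)
  moreover have "bij (g \<circ> k)" by (intro bij_comp k(2) g(2))
  moreover have "(\<lambda>P. (g \<circ> k) ` P) ` L_set q b = L_set q c"
    unfolding g(3)[symmetric] k(1)[symmetric] image_image by simp
  ultimately show "semilin_equiv (L_set q b) (L_set q c)" unfolding semilin_equiv_def by blast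
qed

text \<open>The power \<open>q\<close> in the second alternative of the projective criterion is absorbed by the Frobenius
  exponent \<open>s\<close>, since \<open>x\<^bsup>q\<^sup>4\<^esup> = x\<close>.\<close>

theorem semilin_equiv_L_set_iff:
  "semilin_equiv (L_set q b) (L_set q c) \<longleftrightarrow>
     (\<exists>s. c * frob 2 c = (b * frob 2 b) ^ (p ^ s) \<or> (c * frob 2 c) * (b * frob 2 b) ^ (p ^ s) = 1)"
proof
  assume "semilin_equiv (L_set q b) (L_set q c)"
  then obtain \<sigma> where \<sigma>: "field_embedding \<sigma>" "proj_equiv (L_set q (\<sigma> b)) (L_set q c)"
    unfolding semilin_equiv_iff_ex_automorphism by blast
  have "\<sigma> b * frob 2 (\<sigma> b) = \<sigma> (b * frob 2 b)" by (simp add: frob_def field_embedding_simps[OF \<sigma>(1)])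
  moreover obtain s where "\<sigma> (b * frob 2 b) = (b * frob 2 b) ^ (p ^ s)"
    using field_embedding_eq_power[OF \<sigma>(1)] by blast
  ultimately have "c * frob 2 c = (b * frob 2 b) ^ (p ^ s) \<or>
      (c * frob 2 c) * frob 1 ((b * frob 2 b) ^ (p ^ s)) = 1"
    using \<sigma>(2) unfolding proj_equiv_L_set_iff by simp
  moreover have "frob 1 (x ^ (p ^ s)) = x ^ (p ^ (s + h))" for x
  proof -
    have "p ^ s * q = p ^ (s + h)" by (simp add: q_def power_add)
    thus ?thesis by (simp add: frob_def mult.commute flip: power_mult)
  qed
  ultimately show "\<exists>s. c * frob 2 c = (b * frob 2 b) ^ (p ^ s) \<or>
      (c * frob 2 c) * (b * frob 2 b) ^ (p ^ s) = 1" by metis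
next
  assume "\<exists>s. c * frob 2 c = (b * frob 2 b) ^ (p ^ s) \<or> (c * frob 2 c) * (b * frob 2 b) ^ (p ^ s) = 1"
  then obtain s where s: "c * frob 2 c = (b * frob 2 b) ^ (p ^ s) \<or>
      (c * frob 2 c) * (b * frob 2 b) ^ (p ^ s) = 1" by blast
  have norm: "b ^ n * frob 2 (b ^ n) = (b * frob 2 b) ^ n" for n by (simp add: power_mult_distrib)
  have "\<exists>s. proj_equiv (L_set q (b ^ (p ^ s))) (L_set q c)"
    using s
  proof
    assume "c * frob 2 c = (b * frob 2 b) ^ (p ^ s)"
    thus ?thesis unfolding proj_equiv_L_set_iff norm by blast
  next
    assume s: "(c * frob 2 c) * (b * frob 2 b) ^ (p ^ s) = 1"
    have "frob 1 (x ^ (p ^ (s + 3 * h))) = x ^ (p ^ s)" for x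
    proof -
      have "p ^ (s + 3 * h) = p ^ s * q ^ 3" by (simp add: q_def power_add power_mult mult.commute)
      hence "x ^ (p ^ (s + 3 * h)) = frob 3 (x ^ (p ^ s))" by (simp add: frob_def mult.commute flip: power_mult)
      thus ?thesis by simp
    qed
    hence "(c * frob 2 c) * frob 1 ((b * frob 2 b) ^ (p ^ (s + 3 * h))) = 1" using s by (simp only:)
    thus ?thesis unfolding proj_equiv_L_set_iff norm by blast
  qed
  thus "semilin_equiv (L_set q b) (L_set q c)"
    unfolding semilin_equiv_iff_ex_automorphism
    using field_embedding_power_p bij_power_p by blast
qed

end

section \<open>Scattered subspaces\<close>

sublocale quartic_extension \<subseteq> kv: vector_space "sub_scale \<iota>"
  by (rule vector_space_sub_scale[OF emb])

context quartic_extension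
begin

lemma card_independent_span:
  assumes "finite B" "kv.independent B"
  shows "card (kv.span B) = q ^ card B"
  using assms
proof (induction B)
  case (insert b B)
  have indep: "kv.independent B" and b: "b \<notin> kv.span B"
    using insert.prems insert.hyps(2) by (simp_all add: kv.independent_insert)
  let ?f = "\<lambda>(k, v). sub_scale \<iota> k b + v"
  have "inj_on ?f (UNIV \<times> kv.span B)"
  proof (rule inj_onI, clarify)
    fix k k' v v' assume v: "v \<in> kv.span B" "v' \<in> kv.span B"
      and eq: "sub_scale \<iota> k b + v = sub_scale \<iota> k' b + v'"
    have "sub_scale \<iota> (k - k') b = v' - v"
      using eq by (simp add: kv.scale_left_diff_distrib algebra_simps)
    hence *: "sub_scale \<iota> (k - k') b \<in> kv.span B" using v by (simp add: kv.span_diff)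
    have "k = k'"
    proof (rule ccontr)
      assume "k \<noteq> k'"
      with kv.span_scale[OF *, of "inverse (k - k')"] b show False by simp
    qed
    with eq show "k = k' \<and> v = v'" by simp
  qed
  moreover have "?f ` (UNIV \<times> kv.span B) = kv.span (insert b B)"
  proof (intro set_eqI iffI)
    fix x assume "x \<in> kv.span (insert b B)"
    then obtain k where "x - sub_scale \<iota> k b \<in> kv.span B" by (auto simp: kv.span_insert)
    thus "x \<in> ?f ` (UNIV \<times> kv.span B)" 
      by (intro image_eqI[of _ _ "(k, x - sub_scale \<iota> k b)"]) auto
  next
    fix x assume "x \<in> ?f ` (UNIV \<times> kv.span B)"
    then obtain k v where "x = sub_scale \<iota> k b + v" "v \<in> kv.span B" by auto
    thus "x \<in> kv.span (insert b B)" by (auto simp: kv.span_insert intro!: exI[of _ k])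
  qed
  ultimately have "card (kv.span (insert b B)) = card ((UNIV :: 'k set) \<times> kv.span B)"
    by (metis card_image)
  also have "\<dots> = q * q ^ card B" using insert.IH[OF indep] by (simp add: card_cartesian_product card_k)
  finally show ?case using insert.hyps by simp
qed simp

lemma card_sub_subspace:
  assumes "sub_subspace \<iota> U"
  shows "card U = q ^ sub_dim \<iota> U"
proof -
  obtain B where B: "B \<subseteq> U" "kv.independent B" "U \<subseteq> kv.span B" "card B = kv.dim U"
    using kv.basis_exists by blast
  have "kv.span B = U" using B assms by (meson kv.span_minimal subset_antisym)
  thus ?thesis using card_independent_span[OF _ B(2)] B(4) by simp
qed

lemma sub_dim_eq_iff:
  assumes "sub_subspace \<iota> U"
  shows "sub_dim \<iota> U = n \<longleftrightarrow> card U = q ^ n"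
  unfolding card_sub_subspace[OF assms] using q_ge_2 by (simp add: power_inject_exp)

lemma sub_subspaceI:
  assumes "0 \<in> U" "\<And>v w. v \<in> U \<Longrightarrow> w \<in> U \<Longrightarrow> v + w \<in> U" "\<And>k v. v \<in> U \<Longrightarrow> \<iota> k *s v \<in> U"
  shows "sub_subspace \<iota> U"
  unfolding kv.subspace_def sub_scale_def using assms by blast

lemma sub_subspaceD:
  assumes "sub_subspace \<iota> U"
  shows "0 \<in> U" "\<And>v w. v \<in> U \<Longrightarrow> w \<in> U \<Longrightarrow> v + w \<in> U" "\<And>k v. v \<in> U \<Longrightarrow> \<iota> k *s v \<in> U"
    "\<And>v w. v \<in> U \<Longrightarrow> w \<in> U \<Longrightarrow> v - w \<in> U"
  using assms kv.subspace_diff[OF assms] unfolding kv.subspace_def sub_scale_def by blast+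

lemma sub_subspace_Int_span:
  assumes "sub_subspace \<iota> U"
  shows "sub_subspace \<iota> (U \<inter> vec.span A)"
  using sub_subspaceD[OF assms]
  by (intro sub_subspaceI) (auto intro: vec.span_add vec.span_scale vec.span_zero)

lemma scattered_iff_card:
  assumes "sub_subspace \<iota> U"
  shows "scattered \<iota> U \<longleftrightarrow> (\<forall>v\<in>U - {0}. card (U \<inter> vec.span {v}) = q)"
  unfolding scattered_def linear_set_def
  using sub_dim_eq_iff[OF sub_subspace_Int_span[OF assms], of _ 1] by auto

lemma U_set_subspace: "sub_subspace \<iota> (U_set q (b :: 'a))"
  by (rule sub_subspaceI) (auto simp: in_U_set_iff algebra_simps)

lemma card_U_set: "card (U_set q (b :: 'a)) = q ^ 4"
proof -
  let ?f = "\<lambda>x::'a. vector [x, b * x ^ q + x ^ (q ^ 3)] :: 'a ^ 2"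
  have "U_set q b = range ?f" by (auto simp: U_set_def)
  moreover have "inj ?f" by (rule injI) (simp add: vec2_eq_iff)
  ultimately show ?thesis by (simp add: card_image card_a)
qed

text \<open>If \<open>x\<close> and \<open>c x\<close> span the same point, then \<open>d = c\<^sup>q - c\<close> satisfies an equation
  \<open>B d = d\<^bsup>q\<^sup>3\<^esup>\<close> with \<open>N(B) = N(b)\<close>. Taking norms forces \<open>d = 0\<close>, that is, \<open>c\<close> lies in the small
  field.\<close>

lemma norm_ne_1_imp_scattered:
  fixes b :: 'a
  assumes "norm_q q b \<noteq> 1"
  shows "scattered \<iota> (U_set q b)"
  unfolding scattered_iff_card[OF U_set_subspace]
proof
  fix v assume "v \<in> U_set q b - {0}"
  hence v: "v \<in> U_set q b" "v \<noteq> 0" by auto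
  define x where "x = v $ 1"
  have v2: "v $ 2 = b * frob 1 x + frob 3 x" using v(1) by (simp add: in_U_set_iff x_def)
  have x: "x \<noteq> 0"
  proof
    assume "x = 0"
    with v2 have "v = 0" by (simp add: vec2_eq_iff x_def[symmetric])
    with v(2) show False by simp
  qed
  have "U_set q b \<inter> vec.span {v} = (\<lambda>k. \<iota> k *s v) ` UNIV"
  proof (intro set_eqI iffI)
    fix w assume w: "w \<in> U_set q b \<inter> vec.span {v}"
    then obtain c where c: "w = c *s v" by (auto simp: span_singleton_iff)
    define d where "d = frob 1 c - c"
    have "b * frob 1 (c * x) + frob 3 (c * x) = c * (b * frob 1 x + frob 3 x)"
      using w c v2 by (simp add: in_U_set_iff x_def[symmetric])
    hence "b * frob 1 x * (frob 1 c - c) = frob 3 x * (c - frob 3 c)" by (simp add: algebra_simps)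
    hence e0: "b * frob 1 x * d = frob 3 x * frob 3 d" by (simp add: d_def)
    have e1: "frob 1 b * frob 2 x * frob 1 d = x * d" using arg_cong[OF e0, of "frob 1"] by simp
    have e2: "frob 2 b * frob 3 x * frob 2 d = frob 1 x * frob 1 d" using arg_cong[OF e0, of "frob 2"] by simp
    have e3: "frob 3 b * x * frob 3 d = frob 2 x * frob 2 d" using arg_cong[OF e0, of "frob 3"] by simp
    let ?n = "x * frob 1 x * frob 2 x * frob 3 x * (d * frob 1 d * frob 2 d * frob 3 d)"
    have "(b * frob 1 x * d) * (frob 1 b * frob 2 x * frob 1 d) * (frob 2 b * frob 3 x * frob 2 d)
       * (frob 3 b * x * frob 3 d) = ?n"
      unfolding e0 e1 e2 e3 by (simp only: mult_ac)
    hence "norm_q q b * ?n = ?n" unfolding norm_q_eq by (simp only: mult_ac)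
    hence "?n = 0" using assms by simp
    hence "d = 0" using x by simp
    hence "c \<in> range \<iota>" by (simp add: range_iota d_def)
    with c show "w \<in> (\<lambda>k. \<iota> k *s v) ` UNIV" by auto
  next
    fix w assume "w \<in> (\<lambda>k. \<iota> k *s v) ` UNIV"
    thus "w \<in> U_set q b \<inter> vec.span {v}"
      using sub_subspaceD(3)[OF U_set_subspace v(1)] by (auto simp: span_singleton_iff)
  qed
  moreover have "inj (\<lambda>k. \<iota> k *s v)"
  proof (rule injI)
    fix k k' assume "\<iota> k *s v = \<iota> k' *s v"
    with v(2) have "\<iota> k = \<iota> k'" by simp
    thus "k = k'" using inj_iota by (simp add: inj_eq)
  qed
  ultimately show "card (U_set q b \<inter> vec.span {v}) = q" by (simp add: card_image card_k)
qed

lemma norm_ne_1_imp_max_scattered: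
  fixes b :: 'a
  assumes "norm_q q b \<noteq> 1"
  shows "max_scattered_linear_set \<iota> (L_set q b)"
  unfolding max_scattered_linear_set_def
  using U_set_subspace norm_ne_1_imp_scattered[OF assms] card_U_set sub_dim_eq_iff[OF U_set_subspace]
  by blast

definition dot :: "'a ^ 2 \<Rightarrow> 'a ^ 2 \<Rightarrow> 'a" where
  "dot u w = u $ 1 * w $ 1 + u $ 2 * w $ 2"

lemma dot_simps [simp]:
  "dot (u + v) w = dot u w + dot v w" "dot u (w + w') = dot u w + dot u w'"
  "dot (u - v) w = dot u w - dot v w" "dot u (w - w') = dot u w - dot u w'"
  "dot (c *s u) w = c * dot u w" "dot u (c *s w) = c * dot u w"
  "dot 0 w = 0" "dot u 0 = 0" "dot (- u) w = - dot u w"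
  by (simp_all add: dot_def algebra_simps)

lemma card_functional_kernel_le:
  assumes U: "sub_subspace \<iota> U" and sc: "scattered \<iota> U" and u: "u \<noteq> 0"
  shows "card {w \<in> U. dot u w = 0} \<le> q"
proof (cases "\<exists>v\<in>U - {0}. dot u v = 0")
  case True
  then obtain v where v: "v \<in> U" "v \<noteq> 0" "dot u v = 0" by blast
  have "{w \<in> U. dot u w = 0} \<subseteq> U \<inter> vec.span {v}"
  proof safe
    fix w assume w: "w \<in> U" "dot u w = 0"
    have d: "v $ 1 * w $ 2 = v $ 2 * w $ 1"
    proof -
      have "u $ 1 * (v $ 1 * w $ 2 - v $ 2 * w $ 1) = 0" "u $ 2 * (v $ 1 * w $ 2 - v $ 2 * w $ 1) = 0"
        using v(3) w(2) unfolding dot_def by algebra+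
      with u show ?thesis by (auto simp: vec2_eq_iff)
    qed
    show "w \<in> vec.span {v}"
    proof (cases "v $ 1 = 0")
      case True
      with v(2) have "v $ 2 \<noteq> 0" by (auto simp: vec2_eq_iff)
      with d True show ?thesis unfolding span_singleton_iff
        by (intro exI[of _ "w $ 2 / v $ 2"]) (auto simp: vec2_eq_iff)
    next
      case False
      with d show ?thesis unfolding span_singleton_iff
        by (intro exI[of _ "w $ 1 / v $ 1"]) (auto simp: vec2_eq_iff field_simps)
    qed
  qed
  hence "card {w \<in> U. dot u w = 0} \<le> card (U \<inter> vec.span {v})" by (intro card_mono) auto
  also have "\<dots> = q" using sc v(1,2) unfolding scattered_iff_card[OF U] by blast
  finally show ?thesis .
next
  case False
  hence "{w \<in> U. dot u w = 0} \<subseteq> {0}" by auto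
  hence "card {w \<in> U. dot u w = 0} \<le> card {0 :: 'a ^ 2}" by (intro card_mono) auto
  thus ?thesis using q_ge_2 by simp
qed

text \<open>A functional whose values on \<open>U\<close> satisfy a linearized equation of degree \<open>q\<^sup>2\<close> takes few
  values, so its kernel on \<open>U\<close> is too large for \<open>U\<close> to be scattered.\<close>

lemma scattered_no_short_relation:
  assumes U: "sub_subspace \<iota> U" and card_U: "card U = q ^ 4" and sc: "scattered \<iota> U" and u: "u \<noteq> 0"
    and a: "(a0, a1, a2) \<noteq> (0, 0, 0)"
    and rel: "\<And>w. w \<in> U \<Longrightarrow> a0 * dot u w + a1 * frob 1 (dot u w) + a2 * frob 2 (dot u w) = 0"
  shows False
proof -
  let ?I = "dot u ` U"
  have "card ?I \<le> q ^ 2" by (rule card_linearized_kernel_le[OF a]) (use rel in auto)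
  have fibre: "card {w \<in> U. dot u w = y} \<le> q" if "y \<in> ?I" for y
  proof -
    from that obtain w0 where w0: "w0 \<in> U" "y = dot u w0" by blast
    have "card {w \<in> U. dot u w = y} \<le> card {w \<in> U. dot u w = 0}"
      by (rule card_inj_on_le[of "\<lambda>w. w - w0"])
        (use w0 sub_subspaceD(4)[OF U] in \<open>auto simp: inj_on_def\<close>)
    also have "\<dots> \<le> q" by (rule card_functional_kernel_le[OF U sc u])
    finally show ?thesis .
  qed
  have "card U = card (\<Union>y\<in>?I. {w \<in> U. dot u w = y})" by (rule arg_cong[where f = card]) auto
  also have "\<dots> \<le> (\<Sum>y\<in>?I. card {w \<in> U. dot u w = y})" by (rule card_UN_le) simp
  also have "\<dots> \<le> (\<Sum>y\<in>?I. q)" by (rule sum_mono) (rule fibre)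
  also have "\<dots> \<le> q ^ 2 * q" using \<open>card ?I \<le> q ^ 2\<close> by simp
  also have "\<dots> = q ^ 3" by (simp add: power2_eq_square power3_eq_cube)
  also have "\<dots> < q ^ 4" by (rule q_power_less) simp
  finally show False using card_U by simp
qed

text \<open>If \<open>N(b) = 1\<close>, a functional with few values exists. Normalized as \<open>x + Y (b x\<^sup>q + x\<^bsup>q\<^sup>3\<^esup>)\<close>, it
  satisfies a relation as required as soon as \<open>Y\<^bsup>q+1\<^esup> = - b\<^bsup>q\<^sup>2\<^esup> / (1 - b\<^bsup>q\<^sup>2+1\<^esup>)\<close>, and the right side is a
  power of exponent \<open>q + 1\<close> because its relative norm lies in the small field. If
  \<open>b\<^bsup>q\<^sup>2+1\<^esup> = 1\<close>, the functional \<open>b x\<^sup>q + x\<^bsup>q\<^sup>3\<^esup>\<close> itself has few values.\<close>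

lemma norm_1_short_relation:
  fixes b :: 'a
  assumes "norm_q q b = 1"
  shows "\<exists>u a0 a1 a2. u \<noteq> 0 \<and> (a0, a1, a2) \<noteq> (0, 0, 0) \<and>
    (\<forall>w\<in>U_set q b. a0 * dot u w + a1 * frob 1 (dot u w) + a2 * frob 2 (dot u w) = 0)"
proof -
  define \<beta> where "\<beta> = b * frob 2 b"
  have b: "b \<noteq> 0" using norm_1_ne_0[OF assms] .
  have n: "b * frob 1 b * frob 2 b * frob 3 b = 1" using assms by (simp add: norm_q_eq)
  show ?thesis
  proof (cases "\<beta> = 1")
    case True
    have "- frob 2 b * dot (vector [0, 1]) w + 0 * frob 1 (dot (vector [0, 1]) w) + 1 * frob 2 (dot (vector [0, 1]) w) = 0"
      if "w \<in> U_set q b" for w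
    proof -
      have d: "dot (vector [0, 1]) w = b * frob 1 (w $ 1) + frob 3 (w $ 1)"
        using that by (simp add: dot_def in_U_set_iff)
      have "b * frob 2 b = 1" using True by (simp add: \<beta>_def)
      hence "frob 2 b * (b * frob 1 (w $ 1)) = frob 1 (w $ 1)" by (simp add: mult.commute mult.left_commute)
      thus ?thesis unfolding d by (simp add: algebra_simps)
    qed
    thus ?thesis by (intro exI[of _ "vector [0, 1]"] exI[of _ "- frob 2 b"] exI[of _ 0] exI[of _ 1])
        (auto simp: vec2_eq_iff)
  next
    case False
    have b13: "frob 1 b * frob 3 b = 1 / \<beta>" and \<beta>0: "\<beta> \<noteq> 0"
      using n b by (simp_all add: \<beta>_def field_simps)
    have \<beta>1: "frob 1 \<beta> = 1 / \<beta>" "frob 2 \<beta> = \<beta>" using b13 by (simp_all add: \<beta>_def mult.commute)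
    define y where "y = - frob 2 b / (1 - \<beta>)"
    have yy: "y * frob 2 y = \<beta> / (1 - \<beta>)^2"
      using \<beta>1 by (simp add: y_def \<beta>_def power2_eq_square mult.commute)
    have "\<exists>x. x * frob 1 x = y"
    proof (rule power_q_plus_1_surj)
      show "y \<noteq> 0" using b False by (simp add: y_def)
      have "frob 1 (\<beta> / (1 - \<beta>)^2) = (1 / \<beta>) / (1 - 1 / \<beta>)^2" by (simp add: \<beta>1)
      also have "(1 - 1 / \<beta>)^2 = (1 - \<beta>)^2 / \<beta>^2" using \<beta>0
        by (simp add: power2_eq_square divide_simps) (simp add: algebra_simps)
      also have "(1 / \<beta>) / ((1 - \<beta>)^2 / \<beta>^2) = \<beta> / (1 - \<beta>)^2" using \<beta>0
        by (simp add: power2_eq_square)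
      finally show "frob 1 (y * frob 2 y) = y * frob 2 y" unfolding yy .
    qed
    then obtain Y where Y: "Y * frob 1 Y = y" by blast
    have Y0: "Y \<noteq> 0" using Y b False by (auto simp: y_def)
    have YY: "Y * frob 1 Y * (1 - \<beta>) = - frob 2 b" using Y False by (simp add: y_def)
    have "frob 1 Y * frob 2 Y * (1 - 1 / \<beta>) = - frob 3 b"
      using arg_cong[OF YY, of "frob 1"] by (simp add: \<beta>1)
    hence YY1: "frob 1 Y * frob 2 Y * (\<beta> - 1) = - frob 3 b * \<beta>" using \<beta>0 by (simp add: field_simps)
    have b13': "frob 1 b * frob 3 b * \<beta> = 1" using b13 \<beta>0 by simp
    have k1: "Y * frob 1 Y * b + frob 1 b * frob 1 Y * frob 2 Y = 1"
    proof -
      have "(1 - \<beta>) * (Y * frob 1 Y * b + frob 1 b * frob 1 Y * frob 2 Y) = 1 - \<beta>"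
        using YY YY1 b13' \<beta>_def by algebra
      with False show ?thesis by simp
    qed
    have k3: "Y * frob 1 Y + frob 1 b * frob 1 Y * frob 2 Y * frob 2 b = 0"
    proof -
      have "(1 - \<beta>) * (Y * frob 1 Y + frob 1 b * frob 1 Y * frob 2 Y * frob 2 b) = 0"
        using YY YY1 b13' \<beta>_def by algebra
      with False show ?thesis by simp
    qed
    have "frob 1 Y * dot (vector [1, Y]) w + - 1 * frob 1 (dot (vector [1, Y]) w)
        + frob 1 b * frob 1 Y * frob 2 (dot (vector [1, Y]) w) = 0" if "w \<in> U_set q b" for w
    proof -
      let ?x = "w $ 1"
      have d: "dot (vector [1, Y]) w = ?x + Y * (b * frob 1 ?x + frob 3 ?x)"
        using that by (simp add: dot_def in_U_set_iff)
      have d1: "frob 1 (dot (vector [1, Y]) w) = frob 1 ?x + frob 1 Y * (frob 1 b * frob 2 ?x + ?x)"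
        and d2: "frob 2 (dot (vector [1, Y]) w) = frob 2 ?x + frob 2 Y * (frob 2 b * frob 3 ?x + frob 1 ?x)"
        unfolding d by simp_all
      show ?thesis unfolding d1 d2 unfolding d using k1 k3 by algebra
    qed
    thus ?thesis
      by (intro exI[of _ "vector [1, Y]"] exI[of _ "frob 1 Y"] exI[of _ "- 1"] exI[of _ "frob 1 b * frob 1 Y"])
        (auto simp: vec2_eq_iff)
  qed
qed

lemma scattered_image_norm_ne_1:
  fixes b :: 'a
  assumes U: "sub_subspace \<iota> U" "card U = q ^ 4" "scattered \<iota> U"
    and det: "A * D - B * C \<noteq> 0" and im: "plane_map A B C D ` U = U_set q b"
  shows "norm_q q b \<noteq> 1"
proof
  assume "norm_q q b = 1"
  then obtain u a0 a1 a2 where u: "u \<noteq> 0" "(a0, a1, a2) \<noteq> (0, 0, 0)"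
    and rel: "\<forall>w\<in>U_set q b. a0 * dot u w + a1 * frob 1 (dot u w) + a2 * frob 2 (dot u w) = 0"
    using norm_1_short_relation by blast
  define v where "v = (vector [u $ 1 * A + u $ 2 * C, u $ 1 * B + u $ 2 * D] :: 'a ^ 2)"
  have dv: "dot u (plane_map A B C D w) = dot v w" for w
    by (simp add: dot_def v_def plane_map_def algebra_simps)
  have "v \<noteq> 0"
  proof
    assume "v = 0"
    hence "u $ 1 * A + u $ 2 * C = 0" "u $ 1 * B + u $ 2 * D = 0" by (simp_all add: v_def vec2_eq_iff)
    hence "u $ 1 * (A * D - B * C) = 0" "u $ 2 * (A * D - B * C) = 0" by algebra+
    with det u(1) show False by (simp add: vec2_eq_iff)
  qed
  from scattered_no_short_relation[OF U this u(2)] show False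
    using rel unfolding im[symmetric] by (simp add: dv)
qed

end

section \<open>Quadratic equations over the subfield of order \<open>q\<^sup>2\<close>\<close>

context quartic_extension
begin

lemma card_frob_2_fixed: "card {x. frob 2 x = x} = q ^ 2"
proof -
  have "{x. frob 2 x = x} = insert 0 {x. x ^ (q ^ 2 - 1) = 1}"
    using q_power_less[of 0 2] by (auto simp: frob_2_fixed_iff)
  moreover have "card {x::'a. x ^ (q ^ 2 - 1) = 1} = q ^ 2 - 1"
    using card_roots_of_unity[of "q ^ 2 - 1" "q ^ 2 + 1", where ?'a = 'a] card_a_minus_1 by (simp add: mult.commute)
  moreover have "0 \<notin> {x::'a. x ^ (q ^ 2 - 1) = 1}"
    using q_power_less[of 0 2] by (simp add: power_0_left)
  ultimately show ?thesis by simp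
qed

lemma card_trace_fibre:
  assumes "frob 2 t = t"
  shows "card {x. x + frob 2 x = t} = q ^ 2"
proof -
  from ex_linearized_nonzero[of 1 0 1 0] obtain z where z: "z + frob 2 z \<noteq> 0" by auto
  define r where "r = z / (z + frob 2 z)"
  have "r + frob 2 r = z / (z + frob 2 z) + frob 2 z / (z + frob 2 z)"
    by (simp add: r_def add.commute)
  hence r: "r + frob 2 r = 1" using z by (simp flip: add_divide_distrib)
  from hilbert_90_q2[of "- 1"] obtain w where w0: "w \<noteq> 0" and "w = - frob 2 w" by auto
  hence w: "w \<noteq> 0" "frob 2 w = - w" using minus_minus[of "frob 2 w"] by simp_all
  have "bij_betw (\<lambda>x. r * t + w * x) {x. frob 2 x = x} {x. x + frob 2 x = t}"
  proof (rule bij_betw_byWitness[where f' = "\<lambda>y. (y - r * t) / w"])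
    have rt: "r * t + frob 2 r * t = t" using r by (metis distrib_right mult_1)
    thus "(\<lambda>x. r * t + w * x) ` {x. frob 2 x = x} \<subseteq> {x. x + frob 2 x = t}"
      using w assms by (auto simp: algebra_simps)
    have "frob 2 ((y - r * t) / w) = (y - r * t) / w" if y: "y + frob 2 y = t" for y
    proof -
      have "frob 2 y = t - y" "frob 2 r * t = t - r * t"
        using y rt by (metis add_diff_cancel_left')+
      hence "frob 2 y - frob 2 r * t = - (y - r * t)" by simp
      thus ?thesis using w assms by (simp add: divide_simps)
    qed
    thus "(\<lambda>y. (y - r * t) / w) ` {x. x + frob 2 x = t} \<subseteq> {x. frob 2 x = x}" by auto
  qed (use w in auto)
  from bij_betw_same_card[OF this] show ?thesis using card_frob_2_fixed by simp
qed

text \<open>A quadratic polynomial over the subfield of order \<open>q\<^sup>2\<close> splits over the whole field. For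
  fixed \<open>t\<close>, the map \<open>x \<mapsto> x\<^sup>2 - t x\<close> sends both the subfield and the elements of relative trace
  \<open>t\<close> into the subfield; counted with multiplicity these are \<open>2 q\<^sup>2\<close> arguments, and no value is
  taken more than twice, so all \<open>q\<^sup>2\<close> elements of the subfield are values.\<close>

lemma quadratic_root:
  assumes t: "frob 2 t = t" and d: "frob 2 d = d"
  shows "\<exists>x. x * x = t * x - d"
proof -
  define S where "S = {x. frob 2 x = x}"
  define S' where "S' = {x. x + frob 2 x = t}"
  define f where "f = (\<lambda>x::'a. x * x - t * x)"
  define F where "F = case_sum f f"
  let ?A = "S <+> S'"
  have f_eq: "f x = f y \<longleftrightarrow> y = x \<or> y = t - x" for x y
  proof -
    have "f x - f y = (x - y) * (x + y - t)" unfolding f_def by (simp add: algebra_simps)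
    hence "f x = f y \<longleftrightarrow> x - y = 0 \<or> x + y - t = 0" by (metis mult_eq_0_iff right_minus_eq)
    thus ?thesis by (auto simp: algebra_simps)
  qed
  have sub: "F ` ?A \<subseteq> S"
  proof -
    have "frob 2 (f x) - f x = (frob 2 x - x) * (x + frob 2 x - t)" for x
      unfolding f_def by (simp add: t algebra_simps)
    moreover have "(frob 2 x - x) * (x + frob 2 x - t) = 0" if "x \<in> S \<or> x \<in> S'" for x
      using that unfolding S_def S'_def by auto
    ultimately have "frob 2 (f x) - f x = 0" if "x \<in> S \<or> x \<in> S'" for x using that by simp
    hence "x \<in> S \<or> x \<in> S' \<Longrightarrow> f x \<in> S" for x by (simp add: S_def)
    thus ?thesis by (auto simp: F_def)
  qed
  have fibre: "card {a \<in> ?A. F a = y} \<le> 2" if "y \<in> F ` ?A" for y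
  proof -
    from that obtain x where x: "x \<in> S \<or> x \<in> S'" "y = f x" by (force simp: F_def)
    have S_iff: "t - x \<in> S \<longleftrightarrow> x \<in> S" by (auto simp: S_def t)
    have S'_iff: "t - x \<in> S' \<longleftrightarrow> x \<in> S'" by (auto simp: S'_def t algebra_simps)
    have both: "t - x = x" if "x \<in> S" "x \<in> S'" using that by (auto simp: S_def S'_def algebra_simps)
    have *: "{a \<in> ?A. F a = y} \<subseteq> {a. (\<exists>z \<in> S. a = Inl z \<and> (z = x \<or> z = t - x)) \<or>
        (\<exists>z \<in> S'. a = Inr z \<and> (z = x \<or> z = t - x))}"
    proof -
      have "f z = f x \<longleftrightarrow> z = x \<or> z = t - x" for z using f_eq[of x z] by metis
      thus ?thesis by (auto simp: F_def x(2))
    qed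
    have "\<exists>a b. {a \<in> ?A. F a = y} \<subseteq> {a, b}"
    proof (cases "x \<in> S")
      case True
      show ?thesis
      proof (cases "x \<in> S'")
        case True
        have "{a \<in> ?A. F a = y} \<subseteq> {Inl x, Inr x}" using * both[OF \<open>x \<in> S\<close> True] by auto
        thus ?thesis by blast
      next
        case False
        have "{a \<in> ?A. F a = y} \<subseteq> {Inl x, Inl (t - x)}" using * False S'_iff by auto
        thus ?thesis by blast
      qed
    next
      case False
      have "{a \<in> ?A. F a = y} \<subseteq> {Inr x, Inr (t - x)}" using * False S_iff by auto
      thus ?thesis by blast
    qed
    then obtain a b where "{a \<in> ?A. F a = y} \<subseteq> {a, b}" by blast
    hence "card {a \<in> ?A. F a = y} \<le> card {a, b}" by (intro card_mono) auto
    also have "\<dots> \<le> 2" by (simp add: card_insert_if)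
    finally show ?thesis .
  qed
  have "2 * q ^ 2 = card ?A"
    using card_frob_2_fixed card_trace_fibre[OF t] by (simp add: card_Plus S_def S'_def)
  also have "card ?A = card (\<Union>y\<in>F ` ?A. {a \<in> ?A. F a = y})" by (rule arg_cong[where f = card]) auto
  also have "\<dots> \<le> (\<Sum>y\<in>F ` ?A. card {a \<in> ?A. F a = y})" by (rule card_UN_le) simp
  also have "\<dots> \<le> (\<Sum>y\<in>F ` ?A. 2)" by (rule sum_mono) (rule fibre)
  finally have "card S \<le> card (F ` ?A)" using card_frob_2_fixed by (simp add: S_def)
  hence "F ` ?A = S" by (intro card_seteq sub) auto
  moreover have "- d \<in> S" by (simp add: S_def d)
  ultimately have "- d \<in> F ` ?A" by simp
  then obtain x where "- d = f x" by (auto simp: F_def)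
  thus ?thesis by (intro exI[of _ x]) (simp add: f_def algebra_simps)
qed

end

section \<open>Pairs of semilinear maps of the plane\<close>

lemma plane_dichotomy:
  fixes u w :: "'a::field ^ 2"
  assumes "u \<noteq> 0"
  obtains c where "w = c *s u"
  | "u $ 1 * w $ 2 - u $ 2 * w $ 1 \<noteq> 0"
    "\<And>v. \<exists>a b. v = a *s u + b *s w" "\<And>a b. a *s u + b *s w = 0 \<Longrightarrow> a = 0 \<and> b = 0"
proof (cases "u $ 1 * w $ 2 - u $ 2 * w $ 1 = 0")
  case True
  show ?thesis
  proof (cases "u $ 1 = 0")
    case True
    with assms have "u $ 2 \<noteq> 0" by (auto simp: vec2_eq_iff)
    with \<open>u $ 1 * w $ 2 - u $ 2 * w $ 1 = 0\<close> True show ?thesis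
      by (intro that(1)[of "w $ 2 / u $ 2"]) (auto simp: vec2_eq_iff)
  next
    case False
    with \<open>u $ 1 * w $ 2 - u $ 2 * w $ 1 = 0\<close> show ?thesis
      by (intro that(1)[of "w $ 1 / u $ 1"]) (auto simp: vec2_eq_iff field_simps)
  qed
next
  case False
  let ?d = "u $ 1 * w $ 2 - u $ 2 * w $ 1"
  show ?thesis
  proof (rule that(2)[OF False])
    fix v :: "'a ^ 2"
    have "(v $ 1 * w $ 2 - v $ 2 * w $ 1) * u $ i + (u $ 1 * v $ 2 - u $ 2 * v $ 1) * w $ i = ?d * v $ i"
      if "i = 1 \<or> i = 2" for i using that by (auto simp: algebra_simps)
    hence "v = ((v $ 1 * w $ 2 - v $ 2 * w $ 1) / ?d) *s u + ((u $ 1 * v $ 2 - u $ 2 * v $ 1) / ?d) *s w"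
      using False by (simp add: vec2_eq_iff add_divide_distrib[symmetric])
    thus "\<exists>a b. v = a *s u + b *s w" by blast
  next
    fix a b assume "a *s u + b *s w = 0"
    hence "a * u $ 1 + b * w $ 1 = 0" "a * u $ 2 + b * w $ 2 = 0" by (simp_all add: vec2_eq_iff)
    hence "a * ?d = 0" "b * ?d = 0" by algebra+
    with False show "a = 0 \<and> b = 0" by simp
  qed
qed

text \<open>Such a pair is what remains of a Frobenius-semilinear map \<open>\<phi>\<close> of a four-dimensional space
  \<open>C \<oplus> \<phi>\<^sup>2 C\<close> with \<open>\<phi>\<^sup>4 = 1\<close> when it is written as \<open>\<phi> v = G v + \<phi>\<^sup>2 (H v)\<close> on the plane \<open>C\<close>.\<close>

locale semilinear_pair = quartic_extension \<iota> p h q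
  for \<iota> :: "'k::{field,finite} \<Rightarrow> 'a::{field,finite}" and p h q +
  fixes G H :: "'a ^ 2 \<Rightarrow> 'a ^ 2"
  assumes G_add: "G (v + w) = G v + G w" and G_scale: "G (c *s v) = frob 1 c *s G v"
    and H_add: "H (v + w) = H v + H w" and H_scale: "H (c *s v) = frob 3 c *s H v"
    and GG_HH: "G (G v) + H (H v) = 0" and GH_HG: "G (H v) + H (G v) = v"
begin

lemma G_0 [simp]: "G 0 = 0" and H_0 [simp]: "H 0 = 0"
  using G_add[of 0 0] H_add[of 0 0] by simp_all

lemma G_minus: "G (- v) = - G v" and H_minus: "H (- v) = - H v"
  using G_add[of v "- v"] H_add[of v "- v"] by (simp_all add: eq_neg_iff_add_eq_0 add.commute)

lemma G_diff: "G (v - w) = G v - G w" and H_diff: "H (v - w) = H v - H w"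
  using G_add[of v "- w"] H_add[of v "- w"] by (simp_all add: G_minus H_minus)

definition M :: "'a ^ 2 \<Rightarrow> 'a ^ 2" where "M v = G (H v)"
definition Z :: "'a ^ 2 \<Rightarrow> 'a ^ 2" where "Z v = H (H v)"

lemma HG: "H (G v) = v - M v" using GH_HG[of v] by (simp add: M_def algebra_simps)
lemma GG: "G (G v) = - Z v" using GG_HH[of v] by (simp add: Z_def eq_neg_iff_add_eq_0)

lemma M_add: "M (v + w) = M v + M w" and M_scale: "M (c *s v) = c *s M v" and M_diff: "M (v - w) = M v - M w"
  by (simp_all add: M_def G_add H_add G_scale H_scale G_diff H_diff)

lemma Z_scale: "Z (c *s v) = frob 2 c *s Z v" and Z_diff: "Z (v - w) = Z v - Z w" and Z_add: "Z (v + w) = Z v + Z w"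
  by (simp_all add: Z_def H_scale H_diff H_add)

lemma G_Z: "G (Z v) = Z (G v)"
proof -
  have "G (Z v) = H v - H (G (H v))" using GH_HG[of "H v"] by (simp add: Z_def algebra_simps)
  also have "H (G (H v)) = H v - H (H (G v))"
    using arg_cong[OF GH_HG[of v], of H] by (simp add: H_add algebra_simps)
  finally show ?thesis by (simp add: Z_def)
qed

lemma M_Z: "M (Z v) = Z (M v)"
  by (simp add: M_def G_Z[symmetric]) (simp add: Z_def)

lemma M_G: "M (G v) = G v - G (M v)"
  using arg_cong[OF HG[of v], of G] by (simp add: M_def G_diff)

lemma M_one_minus_M: "M (v - M v) = - Z (Z v)"
proof -
  have "M (v - M v) = G (H (H (G v)))" by (simp only: HG[symmetric]) (simp only: M_def)
  also have "\<dots> = Z (G (G v))" using G_Z[of "G v"] by (simp add: Z_def)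
  also have "\<dots> = - Z (Z v)" using Z_diff[of 0 "Z v"] by (simp add: GG) (simp add: Z_def)
  finally show ?thesis .
qed

lemma M_cayley_hamilton: "\<exists>t d. \<forall>v. M (M v) = t *s M v - d *s v"
proof -
  define e1 where "e1 = (vector [1, 0] :: 'a ^ 2)"
  define e2 where "e2 = (vector [0, 1] :: 'a ^ 2)"
  define A B C D where "A = M e1 $ 1" and "B = M e2 $ 1" and "C = M e1 $ 2" and "D = M e2 $ 2"
  have M: "M v = plane_map A B C D v" for v
  proof -
    have "v = v $ 1 *s e1 + v $ 2 *s e2" by (simp add: e1_def e2_def vec2_eq_iff)
    hence "M v = v $ 1 *s M e1 + v $ 2 *s M e2" by (metis M_add M_scale)
    thus ?thesis by (simp add: plane_map_def vec2_eq_iff A_def B_def C_def D_def mult.commute)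
  qed
  show ?thesis
    by (intro exI[of _ "A + D"] exI[of _ "A * D - B * C"])
      (simp add: M plane_map_def vec2_eq_iff algebra_simps)
qed

text \<open>\<open>M\<close> commutes with \<open>Z\<close>, which is semilinear for the involution of the field over its
  subfield of order \<open>q\<^sup>2\<close>. So the characteristic polynomial of \<open>M\<close> lies over that subfield and
  splits.\<close>

lemma M_eigenvector:
  assumes Z_inj: "\<And>v. Z v = 0 \<Longrightarrow> v = 0"
  shows "\<exists>u l. u \<noteq> 0 \<and> M u = l *s u"
proof (rule ccontr)
  assume "\<not> ?thesis"
  hence no: "u \<noteq> 0 \<Longrightarrow> M u \<noteq> l *s u" for u l by blast
  define v where "v = (vector [1, 0] :: 'a ^ 2)"
  have v: "v \<noteq> 0" by (simp add: v_def vec2_eq_iff)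
  hence Zv: "Z v \<noteq> 0" using Z_inj by blast
  obtain t d where td: "\<And>v. M (M v) = t *s M v - d *s v" using M_cayley_hamilton by blast
  have "Z (M (M v)) = M (M (Z v))" by (simp only: M_Z)
  hence "frob 2 t *s M (Z v) - frob 2 d *s Z v = t *s M (Z v) - d *s Z v"
    unfolding td by (simp only: Z_diff Z_scale M_Z)
  hence eq: "(frob 2 t - t) *s M (Z v) = (frob 2 d - d) *s Z v"
    by (simp add: vec2_eq_iff algebra_simps)
  have t: "frob 2 t = t"
  proof (rule ccontr)
    assume "frob 2 t \<noteq> t"
    hence "M (Z v) = ((frob 2 d - d) / (frob 2 t - t)) *s Z v"
      using eq by (simp add: vec2_eq_iff field_simps)
    with no[OF Zv] show False by blast
  qed
  with eq have "(frob 2 d - d) *s Z v = 0" by simp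
  hence d: "frob 2 d = d" using Zv by simp
  obtain l where l: "l * l = t * l - d" using quadratic_root[OF t d] by blast
  define w where "w = M v - (t - l) *s v"
  have "w \<noteq> 0" using no[OF v, of "t - l"] by (simp add: w_def)
  moreover have "M w = l *s w"
  proof -
    have d_eq: "d = t * l - l * l" using l by (simp add: algebra_simps)
    show ?thesis unfolding w_def M_diff M_scale td d_eq by (simp add: vec2_eq_iff algebra_simps)
  qed
  ultimately show False using no by blast
qed

text \<open>A vector that is an eigenvector of both \<open>M\<close> and \<open>Z\<close> has parallel images under \<open>G\<close> and
  \<open>H\<close>, because \<open>G\<close> maps both images to multiples of that vector. If \<open>M\<close> is not scalar, its
  eigenspaces are lines permuted by \<open>Z\<close> and \<open>G\<close>, and the relation \<open>M G = G (1 - M)\<close> excludes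
  that \<open>Z\<close> moves them. If \<open>M\<close> is scalar, then \<open>Z\<^sup>2\<close> is multiplication by an element of the
  field of order \<open>q\<close>, so that a multiple of \<open>Z\<close> is an involution and fixes a line.\<close>

theorem ex_parallel_images:
  "\<exists>u s t. u \<noteq> 0 \<and> (s, t) \<noteq> (0, 0) \<and> s *s G u = t *s H u"
proof (cases "\<exists>u. u \<noteq> 0 \<and> (G u = 0 \<or> H u = 0)")
  case True
  then obtain u where u: "u \<noteq> 0" "G u = 0 \<or> H u = 0" by blast
  show ?thesis
  proof (cases "G u = 0")
    case True
    with u(1) show ?thesis by (intro exI[of _ u] exI[of _ 1] exI[of _ 0]) simp
  next
    case False
    with u show ?thesis by (intro exI[of _ u] exI[of _ 0] exI[of _ 1]) simp
  qed
next
  case False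
  hence G_inj: "G v = 0 \<Longrightarrow> v = 0" and H_inj: "H v = 0 \<Longrightarrow> v = 0" for v by blast+
  have Z_inj: "Z v = 0 \<Longrightarrow> v = 0" for v unfolding Z_def by (blast dest: H_inj)
  have M_inj: "M v = 0 \<Longrightarrow> v = 0" for v unfolding M_def by (blast dest: H_inj G_inj)
  have "\<exists>u l n. u \<noteq> 0 \<and> M u = l *s u \<and> Z u = n *s u"
  proof (cases "\<exists>l. \<forall>v. M v = l *s v")
    case True
    then obtain l where l: "\<And>v. M v = l *s v" by blast
    define v where "v = (vector [1, 0] :: 'a ^ 2)"
    have v: "v \<noteq> 0" by (simp add: v_def vec2_eq_iff)
    hence "G v \<noteq> 0" using G_inj by blast
    moreover have "l *s G v = G v - frob 1 l *s G v" using M_G[of v] by (simp add: l G_scale)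
    hence "(l + frob 1 l - 1) *s G v = 0" by (simp add: vec2_eq_iff algebra_simps)
    ultimately have "l + frob 1 l - 1 = 0" by (simp only: vector_mul_eq_0) simp
    hence fl: "frob 1 l = 1 - l" by (simp add: algebra_simps eq_diff_eq)
    have "frob 2 l = 1 - frob 1 l" using arg_cong[OF fl, of "frob 1"] by simp
    hence fl2: "frob 2 l = l" using fl by simp
    have l0: "l \<noteq> 0" using M_inj[of v] v l[of v] by auto
    have l1: "1 - l \<noteq> 0" using fl l0 by (metis frob_eq_0_iff)
    define r where "r = - (l * (1 - l))"
    have ZZ: "Z (Z v) = r *s v" for v
      using M_one_minus_M[of v] by (simp add: l r_def vec2_eq_iff algebra_simps)
    have r: "r \<noteq> 0" "frob 2 r = r" using l0 l1 fl2 by (simp_all add: r_def)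
    obtain m where m: "m * frob 2 m = 1 / r" using norm_q2_surj[of "1 / r"] r by auto
    have mZmZ: "m *s Z (m *s Z v) = v" for v
    proof -
      have "m * (frob 2 m * r) = 1" using m r by (simp flip: mult.assoc)
      thus ?thesis by (simp add: Z_scale ZZ)
    qed
    have m0: "m \<noteq> 0" using m r by auto
    show ?thesis
    proof (cases "v + m *s Z v = 0")
      case True
      hence "Z v = (- 1 / m) *s v" using m0 by (simp add: vec2_eq_iff field_simps eq_neg_iff_add_eq_0 add.commute)
      with v l show ?thesis by blast
    next
      case False
      let ?u = "v + m *s Z v"
      have "m *s Z ?u = ?u" using mZmZ[of v] by (simp add: Z_add vector_add_ldistrib add.commute)
      moreover have "Z ?u = (1 / m) *s (m *s Z ?u)" using m0 by simp
      ultimately have "Z ?u = (1 / m) *s ?u" by (simp only:)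
      with False l show ?thesis by blast
    qed
  next
    case nonscalar: False
    obtain u l where u: "u \<noteq> 0" "M u = l *s u" using M_eigenvector[OF Z_inj] by blast
    have MZu: "M (Z u) = frob 2 l *s Z u" by (simp add: M_Z u(2) Z_scale)
    show ?thesis
    proof (cases rule: plane_dichotomy[OF u(1), of "Z u"])
      case (1 n)
      with u show ?thesis by blast
    next
      case 2
      obtain a b where Gu: "G u = a *s u + b *s Z u" using 2(2) by blast
      have "G u \<noteq> 0" using G_inj u(1) by blast
      hence ab: "a \<noteq> 0 \<or> b \<noteq> 0" using Gu by auto
      have "M (G u) = (1 - frob 1 l) *s G u"
        unfolding M_G by (simp add: u(2) G_scale vec2_eq_iff algebra_simps)
      hence "(a * l) *s u + (b * frob 2 l) *s Z u = (1 - frob 1 l) *s (a *s u + b *s Z u)"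
        unfolding Gu M_add M_scale u(2) MZu by simp
      hence "(a * (l - 1 + frob 1 l)) *s u + (b * (frob 2 l - 1 + frob 1 l)) *s Z u = 0"
        by (simp add: vec2_eq_iff algebra_simps)
      from 2(3)[OF this] ab have "l - 1 + frob 1 l = 0 \<or> frob 2 l - 1 + frob 1 l = 0" by auto
      hence fl: "frob 1 l = 1 - l"
      proof
        assume "frob 2 l - 1 + frob 1 l = 0"
        hence "frob 3 (frob 2 l - 1 + frob 1 l) = frob 3 0" by (simp only:)
        thus ?thesis by (simp add: algebra_simps eq_diff_eq)
      qed (simp add: algebra_simps eq_diff_eq)
      have "frob 2 l = 1 - frob 1 l" using arg_cong[OF fl, of "frob 1"] by simp
      hence fl2: "frob 2 l = l" using fl by simp
      \<comment> \<open>Two independent eigenvectors for the same eigenvalue would make \<open>M\<close> scalar.\<close>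
      have "M v = l *s v" for v
      proof -
        obtain x y where v: "v = x *s u + y *s Z u" using 2(2) by blast
        show ?thesis unfolding v M_add M_scale u(2) MZu fl2
          by (simp add: vec2_eq_iff algebra_simps)
      qed
      with nonscalar show ?thesis by blast
    qed
  qed
  then obtain u l n where u: "u \<noteq> 0" "M u = l *s u" "Z u = n *s u" by blast
  have n: "n \<noteq> 0" using Z_inj[of u] u by auto
  have "G (frob 3 l *s G u - (- frob 3 n) *s H u) = 0"
  proof -
    have "G (frob 3 l *s G u - (- frob 3 n) *s H u) = frob 1 (frob 3 l) *s G (G u) - frob 1 (- frob 3 n) *s G (H u)"
      by (simp only: G_diff G_scale)
    also have "\<dots> = l *s (- (n *s u)) + n *s (l *s u)"
      unfolding GG u(3) M_def[symmetric] u(2) by simp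
    also have "\<dots> = 0" by (simp add: vec2_eq_iff algebra_simps)
    finally show ?thesis .
  qed
  from G_inj[OF this] have "frob 3 l *s G u = (- frob 3 n) *s H u" by (simp only: right_minus_eq)
  with u(1) n show ?thesis
    by (intro exI[of _ u] exI[of _ "frob 3 l"] exI[of _ "- frob 3 n"]) auto
qed

end

section \<open>Every maximum scattered linear set belongs to the family\<close>

lemma plane_map_surj_card:
  fixes U W :: "('a::{field,finite} ^ 2) set"
  assumes det: "A * D - B * C \<noteq> 0" and sub: "\<And>w. w \<in> U \<Longrightarrow> plane_map A B C D w \<in> W"
    and card: "card U = card W"
  shows "plane_map A B C D ` U = W"
proof (rule card_subset_eq)
  have "inj (plane_map A B C D)" using bij_plane_map[OF det] by (simp add: bij_def)
  hence "card (plane_map A B C D ` U) = card U" by (intro card_image) (auto simp: inj_on_def inj_def)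
  with card show "card (plane_map A B C D ` U) = card W" by simp
qed (use sub in auto)

locale scattered_subspace = quartic_extension \<iota> p h q
  for \<iota> :: "'k::{field,finite} \<Rightarrow> 'a::{field,finite}" and p h q +
  fixes U :: "('a ^ 2) set"
  assumes U: "sub_subspace \<iota> U" and card_U: "card U = q ^ 4" and sc: "scattered \<iota> U"
begin

lemma no_short_relation:
  assumes "u \<noteq> 0" "\<And>w. w \<in> U \<Longrightarrow> a0 * dot u w + a1 * frob 1 (dot u w) + a2 * frob 2 (dot u w) = 0"
  shows "a0 = 0 \<and> a1 = 0 \<and> a2 = 0"
  using scattered_no_short_relation[OF U card_U sc assms(1), of a0 a1 a2] assms(2) by blast

lemma ex_basis:
  obtains e :: "4 \<Rightarrow> 'a ^ 2" where "kv.span (range e) = U"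
proof -
  obtain B where B: "B \<subseteq> U" "kv.independent B" "U \<subseteq> kv.span B" "card B = kv.dim U"
    using kv.basis_exists by blast
  have span: "kv.span B = U" using B U by (meson kv.span_minimal subset_antisym)
  have "kv.dim U = 4" using sub_dim_eq_iff[OF U, of 4] card_U by simp
  hence "card (UNIV :: 4 set) = card B" using B(4) by simp
  then obtain e where "bij_betw e (UNIV :: 4 set) B"
    using finite_same_card_bij[of "UNIV :: 4 set" B] by auto
  hence "range e = B" by (simp add: bij_betw_def)
  with span that[of e] show ?thesis by simp
qed

end

text \<open>A vector \<open>u\<close> stands for the functional \<open>w \<mapsto> u \<cdot> w\<close> on \<open>U\<close>, recorded by its values on a
  basis. The functionals that are linear over the small field form the space \<open>F\<^sup>4\<close>, on which the
  Frobenius map acts coordinatewise.\<close>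

locale scattered_subspace_basis = scattered_subspace \<iota> p h q U
  for \<iota> :: "'k::{field,finite} \<Rightarrow> 'a::{field,finite}" and p h q U +
  fixes e :: "4 \<Rightarrow> 'a ^ 2"
  assumes span_e: "kv.span (range e) = U"
begin

definition ev :: "'a ^ 2 \<Rightarrow> 'a ^ 4" where "ev u = (\<chi> i. dot u (e i))"
definition fr :: "nat \<Rightarrow> 'a ^ 4 \<Rightarrow> 'a ^ 4" where "fr n x = (\<chi> i. frob n (x $ i))"

lemma ev_simps [simp]: "ev (u + v) = ev u + ev v" "ev (u - v) = ev u - ev v" "ev (c *s u) = c *s ev u"
    "ev 0 = 0" "ev (- u) = - ev u"
  by (simp_all add: ev_def vec_eq_iff)

lemma fr_simps [simp]: "fr n (x + y) = fr n x + fr n y" "fr n (x - y) = fr n x - fr n y"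
    "fr n (c *s x) = frob n c *s fr n x" "fr n (fr m x) = fr (n + m) x" "fr n 0 = 0" "fr 4 x = x"
    "fr 0 x = x" "fr n (- x) = - fr n x" "fr 5 x = fr 1 x"  "fr 6 x = fr 2 x"
  by (simp_all add: fr_def vec_eq_iff)

text \<open>Frobenius fixes the scalars from the small field, so the solutions of a linearized relation
  between functionals form a subspace.\<close>

lemma relation_extends:
  assumes "a *s fr n (ev u) = b *s fr m (ev v) + c *s fr k (ev x)" "w \<in> U"
  shows "a * frob n (dot u w) = b * frob m (dot v w) + c * frob k (dot x w)"
proof -
  let ?K = "{w. a * frob n (dot u w) = b * frob m (dot v w) + c * frob k (dot x w)}"
  have "sub_subspace \<iota> ?K"
    by (rule sub_subspaceI) (auto simp: distrib_left mult.left_commute[of _ "\<iota> _"])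
  moreover have "range e \<subseteq> ?K"
    using assms(1) by (auto simp: ev_def fr_def vec_eq_iff)
  ultimately have "kv.span (range e) \<subseteq> ?K" by (rule kv.span_minimal[rotated])
  with span_e assms(2) show ?thesis by auto
qed

lemma no_short_relation_ev:
  assumes "u \<noteq> 0" "a *s ev u = b *s fr 1 (ev u) + c *s fr 2 (ev u)"
  shows "a = 0 \<and> b = 0 \<and> c = 0"
proof -
  have "a *s fr 0 (ev u) = b *s fr 1 (ev u) + c *s fr 2 (ev u)" using assms(2) by simp
  from relation_extends[OF this]
  have "- a * dot u w + b * frob 1 (dot u w) + c * frob 2 (dot u w) = 0" if "w \<in> U" for w
    using that by simp
  from no_short_relation[OF assms(1) this] show ?thesis by simp
qed

text \<open>If the square of Frobenius sends the functional of \<open>v\<close> to minus that of \<open>u\<close>, then it fixes the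
  functional of \<open>v - u\<close>, and if \<open>u = v\<close> it negates the functional of \<open>v\<close>. Either is a short relation.\<close>

lemma decomposition_unique:
  assumes "ev u + fr 2 (ev v) = 0"
  shows "u = 0 \<and> v = 0"
proof (cases "v = 0")
  case True
  hence "1 *s ev u = 0 *s fr 1 (ev u) + 0 *s fr 2 (ev u)" using assms by simp
  with True show ?thesis using no_short_relation_ev[of u 1 0 0] by auto
next
  case False
  have "fr 2 (ev u + fr 2 (ev v)) = fr 2 0" using assms by (simp only:)
  hence swap: "fr 2 (ev u) = - ev v" by (simp add: eq_neg_iff_add_eq_0)
  have fv: "fr 2 (ev v) = - ev u" using assms by (simp add: eq_neg_iff_add_eq_0 add.commute)
  show ?thesis
  proof (cases "v - u = 0")
    case True
    hence "1 *s ev v = 0 *s fr 1 (ev v) + (- 1) *s fr 2 (ev v)" using fv by simp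
    with no_short_relation_ev[OF False this] show ?thesis by simp
  next
    case vu: False
    have "1 *s ev (v - u) = 0 *s fr 1 (ev (v - u)) + 1 *s fr 2 (ev (v - u))"
      using swap fv by simp
    with no_short_relation_ev[OF vu this] show ?thesis by simp
  qed
qed

text \<open>Counting: the plane and its image together have \<open>(q\<^sup>4)\<^sup>2 \<cdot> (q\<^sup>4)\<^sup>2\<close> combinations, as many as
  there are vectors.\<close>

lemma decomposition_exists: "\<exists>u v. x = ev u + fr 2 (ev v)"
proof -
  let ?f = "\<lambda>(u, v). ev u + fr 2 (ev v)"
  have "inj ?f"
  proof (rule injI, clarify)
    fix u v u' v' assume "ev u + fr 2 (ev v) = ev u' + fr 2 (ev v')"
    hence "ev (u - u') + fr 2 (ev (v - v')) = 0" by (simp add: algebra_simps)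
    from decomposition_unique[OF this] show "u = u' \<and> v = v'" by simp
  qed
  hence "card (range ?f) = CARD(('a ^ 2) \<times> ('a ^ 2))" by (rule card_image)
  also have "\<dots> = CARD('a ^ 4)" by (simp flip: power_add)
  finally have "range ?f = UNIV" by (intro card_subset_eq) auto
  hence "x \<in> range ?f" by simp
  thus ?thesis by auto
qed

lemma decomposition_eqD:
  assumes "ev u + fr 2 (ev v) = ev u' + fr 2 (ev v')"
  shows "u = u'" "v = v'"
proof -
  have "ev (u - u') + fr 2 (ev (v - v')) = 0" using assms by (simp add: algebra_simps)
  from decomposition_unique[OF this] show "u = u'" "v = v'" by simp_all
qed

text \<open>Split the Frobenius image of a functional from the plane along this decomposition; that the fourth
  power of Frobenius is the identity gives the two relations.\<close>

lemma ex_semilinear_pair: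
  "\<exists>G H. semilinear_pair \<iota> p h q G H \<and> (\<forall>u. fr 1 (ev u) = ev (G u) + fr 2 (ev (H u)))"
proof -
  have "\<forall>u. \<exists>v w. fr 1 (ev u) = ev v + fr 2 (ev w)" using decomposition_exists by blast
  then obtain G where "\<forall>u. \<exists>w. fr 1 (ev u) = ev (G u) + fr 2 (ev w)" by metis
  then obtain H where GH: "\<And>u. fr 1 (ev u) = ev (G u) + fr 2 (ev (H u))" by metis
  have "semilinear_pair \<iota> p h q G H"
  proof unfold_locales
    fix v w :: "'a ^ 2" and c :: 'a
    have "ev (G (v + w)) + fr 2 (ev (H (v + w))) = ev (G v + G w) + fr 2 (ev (H v + H w))"
      unfolding GH[symmetric] by (simp add: GH)
    from decomposition_eqD[OF this] show "G (v + w) = G v + G w" "H (v + w) = H v + H w" .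
    have "ev (G (c *s v)) + fr 2 (ev (H (c *s v))) = ev (frob 1 c *s G v) + fr 2 (ev (frob 3 c *s H v))"
      unfolding GH[symmetric] by (simp add: GH vector_add_ldistrib)
    from decomposition_eqD[OF this] show "G (c *s v) = frob 1 c *s G v" "H (c *s v) = frob 3 c *s H v" .
    have "fr 1 (fr 2 (ev (H v))) = fr 2 (ev (G (H v)) + fr 2 (ev (H (H v))))"
      unfolding GH[symmetric] by simp
    hence "fr 1 (fr 1 (ev v)) = ev (G (G v) + H (H v)) + fr 2 (ev (G (H v) + H (G v)))"
      unfolding GH[of v] fr_simps(1)[of 1] unfolding GH by (simp add: add_ac)
    hence "ev (G (G v) + H (H v)) + fr 2 (ev (G (H v) + H (G v))) = ev 0 + fr 2 (ev v)" by simp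
    from decomposition_eqD[OF this] show "G (G v) + H (H v) = 0" "G (H v) + H (G v) = v" .
  qed
  with GH show ?thesis by blast
qed

text \<open>Let \<open>y\<close> be the functional of a vector \<open>u\<close> with parallel images. Then \<open>y\<^sup>q\<close> and \<open>y\<^bsup>q\<^sup>3\<^esup>\<close> have,
  modulo the plane of functionals, proportional components, and some combination of them lies in that
  plane. In the coordinates given by \<open>y\<close> and this combination, \<open>U\<close> becomes a member of the family.\<close>

lemma ex_embedding:
  "\<exists>A B C D b. A * D - B * C \<noteq> 0 \<and> (\<forall>w\<in>U. plane_map A B C D w \<in> U_set q b)"
proof -
  obtain G H where pair: "semilinear_pair \<iota> p h q G H"
    and GH: "\<And>u. fr 1 (ev u) = ev (G u) + fr 2 (ev (H u))" using ex_semilinear_pair by blast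
  interpret semilinear_pair \<iota> p h q G H by (rule pair)
  obtain u s t where u: "u \<noteq> 0" and st: "(s, t) \<noteq> (0, 0)" and par: "s *s G u = t *s H u"
    using ex_parallel_images by blast
  have det: "u $ 1 * v $ 2 - u $ 2 * v $ 1 \<noteq> 0" if "\<And>c. v \<noteq> c *s u" for v
    using plane_dichotomy[OF u, of v] that by metis
  show ?thesis
  proof (cases "t = 0")
    case True
    with st par have Gu: "G u = 0" by simp
    let ?v = "H u"
    have E: "fr 1 (ev u) = fr 2 (ev ?v)" using GH[of u] Gu by simp
    have "fr 2 (fr 1 (ev u)) = fr 2 (fr 2 (ev ?v))" using E by (simp only:)
    hence "1 *s fr 0 (ev ?v) = 1 *s fr 3 (ev u) + 0 *s fr 0 (ev u)" by simp
    from relation_extends[OF this] have v: "dot ?v w = frob 3 (dot u w)" if "w \<in> U" for w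
      using that by simp
    have "?v \<noteq> c *s u" for c
    proof
      assume "?v = c *s u"
      hence "0 *s ev u = (- 1) *s fr 1 (ev u) + frob 2 c *s fr 2 (ev u)" using E by simp
      from no_short_relation_ev[OF u this] show False by simp
    qed
    from det[OF this] have "u $ 1 * ?v $ 2 - u $ 2 * ?v $ 1 \<noteq> 0" .
    moreover have "plane_map (u $ 1) (u $ 2) (?v $ 1) (?v $ 2) w \<in> U_set q 0" if "w \<in> U" for w
      using v[OF that] by (simp add: in_U_set_iff plane_map_def dot_def)
    ultimately show ?thesis by blast
  next
    case False
    define k where "k = s / t"
    have Hu: "H u = k *s G u" using par False
      by (metis (no_types, lifting) divide_inverse k_def mult.commute right_inverse vector_smult_assoc vector_smult_lid)
    let ?v = "G u"
    have E: "fr 1 (ev u) = ev ?v + frob 2 k *s fr 2 (ev ?v)" using GH[of u] Hu by simp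
    have ne: "?v \<noteq> c *s u" for c
    proof
      assume v: "?v = c *s u"
      have "c *s ev u = 1 *s fr 1 (ev u) + (- (frob 2 k * frob 2 c)) *s fr 2 (ev u)"
        using E unfolding v by simp
      from no_short_relation_ev[OF u this] show False by simp
    qed
    show ?thesis
    proof (cases "k = 0")
      case True
      hence "1 *s fr 0 (ev ?v) = 1 *s fr 1 (ev u) + 0 *s fr 0 (ev u)" using E by simp
      from relation_extends[OF this] have v: "dot ?v w = frob 1 (dot u w)" if "w \<in> U" for w
        using that by simp
      have "?v $ 1 * u $ 2 - ?v $ 2 * u $ 1 \<noteq> 0" using det[OF ne] by (simp add: mult.commute)
      moreover have "plane_map (?v $ 1) (?v $ 2) (u $ 1) (u $ 2) w \<in> U_set q 0" if "w \<in> U" for w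
        using v[OF that] by (simp add: in_U_set_iff plane_map_def dot_def flip: frob_mult frob_add)
      ultimately show ?thesis by blast
    next
      case k0: False
      let ?d = "1 - k * frob 2 k"
      have "fr 2 (fr 1 (ev u)) = fr 2 (ev ?v + frob 2 k *s fr 2 (ev ?v))" using E by (simp only:)
      hence E2: "fr 3 (ev u) = fr 2 (ev ?v) + k *s ev ?v" by simp
      have d: "?d \<noteq> 0"
      proof
        assume "?d = 0"
        hence kk: "frob 2 k * k = 1" by (simp add: mult.commute)
        have "fr 1 (ev u) = frob 2 k *s fr 3 (ev u)"
          unfolding E E2 by (simp add: vector_add_ldistrib kk add.commute)
        hence "fr 3 (fr 1 (ev u)) = fr 3 (frob 2 k *s fr 3 (ev u))" by (simp only:)
        hence "1 *s ev u = 0 *s fr 1 (ev u) + frob 1 k *s fr 2 (ev u)" by simp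
        from no_short_relation_ev[OF u this] show False by simp
      qed
      have "?d *s ev ?v = fr 1 (ev u) - frob 2 k *s fr 3 (ev u)"
        unfolding E E2 by (simp add: vec_eq_iff algebra_simps)
      hence "?d *s fr 0 (ev ?v) = 1 *s fr 1 (ev u) + (- frob 2 k) *s fr 3 (ev u)" by simp
      from relation_extends[OF this]
      have v: "?d * dot ?v w = frob 1 (dot u w) - frob 2 k * frob 3 (dot u w)" if "w \<in> U" for w
        using that by simp
      define c where "c = - ?d / frob 2 k"
      define b where "b = - 1 / frob 2 k"
      have c0: "c \<noteq> 0" using d k0 by (simp add: c_def)
      have "c * dot ?v w = b * frob 1 (dot u w) + frob 3 (dot u w)" if "w \<in> U" for w
      proof -
        have "c * dot ?v w = - (?d * dot ?v w) / frob 2 k"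
          by (simp only: c_def times_divide_eq_left minus_mult_left)
        also have "\<dots> = b * frob 1 (dot u w) + frob 3 (dot u w)"
          unfolding v[OF that] using k0 by (simp add: b_def field_simps)
        finally show ?thesis .
      qed
      hence "plane_map (u $ 1) (u $ 2) (c * ?v $ 1) (c * ?v $ 2) w \<in> U_set q b" if "w \<in> U" for w
        using that by (simp add: in_U_set_iff plane_map_def dot_def distrib_left mult.assoc
            flip: frob_mult frob_add)
      moreover have "u $ 1 * (c * ?v $ 2) - u $ 2 * (c * ?v $ 1) \<noteq> 0"
      proof -
        have "u $ 1 * (c * ?v $ 2) - u $ 2 * (c * ?v $ 1) = c * (u $ 1 * ?v $ 2 - u $ 2 * ?v $ 1)"
          by (simp add: algebra_simps)
        with det[OF ne] c0 show ?thesis by simp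
      qed
      ultimately show ?thesis by blast
    qed
  qed
qed

end

context quartic_extension
begin

theorem max_scattered_imp_proj_equiv:
  assumes "max_scattered_linear_set \<iota> X"
  shows "\<exists>b :: 'a. norm_q q b \<noteq> 1 \<and> proj_equiv X (L_set q b)"
proof -
  from assms obtain U where U': "sub_subspace \<iota> U" "X = linear_set U" "scattered \<iota> U" "sub_dim \<iota> U = 4"
    unfolding max_scattered_linear_set_def by blast
  have card_U: "card U = q ^ 4" using sub_dim_eq_iff[OF U'(1)] U'(4) by blast
  interpret scattered_subspace \<iota> p h q U
    by unfold_locales (fact U'(1) card_U U'(3))+
  obtain e :: "4 \<Rightarrow> 'a ^ 2" where "kv.span (range e) = U" by (rule ex_basis)
  then interpret scattered_subspace_basis \<iota> p h q U e by unfold_locales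
  obtain A B C D b where det: "A * D - B * C \<noteq> 0" and sub: "\<forall>w\<in>U. plane_map A B C D w \<in> U_set q b"
    using ex_embedding by blast
  have im: "plane_map A B C D ` U = U_set q b"
    by (rule plane_map_surj_card[OF det]) (use sub card_U card_U_set in auto)
  have "norm_q q b \<noteq> 1" by (rule scattered_image_norm_ne_1[OF U'(1) card_U U'(3) det im])
  moreover have "proj_equiv X (L_set q b)"
    unfolding U'(2) im[symmetric] by (rule proj_equiv_linear_set_image[OF det])
  ultimately show ?thesis by blast
qed

end

section \<open>Counting the classes\<close>

lemma card_image_cong_eq:
  assumes "\<And>b c. b \<in> S \<Longrightarrow> c \<in> S \<Longrightarrow> f b = f c \<longleftrightarrow> g b = g c"
  shows "card (f ` S) = card (g ` S)"
proof -
  let ?k = "\<lambda>x. g (inv_into S f x)"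
  have k: "?k (f c) = g c" if "c \<in> S" for c
  proof -
    have "inv_into S f (f c) \<in> S" "f (inv_into S f (f c)) = f c"
      using that by (simp_all add: inv_into_into f_inv_into_f)
    with assms that show ?thesis by blast
  qed
  have "inj_on ?k (f ` S)" by (rule inj_onI) (use k assms in auto)
  moreover have "?k ` f ` S = g ` S" using k by (auto simp: image_image cong: image_cong)
  ultimately show ?thesis by (metis card_image)
qed

lemma num_up_to_proj_equiv_eq_card:
  assumes "\<And>b c. b \<in> S \<Longrightarrow> c \<in> S \<Longrightarrow> proj_equiv (L b) (L c) \<longleftrightarrow> i b = i c"
  shows "num_up_to_proj_equiv (L ` S) = card (i ` S)"
proof -
  let ?R = "{(X, Y). X \<in> L ` S \<and> Y \<in> L ` S \<and> proj_equiv X Y}"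
  have "(L ` S) // ?R = (\<lambda>b. ?R `` {L b}) ` S" by (auto simp: quotient_def)
  moreover have "?R `` {L b} = ?R `` {L c} \<longleftrightarrow> i b = i c" if "b \<in> S" "c \<in> S" for b c
  proof
    assume "?R `` {L b} = ?R `` {L c}"
    moreover have "L b \<in> ?R `` {L b}" using that assms by auto
    ultimately have "L b \<in> ?R `` {L c}" by simp
    with that assms show "i b = i c" by auto
  next
    assume "i b = i c"
    with that assms show "?R `` {L b} = ?R `` {L c}" by auto
  qed
  ultimately show ?thesis
    unfolding num_up_to_proj_equiv_def using card_image_cong_eq[of S "\<lambda>b. ?R `` {L b}" i] by simp
qed

context quartic_extension
begin

lemma norm_1_circle: "{x. frob 2 x = x \<and> x * frob 1 x = 1} = {x. x ^ (q + 1) = 1}"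
proof (intro set_eqI iffI)
  fix x :: 'a assume "x \<in> {x. x ^ (q + 1) = 1}"
  hence x: "x * frob 1 x = 1" by (simp add: frob_def power_add mult.commute)
  have "frob 1 x * frob 2 x = 1" using arg_cong[OF x, of "frob 1"] by simp
  with x have "frob 2 x = x" by algebra
  with x show "x \<in> {x. frob 2 x = x \<and> x * frob 1 x = 1}" by simp
qed (simp add: frob_def power_add mult.commute)

lemma card_norm_1_circle: "card {x. frob 2 x = x \<and> x * frob 1 x = 1} = q + 1"
  unfolding norm_1_circle
  using card_roots_of_unity[of "q + 1" "(q ^ 2 + 1) * (q - 1)", where ?'a = 'a] norm_q_minus_1
  by (simp add: mult_ac)

lemma range_norm_q2: "{x. frob 2 x = x} = range (\<lambda>b. b * frob 2 b)"
  using norm_q2_surj by (force simp: mult.commute)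

text \<open>The classes correspond to the orbits of \<open>x \<mapsto> x\<^bsup>-q\<^esup>\<close> on the elements \<open>x\<close> of the subfield of order
  \<open>q\<^sup>2\<close> with \<open>x\<^bsup>q+1\<^esup> \<noteq> 1\<close>. Among these \<open>q\<^sup>2 - q - 1\<close> elements only \<open>0\<close> is fixed; it is its own
  image because the inverse of \<open>0\<close> is \<open>0\<close>.\<close>

lemma count_norm_ne_1:
  "num_up_to_proj_equiv {L_set q b | b :: 'a. norm_q q b \<noteq> 1} = q * (q - 1) div 2"
proof -
  define S where "S = {b::'a. norm_q q b \<noteq> 1}"
  define j where "j = (\<lambda>x. inverse (frob 1 x))"
  define \<beta> where "\<beta> = (\<lambda>b. b * frob 2 b)"
  define A where "A = {x. frob 2 x = x \<and> x * frob 1 x \<noteq> 1}"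
  have \<beta>_fixed: "frob 2 (\<beta> b) = \<beta> b" for b by (simp add: \<beta>_def mult.commute)
  have jj: "j (j x) = x" if "frob 2 x = x" for x using that by (simp add: j_def)
  have iff: "proj_equiv (L_set q b) (L_set q c) \<longleftrightarrow> \<beta> c = \<beta> b \<or> \<beta> c * frob 1 (\<beta> b) = 1" for b c
    unfolding \<beta>_def by (rule proj_equiv_L_set_iff)
  have "proj_equiv (L_set q b) (L_set q c) \<longleftrightarrow> {\<beta> b, j (\<beta> b)} = {\<beta> c, j (\<beta> c)}" for b c
  proof -
    have "\<beta> c * frob 1 (\<beta> b) = 1 \<longleftrightarrow> \<beta> b \<noteq> 0 \<and> \<beta> c = j (\<beta> b)"
    proof (cases "\<beta> b = 0")
      case False
      thus ?thesis by (simp add: j_def inverse_eq_divide eq_divide_eq)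
    qed simp
    moreover have "\<beta> b = 0 \<Longrightarrow> j (\<beta> b) = \<beta> b" by (simp add: j_def)
    ultimately have "proj_equiv (L_set q b) (L_set q c) \<longleftrightarrow> \<beta> c = \<beta> b \<or> \<beta> c = j (\<beta> b)"
      using iff[of b c] by metis
    also have "\<dots> \<longleftrightarrow> {\<beta> b, j (\<beta> b)} = {\<beta> c, j (\<beta> c)}"
      using jj[OF \<beta>_fixed] by (auto simp: doubleton_eq_iff)
    finally show ?thesis .
  qed
  hence "num_up_to_proj_equiv (L_set q ` S) = card ((\<lambda>b. {\<beta> b, j (\<beta> b)}) ` S)"
    by (rule num_up_to_proj_equiv_eq_card)
  also have "(\<lambda>b. {\<beta> b, j (\<beta> b)}) ` S = (\<lambda>x. {x, j x}) ` \<beta> ` S" by (simp add: image_image)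
  also have "\<beta> ` S = A"
  proof -
    have "norm_q q b = \<beta> b * frob 1 (\<beta> b)" for b by (simp add: norm_q_eq \<beta>_def mult_ac)
    hence "S = {b. \<beta> b * frob 1 (\<beta> b) \<noteq> 1}" by (simp add: S_def)
    moreover have "A = {x \<in> range \<beta>. x * frob 1 x \<noteq> 1}"
      using range_norm_q2 by (auto simp: A_def \<beta>_def set_eq_iff)
    ultimately show ?thesis by auto
  qed
  finally have 1: "num_up_to_proj_equiv (L_set q ` S) = card ((\<lambda>x. {x, j x}) ` A)" .
  define C where "C = (\<lambda>x. {x, j x}) ` (A - {0})"
  have j_A: "j x \<in> A - {0}" "j x \<noteq> x" if "x \<in> A - {0}" for x
  proof -
    have x: "frob 2 x = x" "x * frob 1 x \<noteq> 1" "x \<noteq> 0" using that by (auto simp: A_def)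
    have "frob 3 x = frob 1 x" using arg_cong[OF x(1), of "frob 1"] by simp
    with x show "j x \<in> A - {0}" by (auto simp: A_def j_def field_simps)
    show "j x \<noteq> x" using x by (auto simp: j_def field_simps)
  qed
  have "2 * card C = card (\<Union>C)"
  proof (rule card_partition)
    show "card c = 2" if "c \<in> C" for c
    proof -
      from that obtain x where "x \<in> A - {0}" "c = {x, j x}" by (auto simp: C_def)
      with j_A(2)[of x] show ?thesis by (simp add: card_insert_if)
    qed
    show "c1 \<inter> c2 = {}" if "c1 \<in> C" "c2 \<in> C" "c1 \<noteq> c2" for c1 c2
    proof -
      have pair: "c = {z, j z}" if "c \<in> C" "z \<in> c" for c z
      proof -
        from that obtain x where x: "x \<in> A" "c = {x, j x}" by (auto simp: C_def)
        have "j (j x) = x" using x(1) by (intro jj) (simp add: A_def)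
        moreover have "z = x \<or> z = j x" using that(2) x(2) by simp
        ultimately show ?thesis using x(2) by (metis insert_commute)
      qed
      show ?thesis
      proof (rule ccontr)
        assume "c1 \<inter> c2 \<noteq> {}"
        then obtain z where "z \<in> c1" "z \<in> c2" by blast
        with pair that show False by metis
      qed
    qed
  qed auto
  also have "\<Union>C = A - {0}" unfolding C_def using j_A(1) by auto
  also have "card (A - {0}) = q ^ 2 - (q + 1) - 1"
  proof -
    have "A = {x. frob 2 x = x} - {x. frob 2 x = x \<and> x * frob 1 x = 1}" by (auto simp: A_def)
    hence "card A = q ^ 2 - (q + 1)"
      using card_frob_2_fixed card_norm_1_circle by (simp add: card_Diff_subset subset_eq)
    moreover have "0 \<in> A" by (simp add: A_def)
    ultimately show ?thesis by (simp add: card_Diff_singleton)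
  qed
  finally have C2: "2 * card C = q ^ 2 - (q + 1) - 1" .
  have "(\<lambda>x. {x, j x}) ` A = insert {0} C"
  proof -
    have "A = insert 0 (A - {0})" by (auto simp: A_def)
    hence "(\<lambda>x. {x, j x}) ` A = (\<lambda>x. {x, j x}) ` insert 0 (A - {0})" by (rule arg_cong)
    also have "\<dots> = insert {0, j 0} C" unfolding C_def by (rule image_insert)
    finally show ?thesis by (simp add: j_def)
  qed
  moreover have "{0} \<notin> C" by (auto simp: C_def)
  ultimately have "card ((\<lambda>x. {x, j x}) ` A) = card C + 1" by simp
  moreover have "2 * (card C + 1) = q * (q - 1)"
  proof -
    have "q * q \<ge> 2 * q" using q_ge_2 by simp
    hence "q * q - (q + 1) - 1 + 2 = q * q - q" using q_ge_2 by linarith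
    thus ?thesis using C2 by (simp add: power2_eq_square diff_mult_distrib2)
  qed
  ultimately have "card ((\<lambda>x. {x, j x}) ` A) = q * (q - 1) div 2" by simp
  moreover have "{L_set q b | b :: 'a. norm_q q b \<noteq> 1} = L_set q ` S" by (auto simp: S_def)
  ultimately show ?thesis using 1 by simp
qed

text \<open>For \<open>x\<^bsup>q+1\<^esup> = 1\<close> the two alternatives of the criterion coincide, so each of the \<open>q + 1\<close>
  solutions other than \<open>1\<close> is a class.\<close>

lemma count_norm_1:
  "num_up_to_proj_equiv {L_set q b | b :: 'a. norm_q2 q b \<noteq> 1 \<and> norm_q q b = 1} = q"
proof -
  define S where "S = {b::'a. norm_q2 q b \<noteq> 1 \<and> norm_q q b = 1}"
  define \<beta> where "\<beta> = (\<lambda>b. b * frob 2 b)"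
  have norm: "norm_q q b = \<beta> b * frob 1 (\<beta> b)" for b by (simp add: norm_q_eq \<beta>_def mult_ac)
  have "proj_equiv (L_set q b) (L_set q c) \<longleftrightarrow> \<beta> b = \<beta> c" if "b \<in> S" "c \<in> S" for b c
  proof -
    have b1: "\<beta> b * frob 1 (\<beta> b) = 1" using that(1) norm by (simp add: S_def)
    have "\<beta> c = \<beta> b" if "\<beta> c * frob 1 (\<beta> b) = 1" using b1 that by algebra
    moreover have "proj_equiv (L_set q b) (L_set q c) \<longleftrightarrow> \<beta> c = \<beta> b \<or> \<beta> c * frob 1 (\<beta> b) = 1"
      unfolding \<beta>_def by (rule proj_equiv_L_set_iff)
    ultimately show ?thesis by auto
  qed
  hence "num_up_to_proj_equiv (L_set q ` S) = card (\<beta> ` S)" by (rule num_up_to_proj_equiv_eq_card)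
  also have "\<beta> ` S = {x. frob 2 x = x \<and> x * frob 1 x = 1} - {1}"
  proof -
    have "S = {b. \<beta> b \<noteq> 1 \<and> \<beta> b * frob 1 (\<beta> b) = 1}"
      unfolding S_def norm norm_q2_eq by (simp add: \<beta>_def)
    moreover have "{x. frob 2 x = x \<and> x * frob 1 x = 1} - {1} = {x \<in> range \<beta>. x \<noteq> 1 \<and> x * frob 1 x = 1}"
      using range_norm_q2 by (auto simp: \<beta>_def set_eq_iff)
    ultimately show ?thesis by auto
  qed
  also have "card \<dots> = q" using card_norm_1_circle by (simp add: card_Diff_singleton)
  finally have "num_up_to_proj_equiv (L_set q ` S) = q" .
  moreover have "{L_set q b | b :: 'a. norm_q2 q b \<noteq> 1 \<and> norm_q q b = 1} = L_set q ` S"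
    by (auto simp: S_def)
  ultimately show ?thesis by simp
qed

end

theorem theorem4p5:
  fixes \<iota> :: "'k::{field,finite} \<Rightarrow> 'a::{field,finite}" and p h q :: nat
  assumes "prime p" and "h \<ge> 1" and "q = p ^ h"
    and "CARD('k) = q" and "CARD('a) = q ^ 4" and "field_embedding \<iota>"
  shows
    "(\<forall>b c :: 'a. semilin_equiv (L_set q b) (L_set q c) \<longleftrightarrow>
        (\<exists>s::nat. c ^ (q ^ 2 + 1) = b ^ (p ^ s * (q ^ 2 + 1)) \<or>
           (b \<noteq> 0 \<and> c ^ (q ^ 2 + 1) = b powi (- int (p ^ s * (q ^ 2 + 1))))))
     \<and> (\<forall>b c :: 'a. proj_equiv (L_set q b) (L_set q c) \<longleftrightarrow>
        (c ^ (q ^ 2 + 1) = b ^ (q ^ 2 + 1) \<or>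
           (b \<noteq> 0 \<and> c ^ (q ^ 2 + 1) = b powi (- int (q * (q ^ 2 + 1))))))
     \<and> (\<forall>b c :: 'a. norm_q2 q b = 1 \<longrightarrow> norm_q2 q c = 1 \<longrightarrow> proj_equiv (L_set q b) (L_set q c))
     \<and> (num_up_to_proj_equiv {L_set q b | b :: 'a. norm_q q b \<noteq> 1} = q * (q - 1) div 2
        \<and> (\<forall>b :: 'a. norm_q q b \<noteq> 1 \<longrightarrow> max_scattered_linear_set \<iota> (L_set q b))
        \<and> (\<forall>X. max_scattered_linear_set \<iota> X \<longrightarrow>
              (\<exists>b :: 'a. norm_q q b \<noteq> 1 \<and> proj_equiv X (L_set q b))))
     \<and> num_up_to_proj_equiv {L_set q b | b :: 'a. norm_q2 q b \<noteq> 1 \<and> norm_q q b = 1} = q"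
proof -
  interpret quartic_extension \<iota> p h q by unfold_locales (fact assms)+
  have norm: "x ^ (q ^ 2 + 1) = x * frob 2 x" for x :: 'a
    using norm_q2_eq[of x] by (simp only: norm_q2_def)
  have pow: "x ^ (n * (q ^ 2 + 1)) = (x * frob 2 x) ^ n" for x :: 'a and n
    unfolding norm[symmetric] by (simp only: power_mult[symmetric] mult.commute)
  have neg: "b \<noteq> 0 \<and> c * frob 2 c = b powi (- int (n * (q ^ 2 + 1))) \<longleftrightarrow>
      (c * frob 2 c) * (b * frob 2 b) ^ n = 1" if "n > 0" for b c :: 'a and n
  proof -
    have "b powi (- int (n * (q ^ 2 + 1))) = inverse ((b * frob 2 b) ^ n)"
      unfolding power_int_minus power_int_of_nat pow ..
    moreover have "(b * frob 2 b) ^ n = 0 \<longleftrightarrow> b = 0" using that by simp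
    ultimately show ?thesis by (metis inverse_unique mult.commute mult_zero_right right_inverse zero_neq_one)
  qed
  have q_pow: "frob 1 x = x ^ q" for x by (simp add: frob_def)
  have "\<forall>b c :: 'a. semilin_equiv (L_set q b) (L_set q c) \<longleftrightarrow>
        (\<exists>s::nat. c ^ (q ^ 2 + 1) = b ^ (p ^ s * (q ^ 2 + 1)) \<or>
           (b \<noteq> 0 \<and> c ^ (q ^ 2 + 1) = b powi (- int (p ^ s * (q ^ 2 + 1)))))"
    unfolding norm pow neg[OF zero_less_power[OF prime_gt_0_nat[OF prime_p]]] semilin_equiv_L_set_iff by blast
  moreover have ii: "\<forall>b c :: 'a. proj_equiv (L_set q b) (L_set q c) \<longleftrightarrow>
        (c ^ (q ^ 2 + 1) = b ^ (q ^ 2 + 1) \<or>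
           (b \<noteq> 0 \<and> c ^ (q ^ 2 + 1) = b powi (- int (q * (q ^ 2 + 1)))))"
    unfolding norm neg[OF q_pos(1)] proj_equiv_L_set_iff q_pow by blast
  moreover have "\<forall>b c :: 'a. norm_q2 q b = 1 \<longrightarrow> norm_q2 q c = 1 \<longrightarrow> proj_equiv (L_set q b) (L_set q c)"
    using ii unfolding norm_q2_def by simp
  ultimately show ?thesis
    using count_norm_ne_1 count_norm_1 norm_ne_1_imp_max_scattered max_scattered_imp_proj_equiv by blast
qed

end
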